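(* For every $\mathsf{B}^\mathsf{l}\subseteq\mathrm{Bin}_{lg}$ and every $n\in\mathbb{N}$, both problems $\mathrm{ATL}^3_{\mathrm{Learn}}(\{\mathbf{F}\},\emptyset,\mathsf{B}^\mathsf{l},n)$ and $\mathrm{ATL}^3_{\mathrm{Learn}}(\{\mathbf{G}\},\emptyset,\mathsf{B}^\mathsf{l},n)$ are NP-complete.
   Context: $\mathrm{Bin}_{lg}$ is the set of binary logical operators $\vee,\wedge,\Rightarrow,\Leftarrow,\Leftrightarrow$ and their negations. A concurrent game structure (CGS) with agents $\mathrm{Ag}=\{1,\dots,k\}$: finite states $Q$, initial states $I\subseteq Q$, labelling $\pi:Q\to2^{\mathsf{Prop}}$, actions $d(q,a)\ge1$ per state and agent, transition function $\delta(q,\alpha_1,\dots,\alpha_k)\in Q$; size = number of tuples $(q,\alpha_1,\dots,\alpha_k)$ plus $|\mathsf{Prop}|$. Strategies map histories to actions; $\mathrm{Out}(q,s)$ = infinite paths from $q$ consistent with the profile $s$ of a coalition. $\mathrm{ATL}^k(\mathsf{Prop},\mathsf{U}^\mathsf{t},\emptyset,\mathsf{B}^\mathsf{l})$: $\phi::=p\mid\phi*\phi\ ( *\in\mathsf{B}^\mathsf{l})\mid\langle\!\langle A\rangle\!\rangle\circ\phi$ with $A\subseteq\mathrm{Ag}$, $\circ\in\mathsf{U}^\mathsf{t}$ (here $\mathsf{U}^\mathsf{t}=\{\mathbf{F}\}$ or $\{\mathbf{G}\}$, so the negation operator is not available); $q\models\langle\!\langle A\rangle\!\rangle\circ\phi$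 iff some profile of $A$ makes every outcome path $\rho$ from $q$ satisfy $\circ\phi$ ($\mathbf{F}\phi$: some $\rho[i]\models\phi$; $\mathbf{G}\phi$: all $\rho[i]\models\phi$). A CGS satisfies $\phi$ iff all initial states do. $|\phi|$ = number of distinct subformulas; $|\phi|_{\mathrm{Bin}}$ = number of distinct subformulas $\phi_1*\phi_2$. $\mathrm{ATL}^3_{\mathrm{Learn}}(\mathsf{U}^\mathsf{t},\emptyset,\mathsf{B}^\mathsf{l},n)$: input $(\mathsf{Prop},\mathcal{P},\mathcal{N},B)$ with finite sets of $3$-agent CGS and $B$ in unary; yes iff some $\phi$ in the fragment with $|\phi|\le B$, $|\phi|_{\mathrm{Bin}}\le n$ holds on all structures of $\mathcal{P}$ and fails on all of $\mathcal{N}$. *)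

theory Defs
  imports Complex_Main "HOL-Computational_Algebra.Polynomial"
begin

section \<open>Polynomial time and NP-completeness\<close>

text \<open>
  The machine model is the deterministic Turing machine with finitely many two-way infinite tapes.
  States are \<open>0, \<dots>, nstates - 1\<close>, where \<open>0\<close> is the start state and \<open>1\<close> the only halting state.
  Tape symbols are \<open>0, \<dots>, nsyms - 1\<close>: \<open>0\<close> is the blank, \<open>1\<close> and \<open>2\<close> are the two input
  bits, the others are work symbols. The input is on the first tape, the output on the last one.
\<close>

datatype head_move = Move_Left | Stay | Move_Right

record tm =
  ntapes :: nat
  nstates :: nat
  nsyms :: nat
  delta :: "nat \<Rightarrow> nat list \<Rightarrow> nat \<times> (nat \<times> head_move) list"

definition wf_tm :: "tm \<Rightarrow> bool" where
  "wf_tm M \<longleftrightarrow> ntapes M \<ge> 1 \<and> nstates M \<ge> 2 \<and> nsyms M \<ge> 3 \<and>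
     (\<forall>q < nstates M. \<forall>as. length as = ntapes M \<and> set as \<subseteq> {..<nsyms M} \<longrightarrow>
        fst (delta M q as) < nstates M \<and>
        length (snd (delta M q as)) = ntapes M \<and>
        fst ` set (snd (delta M q as)) \<subseteq> {..<nsyms M})"

text \<open>A tape is the position of its head together with its contents.\<close>

type_synonym tape = "int \<times> (int \<Rightarrow> nat)"
type_synonym config = "nat \<times> tape list"

fun move_offset :: "head_move \<Rightarrow> int" where
  "move_offset Move_Left = -1"
| "move_offset Stay = 0"
| "move_offset Move_Right = 1"

definition read_tape :: "tape \<Rightarrow> nat" where
  "read_tape t = snd t (fst t)"

definition act_tape :: "nat \<times> head_move \<Rightarrow> tape \<Rightarrow> tape" where
  "act_tape a t = (fst t + move_offset (snd a), (snd t)(fst t := fst a))"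

definition tm_step :: "tm \<Rightarrow> config \<Rightarrow> config" where
  "tm_step M c =
     (if fst c = 1 then c
      else let r = delta M (fst c) (map read_tape (snd c))
           in (fst r, map2 act_tape (snd r) (snd c)))"

definition tape_word :: "bool list \<Rightarrow> int \<Rightarrow> nat" where
  "tape_word w i = (if 0 \<le> i \<and> i < int (length w) then (if w ! nat i then 2 else 1) else 0)"

definition tm_init :: "tm \<Rightarrow> bool list \<Rightarrow> config" where
  "tm_init M w = (0, (0, tape_word w) # replicate (ntapes M - 1) (0, tape_word []))"

definition computes_in_time :: "tm \<Rightarrow> (bool list \<Rightarrow> bool list) \<Rightarrow> (nat \<Rightarrow> nat) \<Rightarrow> bool" where
  "computes_in_time M f T \<longleftrightarrow>
     (\<forall>w. let c = (tm_step M ^^ T (length w)) (tm_init M w)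
          in fst c = 1 \<and> snd (last (snd c)) = tape_word (f w))"

definition poly_time_computable :: "(bool list \<Rightarrow> bool list) \<Rightarrow> bool" where
  "poly_time_computable f \<longleftrightarrow> (\<exists>M (p :: nat poly). wf_tm M \<and> computes_in_time M f (poly p))"

type_synonym language = "bool list set"

definition P_class :: "language set" where
  "P_class = {L. poly_time_computable (\<lambda>w. [w \<in> L])}"

definition word_pair :: "bool list \<Rightarrow> bool list \<Rightarrow> bool list" where
  "word_pair x u = concat (map (\<lambda>b. [b, b]) x) @ [False, True] @ u"

definition NP_class :: "language set" where
  "NP_class = {L. \<exists>V \<in> P_class. \<exists>p :: nat poly. \<forall>x.
     x \<in> L \<longleftrightarrow> (\<exists>u. length u \<le> poly p (length x) \<and> word_pair x u \<in> V)}"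

definition poly_time_reducible :: "language \<Rightarrow> language \<Rightarrow> bool" where
  "poly_time_reducible L L' \<longleftrightarrow> (\<exists>f. poly_time_computable f \<and> (\<forall>x. x \<in> L \<longleftrightarrow> f x \<in> L'))"

definition NP_hard :: "language \<Rightarrow> bool" where
  "NP_hard L \<longleftrightarrow> (\<forall>L' \<in> NP_class. poly_time_reducible L' L)"

definition NP_complete :: "language \<Rightarrow> bool" where
  "NP_complete L \<longleftrightarrow> L \<in> NP_class \<and> NP_hard L"


section \<open>Concurrent game structures\<close>

text \<open>
  The \<open>k\<close> agents are \<open>0, \<dots>, k - 1\<close>, and the actions of agent \<open>a\<close> at state \<open>q\<close> are
  \<open>0, \<dots>, num_act C q a - 1\<close>; component \<open>a\<close> of an action tuple is the action of agent \<open>a\<close>.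
\<close>

record ('q, 'p) cgs =
  states :: "'q set"
  init :: "'q set"
  label :: "'q \<Rightarrow> 'p set"
  num_act :: "'q \<Rightarrow> nat \<Rightarrow> nat"
  trans :: "'q \<Rightarrow> nat list \<Rightarrow> 'q"

definition act_tuples :: "nat \<Rightarrow> ('q, 'p) cgs \<Rightarrow> 'q \<Rightarrow> nat list set" where
  "act_tuples k C q = {\<alpha>. length \<alpha> = k \<and> (\<forall>a < k. \<alpha> ! a < num_act C q a)}"

definition is_cgs :: "nat \<Rightarrow> 'p set \<Rightarrow> ('q, 'p) cgs \<Rightarrow> bool" where
  "is_cgs k Props C \<longleftrightarrow> finite (states C) \<and> init C \<subseteq> states C \<and>
     (\<forall>q \<in> states C. label C q \<subseteq> Props \<and>
        (\<forall>a < k. num_act C q a \<ge> 1) \<and>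
        (\<forall>\<alpha> \<in> act_tuples k C q. trans C q \<alpha> \<in> states C))"

definition cgs_size :: "nat \<Rightarrow> 'p set \<Rightarrow> ('q, 'p) cgs \<Rightarrow> nat" where
  "cgs_size k Props C = card (SIGMA q : states C. act_tuples k C q) + card Props"

definition is_strategy :: "('q, 'p) cgs \<Rightarrow> nat \<Rightarrow> ('q list \<Rightarrow> nat) \<Rightarrow> bool" where
  "is_strategy C a s \<longleftrightarrow>
     (\<forall>h. h \<noteq> [] \<and> set h \<subseteq> states C \<longrightarrow> s h < num_act C (last h) a)"

definition is_profile :: "('q, 'p) cgs \<Rightarrow> nat set \<Rightarrow> (nat \<Rightarrow> 'q list \<Rightarrow> nat) \<Rightarrow> bool" where
  "is_profile C A s \<longleftrightarrow> (\<forall>a \<in> A. is_strategy C a (s a))"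

definition outcomes ::
  "nat \<Rightarrow> ('q, 'p) cgs \<Rightarrow> nat set \<Rightarrow> 'q \<Rightarrow> (nat \<Rightarrow> 'q list \<Rightarrow> nat) \<Rightarrow> (nat \<Rightarrow> 'q) set" where
  "outcomes k C A q s = {\<rho>. \<rho> 0 = q \<and>
     (\<forall>i. \<exists>\<alpha> \<in> act_tuples k C (\<rho> i).
        (\<forall>a \<in> A. \<alpha> ! a = s a (map \<rho> [0..<Suc i])) \<and> \<rho> (Suc i) = trans C (\<rho> i) \<alpha>)}"


section \<open>Alternating-time temporal logic\<close>

datatype bin_lg = Or | And | Imp | RevImp | Iff | NotOr | NotAnd | NotImp | NotRevImp | NotIff

fun bin_sem :: "bin_lg \<Rightarrow> bool \<Rightarrow> bool \<Rightarrow> bool" where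
  "bin_sem Or x y = (x \<or> y)"
| "bin_sem And x y = (x \<and> y)"
| "bin_sem Imp x y = (x \<longrightarrow> y)"
| "bin_sem RevImp x y = (y \<longrightarrow> x)"
| "bin_sem Iff x y = (x \<longleftrightarrow> y)"
| "bin_sem NotOr x y = (\<not> (x \<or> y))"
| "bin_sem NotAnd x y = (\<not> (x \<and> y))"
| "bin_sem NotImp x y = (\<not> (x \<longrightarrow> y))"
| "bin_sem NotRevImp x y = (\<not> (y \<longrightarrow> x))"
| "bin_sem NotIff x y = (\<not> (x \<longleftrightarrow> y))"

datatype temp_op = Finally | Globally

fun temp_sem :: "temp_op \<Rightarrow> (nat \<Rightarrow> bool) \<Rightarrow> bool" where
  "temp_sem Finally P = (\<exists>i. P i)"
| "temp_sem Globally P = (\<forall>i. P i)"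

datatype 'p atl =
    Atom 'p
  | Bin bin_lg "'p atl" "'p atl"
  | Strat "nat set" temp_op "'p atl"

inductive_set ATL :: "nat \<Rightarrow> 'p set \<Rightarrow> temp_op set \<Rightarrow> bin_lg set \<Rightarrow> 'p atl set"
  for k Props Ut Bl where
  "p \<in> Props \<Longrightarrow> Atom p \<in> ATL k Props Ut Bl"
| "b \<in> Bl \<Longrightarrow> \<phi> \<in> ATL k Props Ut Bl \<Longrightarrow> \<psi> \<in> ATL k Props Ut Bl \<Longrightarrow> Bin b \<phi> \<psi> \<in> ATL k Props Ut Bl"
| "A \<subseteq> {..<k} \<Longrightarrow> t \<in> Ut \<Longrightarrow> \<phi> \<in> ATL k Props Ut Bl \<Longrightarrow> Strat A t \<phi> \<in> ATL k Props Ut Bl"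

primrec subformulas :: "'p atl \<Rightarrow> 'p atl set" where
  "subformulas (Atom p) = {Atom p}"
| "subformulas (Bin b \<phi> \<psi>) = insert (Bin b \<phi> \<psi>) (subformulas \<phi> \<union> subformulas \<psi>)"
| "subformulas (Strat A t \<phi>) = insert (Strat A t \<phi>) (subformulas \<phi>)"

definition atl_size :: "'p atl \<Rightarrow> nat" where
  "atl_size \<phi> = card (subformulas \<phi>)"

definition atl_size_Bin :: "'p atl \<Rightarrow> nat" where
  "atl_size_Bin \<phi> = card {\<psi> \<in> subformulas \<phi>. \<exists>b \<psi>\<^sub>1 \<psi>\<^sub>2. \<psi> = Bin b \<psi>\<^sub>1 \<psi>\<^sub>2}"

primrec sat :: "nat \<Rightarrow> ('q, 'p) cgs \<Rightarrow> 'p atl \<Rightarrow> 'q \<Rightarrow> bool" where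
  "sat k C (Atom p) q \<longleftrightarrow> p \<in> label C q"
| "sat k C (Bin b \<phi> \<psi>) q \<longleftrightarrow> bin_sem b (sat k C \<phi> q) (sat k C \<psi> q)"
| "sat k C (Strat A t \<phi>) q \<longleftrightarrow>
     (\<exists>s. is_profile C A s \<and> (\<forall>\<rho> \<in> outcomes k C A q s. temp_sem t (\<lambda>i. sat k C \<phi> (\<rho> i))))"

definition cgs_sat :: "nat \<Rightarrow> ('q, 'p) cgs \<Rightarrow> 'p atl \<Rightarrow> bool" where
  "cgs_sat k C \<phi> \<longleftrightarrow> (\<forall>q \<in> init C. sat k C \<phi> q)"


section \<open>The learning problem\<close>

definition learnable ::
  "nat \<Rightarrow> temp_op set \<Rightarrow> bin_lg set \<Rightarrow> nat \<Rightarrow>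
   'p set \<Rightarrow> ('q, 'p) cgs set \<Rightarrow> ('q, 'p) cgs set \<Rightarrow> nat \<Rightarrow> bool" where
  "learnable k Ut Bl n Props Pos Neg B \<longleftrightarrow>
     (\<exists>\<phi> \<in> ATL k Props Ut Bl. atl_size \<phi> \<le> B \<and> atl_size_Bin \<phi> \<le> n \<and>
        (\<forall>C \<in> Pos. cgs_sat k C \<phi>) \<and> (\<forall>C \<in> Neg. \<not> cgs_sat k C \<phi>))"

text \<open>
  To present instances as words, propositions and states are named by initial segments of the
  natural numbers. The word of a structure lists, state by state, initiality, labelling, action
  counts and the table of transitions for all action tuples in lexicographic order. Numbers are
  written in unary: all but the bound \<open>B\<close>, which is unary by definition, are at most linear in the
  size of the instance, so the length of the word is polynomially related to that size (see
  the lemmas \<open>length_enc_cgs_le\<close> and \<open>cgs_size_le\<close> below).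
\<close>

definition enc_nat :: "nat \<Rightarrow> bool list" where
  "enc_nat n = replicate n True @ [False]"

definition enc_state :: "nat \<Rightarrow> nat \<Rightarrow> (nat, nat) cgs \<Rightarrow> nat \<Rightarrow> bool list" where
  "enc_state k m C q =
     [q \<in> init C] @ map (\<lambda>p. p \<in> label C q) [0..<m] @
     concat (map (\<lambda>a. enc_nat (num_act C q a)) [0..<k]) @
     concat (map (\<lambda>\<alpha>. enc_nat (trans C q \<alpha>))
       (product_lists (map (\<lambda>a. [0..<num_act C q a]) [0..<k])))"

definition enc_cgs :: "nat \<Rightarrow> nat \<Rightarrow> (nat, nat) cgs \<Rightarrow> bool list" where
  "enc_cgs k m C =
     enc_nat (card (states C)) @ concat (map (enc_state k m C) [0..<card (states C)])"

definition enc_instance ::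
  "nat \<Rightarrow> nat \<Rightarrow> (nat, nat) cgs list \<Rightarrow> (nat, nat) cgs list \<Rightarrow> nat \<Rightarrow> bool list" where
  "enc_instance k m Ps Ns B =
     enc_nat m @
     enc_nat (length Ps) @ concat (map (enc_cgs k m) Ps) @
     enc_nat (length Ns) @ concat (map (enc_cgs k m) Ns) @
     enc_nat B"

definition std_cgs :: "nat \<Rightarrow> nat \<Rightarrow> (nat, nat) cgs \<Rightarrow> bool" where
  "std_cgs k m C \<longleftrightarrow> is_cgs k {..<m} C \<and> states C = {..<card (states C)}"

definition ATL_Learn :: "nat \<Rightarrow> temp_op set \<Rightarrow> bin_lg set \<Rightarrow> nat \<Rightarrow> language" where
  "ATL_Learn k Ut Bl n =
     {enc_instance k m Ps Ns B | m Ps Ns B.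
        (\<forall>C \<in> set Ps \<union> set Ns. std_cgs k m C) \<and>
        learnable k Ut Bl n {..<m} (set Ps) (set Ns) B}"

lemma set_product_lists_act_tuples:
  "set (product_lists (map (\<lambda>a. [0..<num_act C q a]) [0..<k])) = act_tuples k C q"
  unfolding product_lists_set act_tuples_def
  by (auto simp: list_all2_conv_all_nth)

lemma length_product_lists_act_tuples:
  "length (product_lists (map (\<lambda>a. [0..<num_act C q a]) [0..<k])) = card (act_tuples k C q)"
proof -
  have "distinct (product_lists (map (\<lambda>a. [0..<num_act C q a]) [0..<k]))"
    by (rule distinct_product_lists) auto
  then show ?thesis
    by (metis distinct_card set_product_lists_act_tuples)
qed

lemma finite_act_tuples: "finite (act_tuples k C q)"
  by (metis List.finite_set set_product_lists_act_tuples)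

lemma num_act_le_card_act_tuples:
  assumes "\<forall>a < k. num_act C q a \<ge> 1" and "a < k"
  shows "num_act C q a \<le> card (act_tuples k C q)"
proof -
  let ?f = "\<lambda>i. (replicate k 0)[a := i]"
  have "inj_on ?f {..<num_act C q a}"
    using assms(2) by (auto intro!: inj_onI) (metis length_replicate nth_list_update_eq)
  moreover have "?f ` {..<num_act C q a} \<subseteq> act_tuples k C q"
    using assms by (fastforce simp: act_tuples_def nth_list_update)
  ultimately show ?thesis
    by (metis card_inj_on_le card_lessThan finite_act_tuples)
qed

lemma card_act_tuples_pos:
  assumes "\<forall>a < k. num_act C q a \<ge> 1"
  shows "card (act_tuples k C q) \<ge> 1"
proof -
  have "replicate k 0 \<in> act_tuples k C q"
    using assms by (fastforce simp: act_tuples_def)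
  then show ?thesis
    by (metis One_nat_def Suc_leI card_gt_0_iff empty_iff finite_act_tuples)
qed

lemma length_enc_nat: "length (enc_nat n) = Suc n"
  by (simp add: enc_nat_def)

lemma length_concat_map: "length (concat (map f xs)) = (\<Sum>x\<leftarrow>xs. length (f x))"
  by (simp add: length_concat comp_def)

lemma cgs_size_eq_sum:
  assumes "finite (states C)"
  shows "cgs_size k {..<m} C = (\<Sum>q \<in> states C. card (act_tuples k C q)) + m"
  using assms by (simp add: cgs_size_def finite_act_tuples)

lemma length_enc_state:
  "length (enc_state k m C q) =
     Suc m + (\<Sum>a<k. Suc (num_act C q a)) +
     (\<Sum>\<alpha>\<leftarrow>product_lists (map (\<lambda>a. [0..<num_act C q a]) [0..<k]). Suc (trans C q \<alpha>))"
  by (simp add: enc_state_def length_concat_map length_enc_nat atLeast0LessThan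
      interv_sum_list_conv_sum_set_nat del: sum_list_Suc)

lemma length_enc_cgs:
  "length (enc_cgs k m C) =
     Suc (card (states C)) + (\<Sum>q<card (states C). length (enc_state k m C q))"
  by (simp add: enc_cgs_def length_concat_map length_enc_nat atLeast0LessThan
      interv_sum_list_conv_sum_set_nat)

lemma length_enc_cgs_le:
  assumes "std_cgs k m C"
  shows "length (enc_cgs k m C) \<le> (2 * k + 2) * (cgs_size k {..<m} C + 1) ^ 2"
proof -
  define N where "N = card (states C)"
  define T where "T q = card (act_tuples k C q)" for q
  define S where "S = (\<Sum>q<N. T q)"
  have st: "states C = {..<N}" and cgs: "is_cgs k {..<m} C"
    using assms by (auto simp: std_cgs_def N_def)
  have size: "cgs_size k {..<m} C = S + m"
    using cgs_size_eq_sum[of C k m] by (simp add: st S_def T_def)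
  have acts: "\<forall>a < k. num_act C q a \<ge> 1" if "q < N" for q
    using cgs that by (auto simp: is_cgs_def st)
  have Tpos: "T q \<ge> 1" if "q < N" for q
    unfolding T_def by (rule card_act_tuples_pos) (rule acts[OF that])
  have "(\<Sum>q<N. 1) \<le> S"
    unfolding S_def using Tpos by (intro sum_mono) auto
  then have NS: "N \<le> S" by simp
  have st_le: "length (enc_state k m C q) \<le> Suc m + k * (T q + 1) + T q * N" if q: "q < N" for q
  proof -
    have "(\<Sum>a<k. Suc (num_act C q a)) \<le> (\<Sum>a<k. T q + 1)"
      using num_act_le_card_act_tuples[OF acts[OF q]] by (intro sum_mono) (auto simp: T_def)
    then have 1: "(\<Sum>a<k. Suc (num_act C q a)) \<le> k * (T q + 1)" by simp
    let ?xs = "product_lists (map (\<lambda>a. [0..<num_act C q a]) [0..<k])"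
    have "Suc (trans C q \<alpha>) \<le> N" if "\<alpha> \<in> set ?xs" for \<alpha>
      using cgs q that unfolding set_product_lists_act_tuples by (fastforce simp: is_cgs_def st)
    then have "(\<Sum>\<alpha>\<leftarrow>?xs. Suc (trans C q \<alpha>)) \<le> (\<Sum>\<alpha>\<leftarrow>?xs. N)"
      by (rule sum_list_mono)
    then have 2: "(\<Sum>\<alpha>\<leftarrow>?xs. Suc (trans C q \<alpha>)) \<le> T q * N"
      by (simp only: sum_list_triv of_nat_id length_product_lists_act_tuples T_def)
    show ?thesis using 1 2 unfolding length_enc_state by linarith
  qed
  have "(\<Sum>q<N. length (enc_state k m C q)) \<le> (\<Sum>q<N. Suc m + k * (T q + 1) + T q * N)"
    using st_le by (intro sum_mono) auto
  also have "\<dots> = N * Suc m + k * (S + N) + S * N"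
    by (simp only: S_def sum.distrib sum_constant card_lessThan of_nat_id mult_1_right
        flip: sum_distrib_left sum_distrib_right)
  also have "\<dots> \<le> S * Suc m + k * (S + S) + S * S"
    using NS by (intro add_mono mult_mono) auto
  finally have "length (enc_cgs k m C) \<le> Suc S + (S * Suc m + k * (S + S) + S * S)"
    using NS by (simp add: length_enc_cgs N_def[symmetric])
  also have "\<dots> \<le> (2 * k + 2) * (S + m + 1) ^ 2"
    by (simp add: power2_eq_square algebra_simps)
  finally show ?thesis by (simp add: size)
qed

lemma cgs_size_le:
  assumes "std_cgs k m C"
  shows "cgs_size k {..<m} C \<le> length (enc_cgs k m C) + m"
proof -
  define N where "N = card (states C)"
  have st: "states C = {..<N}"
    using assms by (auto simp: std_cgs_def N_def)
  have "card (act_tuples k C q) \<le> length (enc_state k m C q)" for q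
  proof -
    let ?xs = "product_lists (map (\<lambda>a. [0..<num_act C q a]) [0..<k])"
    have "length ?xs \<le> (\<Sum>\<alpha>\<leftarrow>?xs. Suc (trans C q \<alpha>))"
      by (simp add: sum_list_Suc)
    then show ?thesis
      by (simp only: length_enc_state length_product_lists_act_tuples)
  qed
  then have "(\<Sum>q<N. card (act_tuples k C q)) \<le> (\<Sum>q<N. length (enc_state k m C q))"
    by (intro sum_mono) auto
  then show ?thesis
    using cgs_size_eq_sum[of C k m] by (simp add: st length_enc_cgs)
qed

end

theory Submission
  imports Defs
begin

text \<open>
  Membership in NP. A formula of size at most \<open>B\<close> is a directed acyclic graph with at most \<open>B\<close> nodes.
  The certificate consists of this graph and the decoded structures; the verifier encodes the
  structures again, compares the result with the input, and evaluates the nodes one by one, iterating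
  the controllable predecessor operator for the strategic ones. Polynomial time is handled by
  structured programs on finitely many registers. They run on Turing machines because a program has
  only finitely many continuations, and the functions on coded data types that they compute are closed
  under composition and under loops with bounded results.

  Hardness. The runs of a nondeterministic machine are described by clauses over \<open>N\<close> variables. A chain
  is a structure with states \<open>l, \<dots>, 0\<close> where leaving a state needs the votes of a coalition from an
  upward closed family, and only state 0 satisfies the proposition. A formula without binary operators
  is a sequence of coalitions, which walks down a chain greedily. Let the levels of a chain of length
  \<open>2N\<close> be passed alternately by agent 0 or agent 1 (a truth value) and by agent 2 (a separator). This
  chain is positive. Negative are a chain passed by any two agents, so that only single agents are of
  use, the chains in which for one clause the choices satisfying it are blocked, and the chain of length
  \<open>2N + 2\<close>. As a formula with fewer than \<open>2N\<close> nested strategic operators does not distinguish the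
  lengths \<open>2N\<close> and \<open>2N + 2\<close>, the bound \<open>B = 2N + 1\<close> leaves no room for binary operators, whatever \<open>Bl\<close>
  and \<open>n\<close> are. The operator \<open>\<^bold>G\<close> is dual to \<open>\<^bold>F\<close>: exchange positive and negative structures.
\<close>

section \<open>From structured programs to polynomial-time Turing machines\<close>

section \<open>Structured tape programs\<close>

text \<open>The size of a formula counts distinct subformulas, so its syntax tree can be
  exponentially larger than \<open>B\<close>; a graph is what keeps the certificate short. Numbers
  are coded in unary, as in the instances, so loops that count up to a number are polynomial. In the
  hardness proof the danger is that one coalition walks down several levels at once, for instance
  through several variables with the same value. The separators prevent this: no single agent passes
  two adjacent levels, so every level costs one operator, and passing all \<open>2 * N\<close>
  levels with \<open>2 * N\<close> operators assigns each coalition to its own level. The decoy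
  chain is longer by 2 rather than 1 because the levels repeat with period 2, and only lengths of
  equal parity look alike to formulas of small depth. The bound \<open>2 * N + 1\<close> counts
  these operators and the atom. A clause of any length costs one chain, so the clauses describing
  machine runs are used as they are. They are needed because \<open>NP_hard\<close> quantifies over
  all of \<open>NP_class\<close>.\<close>

datatype com =
    SKIP
  | ACT nat "nat \<Rightarrow> nat \<times> head_move"
  | SEQ com com (infixr ";;" 60)
  | IF nat "nat \<Rightarrow> bool" com com
  | WHILE nat "nat \<Rightarrow> bool" com

definition idle :: "(nat \<Rightarrow> nat) \<Rightarrow> nat \<Rightarrow> nat \<times> head_move" where
  "idle rd r = (rd r, Stay)"

text \<open>One step of control, as a function of the program and of the symbols under the heads
  only. Since it depends on nothing else, it can become the transition function of a machine whose
  states are programs.\<close>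

primrec ctl :: "com \<Rightarrow> (nat \<Rightarrow> nat) \<Rightarrow> com \<times> (nat \<Rightarrow> nat \<times> head_move)" where
  "ctl SKIP rd = (SKIP, idle rd)"
| "ctl (ACT r f) rd = (SKIP, (idle rd)(r := f (rd r)))"
| "ctl (c ;; d) rd = (if c = SKIP then (d, idle rd) else (fst (ctl c rd) ;; d, snd (ctl c rd)))"
| "ctl (IF r P c d) rd = (if P (rd r) then c else d, idle rd)"
| "ctl (WHILE r P c) rd = (if P (rd r) then c ;; WHILE r P c else SKIP, idle rd)"

definition cstep :: "com \<times> (nat \<Rightarrow> tape) \<Rightarrow> com \<times> (nat \<Rightarrow> tape)" where
  "cstep cs = (let (c, s) = cs; rd = (\<lambda>r. read_tape (s r))
     in (fst (ctl c rd), \<lambda>r. act_tape (snd (ctl c rd) r) (s r)))"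

primrec okc :: "nat \<Rightarrow> com \<Rightarrow> bool" where
  "okc K SKIP \<longleftrightarrow> True"
| "okc K (ACT r f) \<longleftrightarrow> r < K \<and> (\<forall>a<3. fst (f a) < 3)"
| "okc K (c ;; d) \<longleftrightarrow> okc K c \<and> okc K d"
| "okc K (IF r P c d) \<longleftrightarrow> r < K \<and> okc K c \<and> okc K d"
| "okc K (WHILE r P c) \<longleftrightarrow> r < K \<and> okc K c"

text \<open>
  A finite superset of the programs that remain to be executed in the course of a run, like the partial
  derivatives of a regular expression. Its elements become the states of the machine.
\<close>

primrec conts :: "com \<Rightarrow> com set" where
  "conts SKIP = {SKIP}"
| "conts (ACT r f) = {ACT r f, SKIP}"
| "conts (c ;; d) = (\<lambda>c'. c' ;; d) ` conts c \<union> conts d"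
| "conts (IF r P c d) = insert (IF r P c d) (conts c \<union> conts d)"
| "conts (WHILE r P c) = {WHILE r P c, SKIP} \<union> (\<lambda>c'. c' ;; WHILE r P c) ` conts c"

lemma finite_conts: "finite (conts c)"
  by (induction c) auto

lemma conts_refl: "c \<in> conts c"
  by (induction c) auto

lemma SKIP_in_conts: "SKIP \<in> conts c"
  by (induction c) auto

lemma conts_ctl: "c' \<in> conts c \<Longrightarrow> fst (ctl c' rd) \<in> conts c"
  by (induction c arbitrary: c') (auto simp: conts_refl SKIP_in_conts split: if_splits)

lemma okc_conts: "c' \<in> conts c \<Longrightarrow> okc K c \<Longrightarrow> okc K c'"
  by (induction c arbitrary: c') auto

lemma okc_mono: "okc K c \<Longrightarrow> K \<le> K' \<Longrightarrow> okc K' c"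
  by (induction c) auto

lemma ctl_cong:
  "okc K c \<Longrightarrow> \<forall>r<K. rd r = rd' r \<Longrightarrow>
     fst (ctl c rd) = fst (ctl c rd') \<and> (\<forall>r<K. snd (ctl c rd) r = snd (ctl c rd') r)"
  by (induction c) (auto simp: idle_def)

lemma ctl_symbols: "okc K c \<Longrightarrow> r < K \<Longrightarrow> \<forall>r<K. rd r < 3 \<Longrightarrow> fst (snd (ctl c rd) r) < 3"
  by (induction c) (auto simp: idle_def)

lemma ctl_untouched: "okc K c \<Longrightarrow> K \<le> r \<Longrightarrow> snd (ctl c rd) r = idle rd r"
  by (induction c) auto

lemma act_tape_idle [simp]: "act_tape (idle (\<lambda>r. read_tape (s r)) r) (s r) = s r"
  by (cases "s r") (simp add: act_tape_def idle_def read_tape_def)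

lemma cstep_Pair:
  "cstep (c, s) = (fst (ctl c (\<lambda>r. read_tape (s r))), \<lambda>r. act_tape (snd (ctl c (\<lambda>r. read_tape (s r))) r) (s r))"
  by (simp add: cstep_def Let_def)

lemma cstep_SKIP [simp]: "cstep (SKIP, s) = (SKIP, s)"
  by (simp add: cstep_Pair)

lemma csteps_SKIP [simp]: "(cstep ^^ t) (SKIP, s) = (SKIP, s)"
  by (induction t) auto

lemma csteps_SKIP_mono: "(cstep ^^ t) cs = (SKIP, s) \<Longrightarrow> t \<le> t' \<Longrightarrow> (cstep ^^ t') cs = (SKIP, s)"
  by (auto simp: funpow_add le_iff_add add.commute[of t])

text \<open>A tape outside the range of a program keeps its head position as well as its contents.
  The output tape is chosen like this, so it is still blank with its head at 0 when the result is
  finally written.\<close>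

lemma csteps_untouched:
  assumes "okc K c" and "K \<le> r"
  shows "snd ((cstep ^^ t) (c, s)) r = s r"
proof -
  have "okc K (fst ((cstep ^^ t) (c, s))) \<and> snd ((cstep ^^ t) (c, s)) r = s r"
  proof (induction t)
    case (Suc t)
    obtain c' s' where cs: "(cstep ^^ t) (c, s) = (c', s')" by fastforce
    have "okc K (fst (ctl c' rd))" for rd
      using okc_conts[OF conts_ctl[OF conts_refl], of K c'] Suc cs by auto
    moreover have "snd (ctl c' rd) r = idle rd r" for rd
      using ctl_untouched[of K c' r] Suc cs assms by simp
    then have "act_tape (snd (ctl c' (\<lambda>r. read_tape (s' r))) r) (s' r) = s' r"
      by (simp only: act_tape_idle)
    ultimately show ?case
      using Suc cs by (simp add: cstep_Pair)
  qed (use assms in simp)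
  then show ?thesis ..
qed

definition store0 :: "bool list \<Rightarrow> nat \<Rightarrow> tape" where
  "store0 w r = (0, tape_word (if r = 0 then w else []))"

text \<open>The machine imitates the program step by step; its state is the index of the remaining
  program in a list of \<open>conts\<close>. The finished program \<open>SKIP\<close> gets index 1,
  the halting state, and both sides stand still from there on.\<close>

lemma tm_of_com:
  assumes ok: "okc K c" and K: "K \<ge> 1"
  shows "\<exists>M. wf_tm M \<and> ntapes M = K \<and>
    (\<forall>t w. snd ((tm_step M ^^ t) (tm_init M w)) = map (snd ((cstep ^^ t) (c ;; SKIP, store0 w))) [0..<K] \<and>
       (fst ((cstep ^^ t) (c ;; SKIP, store0 w)) = SKIP \<longrightarrow> fst ((tm_step M ^^ t) (tm_init M w)) = 1))"
proof -
  \<comment> \<open>The appended \<open>SKIP\<close> makes the initial program differ from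
    \<open>SKIP\<close> even if \<open>c\<close> is \<open>SKIP\<close>: the first must be state 0,
    the second state 1.\<close>
  define c0 where "c0 = (c ;; SKIP)"
  define A where "A = conts c0 - {c0, SKIP}"
  obtain xs where xs: "set xs = A" "distinct xs"
    using finite_distinct_list[of A] finite_conts[of c0] by (auto simp: A_def)
  define ys where "ys = c0 # SKIP # xs"
  have ys: "set ys = conts c0" "distinct ys"
    using xs conts_refl[of c0] SKIP_in_conts[of c0] by (auto simp: ys_def A_def c0_def)
  define ix where "ix d = (THE i. i < length ys \<and> ys ! i = d)" for d
  have ix: "ix d < length ys \<and> ys ! ix d = d" if "d \<in> conts c0" for d
  proof -
    have "\<exists>!i. i < length ys \<and> ys ! i = d"
      using that ys by (metis in_set_conv_nth nth_eq_iff_index_eq)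
    then show ?thesis unfolding ix_def by (rule theI')
  qed
  have ixI: "ix d = i" if "i < length ys" "ys ! i = d" for d i
    using that ix[of d] ys by (metis nth_eq_iff_index_eq nth_mem)
  have ix0: "ix c0 = 0" and ix1: "ix SKIP = 1"
    by (auto intro!: ixI simp: ys_def)
  \<comment> \<open>The machine has no tapes from \<open>K\<close> on; \<open>ctl\<close> is given a
    dummy symbol for them, which by \<open>ctl_cong\<close> has no effect on the tapes below
    \<open>K\<close>.\<close>
  define rdl where "rdl as r = (if r < K then as ! r else (0::nat))" for as r
  define M where "M = \<lparr>ntapes = K, nstates = length ys, nsyms = 3,
     delta = (\<lambda>q as. (ix (fst (ctl (ys ! q) (rdl as))), map (snd (ctl (ys ! q) (rdl as))) [0..<K]))\<rparr>"
  have ok0: "okc K c0" using ok by (simp add: c0_def)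
  have okd: "okc K d" if "d \<in> conts c0" for d
    using okc_conts[OF that ok0] .
  have wf: "wf_tm M"
    unfolding wf_tm_def
  proof (intro conjI allI impI)
    fix q as assume q: "q < nstates M" and as: "length as = ntapes M \<and> set as \<subseteq> {..<nsyms M}"
    have d: "ys ! q \<in> conts c0" using q ys(1) nth_mem by (auto simp: M_def)
    show "fst (delta M q as) < nstates M"
      using ix[OF conts_ctl[OF d]] by (simp add: M_def)
    have "\<forall>r<K. rdl as r < 3" using as nth_mem by (fastforce simp: rdl_def M_def)
    then show "fst ` set (snd (delta M q as)) \<subseteq> {..<nsyms M}"
      using ctl_symbols[OF okd[OF d]] by (auto simp: M_def)
  qed (use K in \<open>auto simp: M_def ys_def\<close>)
  have sim: "let (d, s) = (cstep ^^ t) (c0, store0 w) in d \<in> conts c0 \<and>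
     (tm_step M ^^ t) (tm_init M w) = (ix d, map s [0..<K])" for t w
  proof (induction t)
    case 0
    have "map (store0 w) [0..<K] = (0, tape_word w) # replicate (K - 1) (0, tape_word [])"
      using K by (intro nth_equalityI) (auto simp: store0_def nth_Cons')
    then show ?case by (simp add: tm_init_def ix0 conts_refl M_def)
  next
    case (Suc t)
    obtain d s where ds: "(cstep ^^ t) (c0, store0 w) = (d, s)" by fastforce
    have d: "d \<in> conts c0" and tm: "(tm_step M ^^ t) (tm_init M w) = (ix d, map s [0..<K])"
      using Suc ds by auto
    define rd where "rd = (\<lambda>r. read_tape (s r))"
    have "\<forall>r<K. rd r = rdl (map read_tape (map s [0..<K])) r" by (simp add: rdl_def rd_def)
    from ctl_cong[OF okd[OF d] this] have
      cc: "fst (ctl d rd) = fst (ctl d (rdl (map read_tape (map s [0..<K]))))"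
      "\<forall>r<K. snd (ctl d rd) r = snd (ctl d (rdl (map read_tape (map s [0..<K])))) r" by auto
    have step: "tm_step M (ix d, map s [0..<K]) = (ix (fst (ctl d rd)), map (\<lambda>r. act_tape (snd (ctl d rd) r) (s r)) [0..<K])"
    proof (cases "d = SKIP")
      case True
      then show ?thesis by (simp add: tm_step_def ix1 rd_def)
    next
      case False
      then have "ix d \<noteq> 1" using ix[OF d] ix[OF SKIP_in_conts] ix1 by metis
      then show ?thesis
        using ix[OF d] cc by (auto simp: tm_step_def M_def map2_map_map intro!: nth_equalityI)
    qed
    show ?case
      using ds d tm step conts_ctl[OF d, of rd] by (simp add: cstep_Pair rd_def)
  qed
  show ?thesis
  proof (intro exI[of _ M] conjI allI wf)
    fix t w
    obtain d s where ds: "(cstep ^^ t) (c0, store0 w) = (d, s)" by fastforce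
    show "snd ((tm_step M ^^ t) (tm_init M w)) = map (snd ((cstep ^^ t) (c ;; SKIP, store0 w))) [0..<K]"
      using sim[of t w] ds by (simp add: c0_def)
    show "fst ((cstep ^^ t) (c ;; SKIP, store0 w)) = SKIP \<longrightarrow> fst ((tm_step M ^^ t) (tm_init M w)) = 1"
      using sim[of t w] ds ix1 by (auto simp: c0_def)
  qed (simp add: M_def)
qed

section \<open>Registers holding words\<close>

text \<open>The first letter of the word is under the head, so that the word is a stack growing to the left.\<close>

definition stk :: "tape \<Rightarrow> bool list \<Rightarrow> bool" where
  "stk t xs \<longleftrightarrow> snd t = (\<lambda>i. tape_word xs (i - fst t))"

definition rep :: "(nat \<Rightarrow> bool list) \<Rightarrow> (nat \<Rightarrow> tape) \<Rightarrow> bool" where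
  "rep \<sigma> s \<longleftrightarrow> (\<forall>r. stk (s r) (\<sigma> r))"

text \<open>Words are represented relative to the heads, so the claim ranges over all head
  positions. As \<open>SKIP\<close> is a fixed point of \<open>cstep\<close>, the number
  \<open>t\<close> acts as an upper bound on the time, which \<open>exec_conv\<close> uses.\<close>

definition exec :: "com \<Rightarrow> (nat \<Rightarrow> bool list) \<Rightarrow> nat \<Rightarrow> (nat \<Rightarrow> bool list) \<Rightarrow> bool" where
  "exec c \<sigma> t \<sigma>' \<longleftrightarrow> (\<forall>s. rep \<sigma> s \<longrightarrow> (\<exists>s'. (cstep ^^ t) (c, s) = (SKIP, s') \<and> rep \<sigma>' s'))"

abbreviation sym_of :: "bool \<Rightarrow> nat" where
  "sym_of b \<equiv> if b then 2 else 1"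

definition top_sym :: "bool list \<Rightarrow> nat" where
  "top_sym xs = (case xs of [] \<Rightarrow> 0 | b # _ \<Rightarrow> sym_of b)"

lemma top_sym_simps [simp]: "top_sym [] = 0" "top_sym (b # xs) = sym_of b"
  by (auto simp: top_sym_def)

lemma tape_word_Cons: "tape_word (b # xs) i = (if i = 0 then sym_of b else tape_word xs (i - 1))"
proof -
  have "nat i = Suc (nat (i - 1))" if "i > 0" using that by simp
  then show ?thesis by (auto simp: tape_word_def)
qed

lemma tape_word_Nil: "tape_word [] i = 0"
  by (simp add: tape_word_def)

lemma tape_word_neg: "i < 0 \<Longrightarrow> tape_word xs i = 0"
  by (simp add: tape_word_def)

lemma read_stk: "stk t xs \<Longrightarrow> read_tape t = top_sym xs"
  by (cases xs) (auto simp: stk_def read_tape_def tape_word_Cons tape_word_Nil)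

text \<open>The extra step discards the finished \<open>SKIP\<close>. The time \<open>u\<close> can
  be smaller than \<open>t + 1\<close>, because \<open>c\<close> may have reached
  \<open>SKIP\<close> before step \<open>t\<close>.\<close>

lemma csteps_SEQ:
  "(cstep ^^ t) (c, s) = (SKIP, s') \<Longrightarrow> \<exists>u\<le>t + 1. (cstep ^^ u) (c ;; d, s) = (d, s')"
proof (induction t arbitrary: c s)
  case 0
  then have "(cstep ^^ 1) (c ;; d, s) = (d, s')" by (simp add: cstep_Pair)
  then show ?case by force
next
  case (Suc t)
  show ?case
  proof (cases "c = SKIP")
    case True
    then have "(cstep ^^ 1) (c ;; d, s) = (d, s')"
      using Suc.prems by (simp add: cstep_Pair)
    then show ?thesis by force
  next
    case False
    obtain c1 s1 where c1: "cstep (c, s) = (c1, s1)" by fastforce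
    then have "(cstep ^^ t) (c1, s1) = (SKIP, s')"
      using Suc.prems by (simp add: funpow_swap1)
    from Suc.IH[OF this] obtain u where "u \<le> t + 1" "(cstep ^^ u) (c1 ;; d, s1) = (d, s')" by blast
    moreover have "cstep (c ;; d, s) = (c1 ;; d, s1)"
      using c1 False by (simp add: cstep_Pair)
    ultimately show ?thesis
      by (intro exI[of _ "Suc u"]) (simp add: funpow_swap1)
  qed
qed

lemma csteps_SEQ_SKIP:
  assumes "(cstep ^^ t) (c, s) = (SKIP, s')" and "(cstep ^^ t') (d, s') = (SKIP, s'')"
  shows "(cstep ^^ (t + t' + 1)) (c ;; d, s) = (SKIP, s'')"
proof -
  obtain u where u: "u \<le> t + 1" "(cstep ^^ u) (c ;; d, s) = (d, s')"
    using csteps_SEQ[OF assms(1)] by blast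
  have "(cstep ^^ (t' + u)) (c ;; d, s) = (SKIP, s'')"
    using u assms(2) by (simp add: funpow_add)
  then show ?thesis by (rule csteps_SKIP_mono) (use u in simp)
qed

lemma exec_conv: "exec c \<sigma> t \<sigma>' \<Longrightarrow> t \<le> t' \<Longrightarrow> \<sigma>' = \<tau> \<Longrightarrow> exec c \<sigma> t' \<tau>"
  unfolding exec_def by (metis csteps_SKIP_mono)

lemma exec_SKIP: "exec SKIP \<sigma> 0 \<sigma>"
  by (simp add: exec_def)

lemma exec_SEQ: "exec c \<sigma> t \<sigma>' \<Longrightarrow> exec d \<sigma>' u \<sigma>'' \<Longrightarrow> exec (c ;; d) \<sigma> (t + u + 1) \<sigma>''"
  unfolding exec_def by (metis csteps_SEQ_SKIP)

lemma cstep_IF: "cstep (IF r P c d, s) = (if P (read_tape (s r)) then c else d, s)"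
  by (simp add: cstep_Pair)

lemma cstep_WHILE:
  "cstep (WHILE r P c, s) = (if P (read_tape (s r)) then c ;; WHILE r P c else SKIP, s)"
  by (simp add: cstep_Pair)

lemma exec_IF:
  assumes "exec (if P (top_sym (\<sigma> r)) then c else d) \<sigma> t \<sigma>'"
  shows "exec (IF r P c d) \<sigma> (t + 1) \<sigma>'"
  unfolding exec_def
proof (intro allI impI)
  fix s assume s: "rep \<sigma> s"
  then have "read_tape (s r) = top_sym (\<sigma> r)" by (simp add: rep_def read_stk)
  then show "\<exists>s'. (cstep ^^ (t + 1)) (IF r P c d, s) = (SKIP, s') \<and> rep \<sigma>' s'"
    using assms s by (simp add: exec_def funpow_swap1 cstep_IF)
qed

lemma exec_WHILE_False:
  assumes "\<not> P (top_sym (\<sigma> r))"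
  shows "exec (WHILE r P c) \<sigma> 1 \<sigma>"
  unfolding exec_def
proof (intro allI impI)
  fix s assume s: "rep \<sigma> s"
  then have "read_tape (s r) = top_sym (\<sigma> r)" by (simp add: rep_def read_stk)
  then show "\<exists>s'. (cstep ^^ 1) (WHILE r P c, s) = (SKIP, s') \<and> rep \<sigma> s'"
    using assms s by (simp add: cstep_WHILE)
qed

lemma exec_WHILE_True:
  assumes "P (top_sym (\<sigma> r))" and "exec c \<sigma> t \<sigma>'" and "exec (WHILE r P c) \<sigma>' u \<sigma>''"
  shows "exec (WHILE r P c) \<sigma> (t + u + 2) \<sigma>''"
  unfolding exec_def
proof (intro allI impI)
  fix s assume s: "rep \<sigma> s"
  then have "read_tape (s r) = top_sym (\<sigma> r)" by (simp add: rep_def read_stk)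
  then have "cstep (WHILE r P c, s) = (c ;; WHILE r P c, s)" using assms(1) by (simp add: cstep_WHILE)
  moreover obtain s' where "(cstep ^^ (t + u + 1)) (c ;; WHILE r P c, s) = (SKIP, s')" "rep \<sigma>'' s'"
    using exec_SEQ[OF assms(2,3)] s unfolding exec_def by blast
  ultimately show "\<exists>s'. (cstep ^^ (t + u + 2)) (WHILE r P c, s) = (SKIP, s') \<and> rep \<sigma>'' s'"
    by (simp add: funpow_swap1)
qed

lemma exec_ACT:
  assumes "\<And>t. stk t (\<sigma> r) \<Longrightarrow> stk (act_tape (f (top_sym (\<sigma> r))) t) xs"
  shows "exec (ACT r f) \<sigma> 1 (\<sigma>(r := xs))"
  unfolding exec_def
proof (intro allI impI)
  fix s assume s: "rep \<sigma> s"
  then have r: "read_tape (s r) = top_sym (\<sigma> r)" by (simp add: rep_def read_stk)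
  have "(cstep ^^ 1) (ACT r f, s) = (SKIP, s(r := act_tape (f (top_sym (\<sigma> r))) (s r)))"
    by (auto simp: cstep_Pair r fun_eq_iff)
  moreover have "rep (\<sigma>(r := xs)) (s(r := act_tape (f (top_sym (\<sigma> r))) (s r)))"
    using s assms by (simp add: rep_def)
  ultimately show "\<exists>s'. (cstep ^^ 1) (ACT r f, s) = (SKIP, s') \<and> rep (\<sigma>(r := xs)) s'" by blast
qed

text \<open>A machine step writes before it moves, so a push takes two actions: step left while
  preserving the old letter, then write on the free cell.\<close>

definition PUSH :: "nat \<Rightarrow> bool \<Rightarrow> com" where
  "PUSH r b = (ACT r (\<lambda>a. (a, Move_Left)) ;; ACT r (\<lambda>_. (sym_of b, Stay)))"

definition POP :: "nat \<Rightarrow> com" where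
  "POP r = ACT r (\<lambda>_. (0, Move_Right))"

abbreviation WHN :: "nat \<Rightarrow> com \<Rightarrow> com" where
  "WHN r c \<equiv> WHILE r (\<lambda>a. a \<noteq> 0) c"

abbreviation IFT :: "nat \<Rightarrow> com \<Rightarrow> com \<Rightarrow> com" where
  "IFT r c d \<equiv> IF r (\<lambda>a. a = 2) c d"

lemma exec_PUSH: "exec (PUSH r b) \<sigma> 3 (\<sigma>(r := b # \<sigma> r))"
  unfolding exec_def
proof (intro allI impI)
  fix s assume s: "rep \<sigma> s"
  obtain h f where hf: "s r = (h, f)" by fastforce
  have f: "f = (\<lambda>i. tape_word (\<sigma> r) (i - h))"
    using s hf by (auto simp: rep_def stk_def dest: spec[of _ r])
  have "(cstep ^^ 3) (PUSH r b, s) = (SKIP, s(r := (h - 1, f(h - 1 := sym_of b))))"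
    by (auto simp: PUSH_def numeral_3_eq_3 cstep_Pair fun_eq_iff act_tape_def hf read_tape_def idle_def)
  moreover have "rep (\<sigma>(r := b # \<sigma> r)) (s(r := (h - 1, f(h - 1 := sym_of b))))"
    using s by (auto simp: rep_def stk_def f fun_eq_iff tape_word_Cons algebra_simps)
  ultimately show "\<exists>s'. (cstep ^^ 3) (PUSH r b, s) = (SKIP, s') \<and> rep (\<sigma>(r := b # \<sigma> r)) s'"
    by blast
qed

lemma exec_POP: "exec (POP r) \<sigma> 1 (\<sigma>(r := tl (\<sigma> r)))"
  unfolding POP_def
proof (rule exec_ACT)
  fix t assume "stk t (\<sigma> r)"
  then show "stk (act_tape (0, Move_Right) t) (tl (\<sigma> r))"
    by (cases "\<sigma> r") (auto simp: stk_def act_tape_def fun_eq_iff tape_word_Nil tape_word_Cons tape_word_neg algebra_simps)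
qed

lemma okc_PUSH [simp]: "okc K (PUSH r b) \<longleftrightarrow> r < K"
  by (auto simp: PUSH_def)

lemma okc_POP [simp]: "okc K (POP r) \<longleftrightarrow> r < K"
  by (simp add: POP_def)

definition EACH :: "nat \<Rightarrow> (bool \<Rightarrow> com) \<Rightarrow> com" where
  "EACH a F = WHN a (IFT a (POP a ;; F True) (POP a ;; F False))"

lemma okc_EACH [simp]: "okc K (EACH a F) \<longleftrightarrow> a < K \<and> okc K (F True) \<and> okc K (F False)"
  by (auto simp: EACH_def)

text \<open>The second hypothesis says that the body ignores register \<open>a\<close>, so popping
  commutes with it and the loop becomes a \<open>fold\<close>. The 5 additional steps per letter pay
  for the loop test, the branch, the pop and two sequencings.\<close>

lemma exec_EACH:
  assumes ex: "\<And>b \<tau>. exec (F b) \<tau> k (g b \<tau>)"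
    and g: "\<And>b \<tau> ys. g b (\<tau>(a := ys)) = (g b \<tau>)(a := ys)"
  shows "exec (EACH a F) \<sigma> ((k + 5) * length (\<sigma> a) + 1) ((fold g (\<sigma> a) \<sigma>)(a := []))"
proof (induction "\<sigma> a" arbitrary: \<sigma>)
  case Nil
  then show ?case
    unfolding EACH_def by (intro exec_conv[OF exec_WHILE_False]) (auto simp: fun_eq_iff)
next
  case (Cons b xs)
  have fold_upd: "fold g zs (\<tau>(a := ys)) = (fold g zs \<tau>)(a := ys)" for zs \<tau> ys
    by (induction zs arbitrary: \<tau>) (auto simp: g)
  have 1: "exec (POP a ;; F b) \<sigma> (k + 2) ((g b \<sigma>)(a := xs))"
    by (rule exec_conv[OF exec_SEQ[OF exec_POP ex]]) (use Cons(2)[symmetric] in \<open>auto simp: g\<close>)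
  have 2: "exec (IFT a (POP a ;; F True) (POP a ;; F False)) \<sigma> (k + 3) ((g b \<sigma>)(a := xs))"
    by (rule exec_conv[OF exec_IF[where t = "k + 2"]]) (use 1 Cons(2)[symmetric] in \<open>auto split: if_splits\<close>)
  have 3: "exec (EACH a F) ((g b \<sigma>)(a := xs)) ((k + 5) * length xs + 1) ((fold g xs ((g b \<sigma>)(a := xs)))(a := []))"
    using Cons(1)[of "(g b \<sigma>)(a := xs)"] by simp
  show ?case
    unfolding EACH_def
    by (rule exec_conv[OF exec_WHILE_True[OF _ 2 3[unfolded EACH_def]]])
       (use Cons(2)[symmetric] in \<open>auto simp: fold_upd\<close>)
qed

definition MOVE :: "nat \<Rightarrow> nat \<Rightarrow> com" where
  "MOVE a b = EACH a (PUSH b)"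

definition MOVE2 :: "nat \<Rightarrow> nat \<Rightarrow> nat \<Rightarrow> com" where
  "MOVE2 a b c = EACH a (\<lambda>v. PUSH b v ;; PUSH c v)"

definition DOUBLE :: "nat \<Rightarrow> nat \<Rightarrow> com" where
  "DOUBLE a b = EACH a (\<lambda>v. PUSH b v ;; PUSH b v)"

definition CLEAR :: "nat \<Rightarrow> com" where
  "CLEAR a = EACH a (\<lambda>_. SKIP)"

lemma okc_macros [simp]:
  "okc K (MOVE a b) \<longleftrightarrow> a < K \<and> b < K"
  "okc K (MOVE2 a b c) \<longleftrightarrow> a < K \<and> b < K \<and> c < K"
  "okc K (DOUBLE a b) \<longleftrightarrow> a < K \<and> b < K"
  "okc K (CLEAR a) \<longleftrightarrow> a < K"
  by (auto simp: MOVE_def MOVE2_def DOUBLE_def CLEAR_def)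

lemma exec_MOVE:
  assumes "a \<noteq> b"
  shows "exec (MOVE a b) \<sigma> (8 * length (\<sigma> a) + 1) (\<sigma>(a := [], b := rev (\<sigma> a) @ \<sigma> b))"
proof -
  have "fold (\<lambda>v \<tau>. \<tau>(b := v # \<tau> b)) xs \<sigma> = \<sigma>(b := rev xs @ \<sigma> b)" for xs
    by (induction xs arbitrary: \<sigma>) auto
  then show ?thesis
    unfolding MOVE_def using assms by (intro exec_conv[OF exec_EACH[OF exec_PUSH]]) (auto simp: fun_eq_iff)
qed

lemma exec_MOVE2:
  assumes "a \<noteq> b" "a \<noteq> c" "b \<noteq> c"
  shows "exec (MOVE2 a b c) \<sigma> (12 * length (\<sigma> a) + 1) (\<sigma>(a := [], b := rev (\<sigma> a) @ \<sigma> b, c := rev (\<sigma> a) @ \<sigma> c))"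
proof -
  have *: "fold (\<lambda>v \<tau>. \<tau>(b := v # \<tau> b, c := v # \<tau> c)) xs \<sigma> = \<sigma>(b := rev xs @ \<sigma> b, c := rev xs @ \<sigma> c)" for xs
    using assms by (induction xs arbitrary: \<sigma>) (auto simp: fun_eq_iff)
  show ?thesis
    unfolding MOVE2_def using assms
    by (intro exec_conv[OF exec_EACH[OF exec_SEQ[OF exec_PUSH exec_PUSH]]]) (auto simp: fun_eq_iff *)
qed

lemma exec_DOUBLE:
  assumes "a \<noteq> b"
  shows "exec (DOUBLE a b) \<sigma> (12 * length (\<sigma> a) + 1)
    (\<sigma>(a := [], b := concat (map (\<lambda>v. [v, v]) (rev (\<sigma> a))) @ \<sigma> b))"
proof -
  have *: "fold (\<lambda>v \<tau>. \<tau>(b := v # \<tau> b, b := v # (\<tau>(b := v # \<tau> b)) b)) xs \<sigma> =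
      \<sigma>(b := concat (map (\<lambda>v. [v, v]) (rev xs)) @ \<sigma> b)" for xs
    using assms by (induction xs arbitrary: \<sigma>) (auto simp: fun_eq_iff)
  show ?thesis
    unfolding DOUBLE_def using assms
    by (intro exec_conv[OF exec_EACH[OF exec_SEQ[OF exec_PUSH exec_PUSH]]]) (auto simp: fun_eq_iff *[simplified])
qed

lemma exec_CLEAR: "exec (CLEAR a) \<sigma> (5 * length (\<sigma> a) + 1) (\<sigma>(a := []))"
proof -
  have "fold (\<lambda>v \<tau>. \<tau>) xs \<sigma> = \<sigma>" for xs :: "bool list"
    by (induction xs) auto
  then show ?thesis
    unfolding CLEAR_def by (intro exec_conv[OF exec_EACH[OF exec_SKIP]]) auto
qed

definition PUSHES :: "nat \<Rightarrow> bool list \<Rightarrow> com" where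
  "PUSHES r xs = foldr (\<lambda>b c. c ;; PUSH r b) xs SKIP"

lemma okc_PUSHES [simp]: "r < K \<Longrightarrow> okc K (PUSHES r xs)"
  by (induction xs) (auto simp: PUSHES_def)

lemma exec_PUSHES: "exec (PUSHES r xs) \<sigma> (4 * length xs) (\<sigma>(r := xs @ \<sigma> r))"
proof (induction xs)
  case Nil
  then show ?case using exec_SKIP by (simp add: PUSHES_def)
next
  case (Cons b xs)
  have "exec (PUSHES r xs ;; PUSH r b) \<sigma> (4 * length (b # xs)) (\<sigma>(r := (b # xs) @ \<sigma> r))"
    by (rule exec_conv[OF exec_SEQ[OF Cons exec_PUSH]]) auto
  then show ?case by (simp only: PUSHES_def foldr.simps comp_apply)
qed

text \<open>In \<open>word_pair x y\<close> the letters of \<open>x\<close> are doubled and the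
  unequal pair \<open>False\<close>, \<open>True\<close> ends them. A pair that begins with
  \<open>True\<close> is therefore a doubled \<open>True\<close>. A loop can only test a symbol
  under a head, so the single letter in register \<open>f\<close> serves as a flag, which is popped
  at the separator.\<close>

definition UNPAIR :: "nat \<Rightarrow> nat \<Rightarrow> com" where
  "UNPAIR t f = (PUSH f True ;; WHN f (IFT 0
     (POP 0 ;; POP 0 ;; PUSH t True)
     (POP 0 ;; IFT 0 (POP 0 ;; POP f) (POP 0 ;; PUSH t False))))"

lemma okc_UNPAIR [simp]: "okc K (UNPAIR t f) \<longleftrightarrow> t < K \<and> f < K \<and> 0 < K"
  by (auto simp: UNPAIR_def)

lemma word_pair_simps [simp]:
  "word_pair [] y = False # True # y"
  "word_pair (b # x) y = b # b # word_pair x y"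
  by (auto simp: word_pair_def)

lemma length_word_pair [simp]: "length (word_pair x y) = 2 * length x + 2 + length y"
  by (induction x) auto

lemma exec_UNPAIR:
  assumes d: "t \<noteq> 0" "f \<noteq> 0" "t \<noteq> f" and "\<sigma> 0 = word_pair x y" and f: "\<sigma> f = []"
  shows "exec (UNPAIR t f) \<sigma> (20 * length x + 20) (\<sigma>(0 := y, t := rev x @ \<sigma> t))"
proof -
  define body where "body = IFT 0
     (POP 0 ;; POP 0 ;; PUSH t True)
     (POP 0 ;; IFT 0 (POP 0 ;; POP f) (POP 0 ;; PUSH t False))"
  have loop: "exec (WHN f body) \<sigma> (20 * length x + 15) (\<sigma>(0 := y, t := rev x @ \<sigma> t, f := []))"
    if "\<sigma> 0 = word_pair x y" "\<sigma> f = [True]" for \<sigma> x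
    using that
  proof (induction x arbitrary: \<sigma>)
    case Nil
    have "exec (POP 0 ;; POP f) (\<sigma>(0 := tl (\<sigma> 0))) 3 (\<sigma>(0 := y, f := []))"
      by (rule exec_conv[OF exec_SEQ[OF exec_POP exec_POP]]) (use Nil d in \<open>auto simp: fun_eq_iff\<close>)
    then have "exec (IFT 0 (POP 0 ;; POP f) (POP 0 ;; PUSH t False)) (\<sigma>(0 := tl (\<sigma> 0))) 4 (\<sigma>(0 := y, f := []))"
      by (intro exec_conv[OF exec_IF[where t = 3]]) (use Nil in auto)
    from exec_SEQ[OF exec_POP this]
    have "exec body \<sigma> 7 (\<sigma>(0 := y, f := []))"
      unfolding body_def by (intro exec_conv[OF exec_IF[where t = 6]]) (use Nil in auto)
    from exec_WHILE_True[OF _ this exec_WHILE_False] show ?case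
      by (rule exec_conv) (use Nil d in auto)
  next
    case (Cons b x)
    have b: "exec body \<sigma> 11 (\<sigma>(0 := word_pair x y, t := b # \<sigma> t))"
    proof (cases b)
      case True
      have "exec (POP 0 ;; POP 0 ;; PUSH t True) \<sigma> 7 (\<sigma>(0 := word_pair x y, t := b # \<sigma> t))"
        by (rule exec_conv[OF exec_SEQ[OF exec_POP exec_SEQ[OF exec_POP exec_PUSH]]]) (use Cons d True in \<open>auto simp: fun_eq_iff\<close>)
      then show ?thesis
        unfolding body_def by (intro exec_conv[OF exec_IF[where t = 7]]) (use Cons True in auto)
    next
      case False
      have "exec (POP 0 ;; PUSH t False) (\<sigma>(0 := tl (\<sigma> 0))) 5 (\<sigma>(0 := word_pair x y, t := b # \<sigma> t))"
        by (rule exec_conv[OF exec_SEQ[OF exec_POP exec_PUSH]]) (use Cons d False in \<open>auto simp: fun_eq_iff\<close>)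
      then have "exec (IFT 0 (POP 0 ;; POP f) (POP 0 ;; PUSH t False)) (\<sigma>(0 := tl (\<sigma> 0))) 6 (\<sigma>(0 := word_pair x y, t := b # \<sigma> t))"
        by (intro exec_conv[OF exec_IF[where t = 5]]) (use Cons False in auto)
      from exec_SEQ[OF exec_POP this] show ?thesis
        unfolding body_def by (intro exec_conv[OF exec_IF[where t = 8]]) (use Cons False in auto)
    qed
    show ?case
      by (rule exec_conv[OF exec_WHILE_True[OF _ b Cons.IH]]) (use Cons.prems d in \<open>auto simp: fun_eq_iff\<close>)
  qed
  have "exec (WHN f body) (\<sigma>(f := True # \<sigma> f)) (20 * length x + 15) (\<sigma>(0 := y, t := rev x @ \<sigma> t))"
    by (rule exec_conv[OF loop[of _ x]]) (use assms in \<open>auto simp: fun_eq_iff\<close>)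
  from exec_SEQ[OF exec_PUSH this] show ?thesis
    unfolding UNPAIR_def body_def[symmetric] by (rule exec_conv) auto
qed

text \<open>Moving letter by letter between stacks reverses a word. The detour through
  \<open>k + 1\<close> restores the order, and \<open>MOVE2\<close> leaves one copy in register 0
  and one in \<open>k\<close>.\<close>

definition SAVE :: "nat \<Rightarrow> com" where
  "SAVE k = (MOVE 0 (k + 1) ;; MOVE2 (k + 1) 0 k)"

definition RESTORE :: "nat \<Rightarrow> com" where
  "RESTORE k = (MOVE k (k + 1) ;; MOVE (k + 1) 0)"

lemma okc_SAVE [simp]: "okc K (SAVE k) \<longleftrightarrow> k + 1 < K" "okc K (RESTORE k) \<longleftrightarrow> k + 1 < K"
  by (auto simp: SAVE_def RESTORE_def)

lemma exec_SAVE: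
  assumes "k > 0" "\<sigma> k = []" "\<sigma> (k + 1) = []"
  shows "exec (SAVE k) \<sigma> (20 * length (\<sigma> 0) + 3) (\<sigma>(k := \<sigma> 0))"
  unfolding SAVE_def
  by (rule exec_conv[OF exec_SEQ[OF exec_MOVE exec_MOVE2]]) (use assms in \<open>auto simp: fun_eq_iff\<close>)

lemma exec_RESTORE:
  assumes "k > 0" "\<sigma> 0 = []" "\<sigma> (k + 1) = []"
  shows "exec (RESTORE k) \<sigma> (16 * length (\<sigma> k) + 3) (\<sigma>(0 := \<sigma> k, k := []))"
  unfolding RESTORE_def
  by (rule exec_conv[OF exec_SEQ[OF exec_MOVE exec_MOVE]]) (use assms in \<open>auto simp: fun_eq_iff\<close>)

text \<open>Both words are compared reversed, and register 0 holds the verdict as a single letter.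
  If register 3 runs empty first, its blank differs from every letter and the verdict becomes
  \<open>False\<close>; the last loop does the same for letters left over in register 3.\<close>

definition EQUAL :: com where
  "EQUAL = (UNPAIR 1 2 ;; MOVE 0 3 ;; PUSH 0 True ;;
     EACH 1 (\<lambda>b. IF 3 (\<lambda>a. a = sym_of b) (POP 3) (POP 3 ;; POP 0 ;; PUSH 0 False)) ;;
     EACH 3 (\<lambda>b. POP 0 ;; PUSH 0 False))"

lemma okc_EQUAL: "okc 4 EQUAL"
  by (auto simp: EQUAL_def)

lemma exec_EQUAL:
  assumes "\<sigma> 0 = word_pair x y" "\<sigma> 1 = []" "\<sigma> 2 = []" "\<sigma> 3 = []"
  shows "exec EQUAL \<sigma> (100 * length x + 100 * length y + 100) (\<sigma>(0 := [x = y]))"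
proof -
  define g where "g b \<tau> = \<tau>(3 := tl (\<tau> 3), 0 := if top_sym (\<tau> 3) = sym_of b then \<tau> 0 else False # tl (\<tau> 0))"
    for b :: bool and \<tau> :: "nat \<Rightarrow> bool list"
  have exg: "exec (IF 3 (\<lambda>a. a = sym_of b) (POP 3) (POP 3 ;; POP 0 ;; PUSH 0 False)) \<tau> 8 (g b \<tau>)" for b \<tau>
  proof (rule exec_conv[OF exec_IF[where t = 7]])
    have "exec (POP 3) \<tau> 7 (g b \<tau>)" if "top_sym (\<tau> 3) = sym_of b"
      by (rule exec_conv[OF exec_POP]) (use that in \<open>auto simp: g_def fun_eq_iff\<close>)
    moreover have "exec (POP 3 ;; POP 0 ;; PUSH 0 False) \<tau> 7 (g b \<tau>)" if "top_sym (\<tau> 3) \<noteq> sym_of b"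
      by (rule exec_conv[OF exec_SEQ[OF exec_POP exec_SEQ[OF exec_POP exec_PUSH]]])
         (use that in \<open>auto simp: g_def fun_eq_iff\<close>)
    ultimately show "exec (if top_sym (\<tau> 3) = sym_of b then POP 3 else POP 3 ;; POP 0 ;; PUSH 0 False) \<tau> 7 (g b \<tau>)"
      by simp
  qed auto
  have gfold: "fold g u \<tau> = \<tau>(3 := drop (length u) v, 0 := [acc \<and> take (length u) v = u])"
    if "\<tau> 0 = [acc]" "\<tau> 3 = v" for u v \<tau> acc
    using that
  proof (induction u arbitrary: v \<tau> acc)
    case Nil
    then show ?case by (auto simp: fun_eq_iff)
  next
    case (Cons b u)
    have "fold g (b # u) \<tau> = fold g u (g b \<tau>)" by simp
    also have "\<dots> = (g b \<tau>)(3 := drop (length u) (tl v), 0 := [(acc \<and> top_sym v = sym_of b) \<and> take (length u) (tl v) = u])"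
      by (rule Cons.IH) (use Cons.prems in \<open>auto simp: g_def\<close>)
    also have "\<dots> = \<tau>(3 := drop (length (b # u)) v, 0 := [acc \<and> take (length (b # u)) v = b # u])"
      by (cases v) (auto simp: g_def fun_eq_iff)
    finally show ?case .
  qed
  define h where "h b \<tau> = \<tau>(0 := False # tl (\<tau> 0))" for b :: bool and \<tau> :: "nat \<Rightarrow> bool list"
  have exh: "exec (POP 0 ;; PUSH 0 False) \<tau> 5 (h b \<tau>)" for b \<tau>
    by (rule exec_conv[OF exec_SEQ[OF exec_POP exec_PUSH]]) (auto simp: h_def)
  have hfold: "fold h u \<tau> = \<tau>(0 := [acc \<and> u = []])" if "\<tau> 0 = [acc]" for u \<tau> acc
    using that
  proof (induction u arbitrary: \<tau> acc)
    case (Cons b u)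
    have "fold h (b # u) \<tau> = fold h u (h b \<tau>)" by simp
    also have "\<dots> = (h b \<tau>)(0 := [False \<and> u = []])"
      by (rule Cons.IH) (use Cons.prems in \<open>simp add: h_def\<close>)
    also have "\<dots> = \<tau>(0 := [acc \<and> b # u = []])"
      unfolding h_def by simp
    finally show ?case .
  qed (auto simp: fun_eq_iff)
  define \<sigma>1 where "\<sigma>1 = \<sigma>(0 := [True], 1 := rev x, 3 := rev y)"
  define \<sigma>2 where "\<sigma>2 = \<sigma>(3 := drop (length x) (rev y), 0 := [take (length x) (rev y) = rev x])"
  have 2: "exec (EACH 1 (\<lambda>b. IF 3 (\<lambda>a. a = sym_of b) (POP 3) (POP 3 ;; POP 0 ;; PUSH 0 False))) \<sigma>1
      (13 * length x + 1) \<sigma>2"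
  proof (rule exec_conv[OF exec_EACH[OF exg]])
    have "fold g (\<sigma>1 1) \<sigma>1 = \<sigma>1(3 := drop (length (\<sigma>1 1)) (rev y), 0 := [True \<and> take (length (\<sigma>1 1)) (rev y) = \<sigma>1 1])"
      by (rule gfold) (auto simp: \<sigma>1_def)
    then show "(fold g (\<sigma>1 1) \<sigma>1)(1 := []) = \<sigma>2"
      using assms by (auto simp: \<sigma>1_def \<sigma>2_def fun_eq_iff)
    show "g b (\<tau>(1 := ys)) = (g b \<tau>)(1 := ys)" for b \<tau> ys
      by (auto simp: g_def fun_eq_iff)
  qed (simp add: \<sigma>1_def)
  have 3: "exec (EACH 3 (\<lambda>b. POP 0 ;; PUSH 0 False)) \<sigma>2 (10 * length y + 1) (\<sigma>(0 := [x = y]))"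
  proof (rule exec_conv[OF exec_EACH[OF exh]])
    have "(take (length x) (rev y) = rev x \<and> drop (length x) (rev y) = []) \<longleftrightarrow> x = y"
      by (metis append_Nil2 append_take_drop_id drop_all length_rev order_refl rev_rev_ident take_all)
    then show "(fold h (\<sigma>2 3) \<sigma>2)(3 := []) = \<sigma>(0 := [x = y])"
      using hfold[of \<sigma>2 "take (length x) (rev y) = rev x" "\<sigma>2 3"] assms
      by (auto simp: \<sigma>2_def fun_eq_iff)
  qed (auto simp: h_def \<sigma>2_def fun_eq_iff)
  have U: "exec (UNPAIR 1 2) \<sigma> (20 * length x + 20) (\<sigma>(0 := y, 1 := rev x))"
    by (rule exec_conv[OF exec_UNPAIR]) (use assms in auto)
  have M: "exec (MOVE 0 3) (\<sigma>(0 := y, 1 := rev x)) (8 * length y + 1) (\<sigma>(0 := [], 1 := rev x, 3 := rev y))"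
    by (rule exec_conv[OF exec_MOVE]) (use assms in \<open>auto simp: fun_eq_iff\<close>)
  have P: "exec (PUSH 0 True) (\<sigma>(0 := [], 1 := rev x, 3 := rev y)) 3 \<sigma>1"
    by (rule exec_conv[OF exec_PUSH]) (auto simp: fun_eq_iff \<sigma>1_def)
  show ?thesis
    unfolding EQUAL_def
    by (rule exec_conv[OF exec_SEQ[OF U exec_SEQ[OF M exec_SEQ[OF P exec_SEQ[OF 2 3]]]]]) auto
qed

lemma top_sym_eq_0: "top_sym xs = 0 \<longleftrightarrow> xs = []"
  by (cases xs) auto

section \<open>Polynomial bounds\<close>

lemma poly_nat_mono: "(m::nat) \<le> n \<Longrightarrow> poly p m \<le> poly p n"
  by (induction p) (auto intro!: add_mono mult_mono)

definition polyb :: "('a \<Rightarrow> nat) \<Rightarrow> ('a \<Rightarrow> nat) \<Rightarrow> bool" where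
  "polyb m T \<longleftrightarrow> (\<exists>p. \<forall>x. T x \<le> poly p (m x))"

named_theorems polyb_intro
named_theorems ptime_intro

lemma polyb_mono: "polyb m T \<Longrightarrow> (\<And>x. T' x \<le> T x) \<Longrightarrow> polyb m T'"
  unfolding polyb_def by (meson order_trans)

lemma polyb_self [polyb_intro]: "polyb m m"
  unfolding polyb_def by (intro exI[of _ "[:0, 1:]"]) simp

lemma polyb_const [polyb_intro]: "polyb m (\<lambda>_. c)"
  unfolding polyb_def by (intro exI[of _ "[:c:]"]) simp

lemma polyb_add [polyb_intro]:
  assumes "polyb m S" and "polyb m T"
  shows "polyb m (\<lambda>x. S x + T x)"
proof -
  obtain p q where "\<And>x. S x \<le> poly p (m x)" "\<And>x. T x \<le> poly q (m x)"
    using assms unfolding polyb_def by blast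
  then show ?thesis
    unfolding polyb_def by (intro exI[of _ "p + q"]) (simp add: add_mono)
qed

lemma polyb_Suc [polyb_intro]: "polyb m S \<Longrightarrow> polyb m (\<lambda>x. Suc (S x))"
  using polyb_add[OF polyb_const[of m 1]] by simp

lemma polyb_mult [polyb_intro]:
  assumes "polyb m S" and "polyb m T"
  shows "polyb m (\<lambda>x. S x * T x)"
proof -
  obtain p q where "\<And>x. S x \<le> poly p (m x)" "\<And>x. T x \<le> poly q (m x)"
    using assms unfolding polyb_def by blast
  then show ?thesis
    unfolding polyb_def by (intro exI[of _ "p * q"]) (simp add: mult_mono)
qed

lemma polyb_poly [polyb_intro]:
  assumes "polyb m T"
  shows "polyb m (\<lambda>x. poly p (T x))"
proof -
  obtain q where "\<And>x. T x \<le> poly q (m x)"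
    using assms unfolding polyb_def by blast
  then show ?thesis
    unfolding polyb_def by (intro exI[of _ "pcompose p q"]) (simp add: poly_pcompose poly_nat_mono)
qed

lemma polyb_trans:
  assumes "polyb m' T" and "polyb m (\<lambda>x. m' (f x))"
  shows "polyb m (\<lambda>x. T (f x))"
proof -
  obtain p where "\<And>x. T x \<le> poly p (m' x)" using assms(1) unfolding polyb_def by blast
  then show ?thesis by (intro polyb_mono[OF polyb_poly[OF assms(2), of p]])
qed

section \<open>A calculus of polynomial-time functions on coded data\<close>

section \<open>Data types coded by words\<close>

text \<open>Only decoding after encoding has to be the identity. A certificate may be any word; a
  word that is no code decodes to some value, and the verifier judges that value.\<close>

class bitcoded =
  fixes bits :: "'a \<Rightarrow> bool list" and unbits :: "bool list \<Rightarrow> 'a"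
  assumes unbits_bits [simp]: "unbits (bits x) = x"

abbreviation bsize :: "'a::bitcoded \<Rightarrow> nat" where
  "bsize x \<equiv> length (bits x)"

lemma bits_inject [simp]: "bits x = bits y \<longleftrightarrow> x = y"
  by (metis unbits_bits)

instantiation bool :: bitcoded begin
definition "bits (b::bool) = [b]"
definition "unbits w = hd (w :: bool list)"
instance by standard (simp add: bits_bool_def unbits_bool_def)
end

text \<open>With the unary code the size of a number is the number itself, so counting loops have
  polynomial length and polynomial bounds on values are bounds on sizes.\<close>

instantiation nat :: bitcoded begin
definition "bits n = replicate n True"
definition "unbits w = length (w :: bool list)"
instance by standard (simp add: bits_nat_def unbits_nat_def)
end

text \<open>The inverse of \<^const>\<open>word_pair\<close>, written as an iteration so that its cost is easy to bound.\<close>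

definition unw_step :: "bool \<times> bool list \<times> bool list \<Rightarrow> bool \<times> bool list \<times> bool list" where
  "unw_step s = (let d = fst s; a = fst (snd s); w = snd (snd s) in
     if d \<or> w = [] then s
     else if hd w = hd (tl w) then (False, hd w # a, tl (tl w)) else (True, a, tl (tl w)))"

definition unw :: "bool list \<Rightarrow> bool list \<times> bool list" where
  "unw w = (let s = (unw_step ^^ length w) (False, [], w) in (rev (fst (snd s)), snd (snd s)))"

lemma unw_step_stop: "(unw_step ^^ k) (True, a, w) = (True, a, w)"
proof (induction k)
  case (Suc k)
  moreover have "unw_step (True, a, w) = (True, a, w)" by (simp add: unw_step_def)
  ultimately show ?case by simp
qed simp

lemma unw_word_pair [simp]: "unw (word_pair x y) = (x, y)"
proof -
  have "(unw_step ^^ (Suc (length x) + k)) (False, a, word_pair x y) = (True, rev x @ a, y)" for a k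
  proof (induction x arbitrary: a)
    case Nil
    then show ?case by (simp del: funpow.simps add: funpow_Suc_right unw_step_stop) (simp add: unw_step_def unw_step_stop)
  next
    case (Cons b x)
    have "unw_step (False, a, word_pair (b # x) y) = (False, b # a, word_pair x y)"
      by (simp add: unw_step_def)
    then show ?case using Cons.IH[of "b # a"] by (simp del: funpow.simps add: funpow_Suc_right)
  qed
  note t = this[of "length x + 1 + length y" "[]"]
  have e: "length (word_pair x y) = Suc (length x) + (length x + 1 + length y)" by simp
  have "(unw_step ^^ length (word_pair x y)) (False, [], word_pair x y) = (True, rev x, y)"
    unfolding e using t by (simp only: append_Nil2)
  then show ?thesis by (simp add: unw_def Let_def del: length_word_pair)
qed

lemma unw_iter_size:
  "length (fst (snd ((unw_step ^^ k) s))) + length (snd (snd ((unw_step ^^ k) s)))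
     \<le> length (fst (snd s)) + length (snd (snd s))"
proof (induction k)
  case (Suc k)
  have "length (fst (snd (unw_step s))) + length (snd (snd (unw_step s)))
     \<le> length (fst (snd s)) + length (snd (snd s))" for s
    by (cases "snd (snd s)") (auto simp: unw_step_def Let_def)
  from order_trans[OF this Suc] show ?case by simp
qed simp

lemma unw_size: "length (fst (unw w)) + length (snd (unw w)) \<le> length w"
  using unw_iter_size[of "length w" "(False, [], w)"] by (simp add: unw_def Let_def)

definition unwl_step :: "bool list list \<times> bool list \<Rightarrow> bool list list \<times> bool list" where
  "unwl_step s = (if snd s = [] then s else (fst (unw (snd s)) # fst s, snd (unw (snd s))))"

definition unwl :: "bool list \<Rightarrow> bool list list" where
  "unwl w = rev (fst ((unwl_step ^^ length w) ([], w)))"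

fun pack :: "bool list list \<Rightarrow> bool list" where
  "pack [] = []"
| "pack (w # ws) = word_pair w (pack ws)"

lemma length_pack: "length ws \<le> length (pack ws)"
  by (induction ws) auto

lemma unwl_pack [simp]: "unwl (pack ws) = ws"
proof -
  have stop: "(unwl_step ^^ k) (acc, []) = (acc, [])" for acc k
  proof (induction k)
    case (Suc k)
    moreover have "unwl_step (acc, []) = (acc, [])" by (simp add: unwl_step_def)
    ultimately show ?case by simp
  qed simp
  have "(unwl_step ^^ (length ws + k)) (acc, pack ws) = (rev ws @ acc, [])" for k acc
  proof (induction ws arbitrary: acc)
    case (Cons w ws)
    have "word_pair w (pack ws) \<noteq> []" by (cases w) auto
    then have "unwl_step (acc, pack (w # ws)) = (w # acc, pack ws)"
      by (simp add: unwl_step_def del: word_pair_simps)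
    then show ?case using Cons[of "w # acc"] by (simp del: funpow.simps add: funpow_Suc_right)
  qed (simp add: stop)
  from this[of "length (pack ws) - length ws" "[]"] show ?thesis
    by (simp add: unwl_def length_pack)
qed

instantiation prod :: (bitcoded, bitcoded) bitcoded begin
definition "bits p = word_pair (bits (fst p)) (bits (snd p))"
definition "unbits w = (unbits (fst (unw w)), unbits (snd (unw w)))"
instance by standard (simp add: bits_prod_def unbits_prod_def)
end

instantiation list :: (bitcoded) bitcoded begin
definition "bits xs = pack (map bits xs)"
definition "unbits w = map unbits (unwl w)"
instance by standard (simp add: bits_list_def unbits_list_def comp_def)
end

lemma bits_simps:
  "bits b = [b]" "bits n = replicate n True" "bits (x, y) = word_pair (bits x) (bits y)"
  "bits [] = []" "bits (x # xs) = word_pair (bits x) (bits xs)"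
  by (simp_all add: bits_bool_def bits_nat_def bits_prod_def bits_list_def)

lemma bsize_simps [simp]:
  "bsize (b::bool) = 1" "bsize (n::nat) = n" "bsize p = 2 * bsize (fst p) + 2 + bsize (snd p)"
  "bsize [] = 0" "bsize (x # xs) = 2 * bsize x + 2 + bsize xs"
  by (simp_all add: bits_simps bits_prod_def)

lemma bits_eq_Nil [simp]: "bits (xs :: 'a::bitcoded list) = [] \<longleftrightarrow> xs = []"
  by (cases xs) (auto simp: bits_simps simp flip: length_0_conv)

lemma length_le_bsize: "length xs \<le> bsize xs"
  by (induction xs) auto

lemma bsize_append [simp]: "bsize (xs @ ys) = bsize xs + bsize ys"
  by (induction xs) auto

lemma bsize_rev [simp]: "bsize (rev xs) = bsize xs"
  by (induction xs) auto

lemma bsize_mem: "a \<in> set xs \<Longrightarrow> 2 * bsize a + 2 \<le> bsize xs"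
  by (induction xs) auto

lemma bsize_take: "bsize (take n xs) \<le> bsize xs"
  by (metis append_take_drop_id bsize_append le_add1)

lemma bsize_drop: "bsize (drop n xs) \<le> bsize xs"
  by (metis append_take_drop_id bsize_append le_add2)

lemma bsize_list_bound:
  assumes "\<And>a. a \<in> set xs \<Longrightarrow> bsize a \<le> B"
  shows "bsize xs \<le> length xs * (2 * B + 2)"
  using assms by (induction xs) (auto simp: add_mono, fastforce)

section \<open>Polynomial-time functions\<close>

text \<open>
  Registers from \<open>R\<close> on may hold anything and are left alone, so programs are combined by saving
  data there, without renaming registers.
\<close>

definition computes ::
  "com \<Rightarrow> nat \<Rightarrow> ('a::bitcoded \<Rightarrow> 'b::bitcoded) \<Rightarrow> ('a \<Rightarrow> nat) \<Rightarrow> bool" where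
  "computes c R f T \<longleftrightarrow> okc R c \<and> R \<ge> 1 \<and>
     (\<forall>x \<sigma>. \<sigma> 0 = bits x \<longrightarrow> (\<forall>r. 0 < r \<and> r < R \<longrightarrow> \<sigma> r = []) \<longrightarrow> exec c \<sigma> (T x) (\<sigma>(0 := bits (f x))))"

text \<open>The bound on the size of the result is what turns a time bound for an outer function
  into one for the composition in \<open>ptime_comp\<close>.\<close>

definition ptime :: "('a::bitcoded \<Rightarrow> 'b::bitcoded) \<Rightarrow> bool" where
  "ptime f \<longleftrightarrow> polyb bsize (\<lambda>x. bsize (f x)) \<and> (\<exists>c R T. polyb bsize T \<and> computes c R f T)"

lemma ptimeI:
  assumes "polyb bsize (\<lambda>x. bsize (f x))" and "polyb bsize T" and "okc R c" and "R \<ge> 1"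
    and "\<And>x \<sigma>. \<sigma> 0 = bits x \<Longrightarrow> (\<And>r. 0 < r \<Longrightarrow> r < R \<Longrightarrow> \<sigma> r = []) \<Longrightarrow> exec c \<sigma> (T x) (\<sigma>(0 := bits (f x)))"
  shows "ptime f"
  using assms unfolding ptime_def computes_def by metis

lemma ptimeE:
  assumes "ptime f"
  obtains c R T where "polyb bsize T" "okc R c" "R \<ge> 1"
    "\<And>x \<sigma>. \<sigma> 0 = bits x \<Longrightarrow> (\<And>r. 0 < r \<Longrightarrow> r < R \<Longrightarrow> \<sigma> r = []) \<Longrightarrow> exec c \<sigma> (T x) (\<sigma>(0 := bits (f x)))"
  using assms unfolding ptime_def computes_def by metis

lemma polyb_bsize [polyb_intro]: "ptime f \<Longrightarrow> polyb bsize (\<lambda>x. bsize (f x))"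
  by (simp add: ptime_def)

lemma polyb_bsize_list_length [polyb_intro]: "ptime f \<Longrightarrow> polyb bsize (\<lambda>x. length (f x))"
  by (rule polyb_mono[OF polyb_bsize]) (auto simp: length_le_bsize)

lemma polyb_nat [polyb_intro]: "ptime f \<Longrightarrow> polyb bsize (\<lambda>x. f x)"
  using polyb_bsize[of f] by simp

lemma ptime_comp:
  fixes g :: "'b::bitcoded \<Rightarrow> 'c::bitcoded" and f :: "'a::bitcoded \<Rightarrow> 'b"
  assumes "ptime g" and "ptime f"
  shows "ptime (\<lambda>x. g (f x))"
proof -
  obtain cf Rf Tf where f: "polyb bsize Tf" "okc Rf cf" "Rf \<ge> 1"
    "\<And>x \<sigma>. \<sigma> 0 = bits x \<Longrightarrow> (\<And>r. 0 < r \<Longrightarrow> r < Rf \<Longrightarrow> \<sigma> r = []) \<Longrightarrow> exec cf \<sigma> (Tf x) (\<sigma>(0 := bits (f x)))"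
    using assms(2) by (rule ptimeE) blast
  obtain cg Rg Tg where g: "polyb bsize Tg" "okc Rg cg" "Rg \<ge> 1"
    "\<And>x \<sigma>. \<sigma> 0 = bits x \<Longrightarrow> (\<And>r. 0 < r \<Longrightarrow> r < Rg \<Longrightarrow> \<sigma> r = []) \<Longrightarrow> exec cg \<sigma> (Tg x) (\<sigma>(0 := bits (g x)))"
    using assms(1) by (rule ptimeE) blast
  show ?thesis
  proof (rule ptimeI)
    show "polyb bsize (\<lambda>x. bsize (g (f x)))"
      by (rule polyb_trans[OF polyb_bsize[OF assms(1)] polyb_bsize[OF assms(2)]])
    show "polyb bsize (\<lambda>x. Tf x + Tg (f x) + 1)"
      by (intro polyb_intro f polyb_trans[OF g(1) polyb_bsize[OF assms(2)]])
    show "okc (max Rf Rg) (cf ;; cg)"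
      using okc_mono[OF f(2)] okc_mono[OF g(2)] by simp
    fix x :: 'a and \<sigma> :: "nat \<Rightarrow> bool list" assume s: "\<sigma> 0 = bits x" "\<And>r. 0 < r \<Longrightarrow> r < max Rf Rg \<Longrightarrow> \<sigma> r = []"
    have 1: "exec cf \<sigma> (Tf x) (\<sigma>(0 := bits (f x)))" by (rule f(4)) (use s in auto)
    have 2: "exec cg (\<sigma>(0 := bits (f x))) (Tg (f x)) ((\<sigma>(0 := bits (f x)))(0 := bits (g (f x))))"
      by (rule g(4)) (use s in auto)
    show "exec (cf ;; cg) \<sigma> (Tf x + Tg (f x) + 1) (\<sigma>(0 := bits (g (f x))))"
      using exec_SEQ[OF 1 2] by simp
  qed (use f(3) in auto)
qed

lemma ptime_id [ptime_intro]: "ptime (\<lambda>x. x)"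
  by (rule ptimeI[where c = SKIP and R = 1 and T = "\<lambda>_. 0"])
     (auto intro!: polyb_intro exec_conv[OF exec_SKIP] simp: fun_eq_iff)

text \<open>Register \<open>R\<close> keeps the argument, \<open>R + 1\<close> is scratch space for
  copying, and \<open>R + 2\<close> holds the reversed value of \<open>f\<close>. The code of the
  pair is built from right to left: the value of \<open>g\<close>, then the separator, then the
  doubled letters of the value of \<open>f\<close>.\<close>

lemma ptime_Pair [ptime_intro]:
  fixes f :: "'a::bitcoded \<Rightarrow> 'b::bitcoded" and g :: "'a \<Rightarrow> 'c::bitcoded"
  assumes "ptime f" and "ptime g"
  shows "ptime (\<lambda>x. (f x, g x))"
proof -
  obtain cf Rf Tf where f: "polyb bsize Tf" "okc Rf cf" "Rf \<ge> 1"
    "\<And>x \<sigma>. \<sigma> 0 = bits x \<Longrightarrow> (\<And>r. 0 < r \<Longrightarrow> r < Rf \<Longrightarrow> \<sigma> r = []) \<Longrightarrow> exec cf \<sigma> (Tf x) (\<sigma>(0 := bits (f x)))"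
    using assms(1) by (rule ptimeE) blast
  obtain cg Rg Tg where g: "polyb bsize Tg" "okc Rg cg" "Rg \<ge> 1"
    "\<And>x \<sigma>. \<sigma> 0 = bits x \<Longrightarrow> (\<And>r. 0 < r \<Longrightarrow> r < Rg \<Longrightarrow> \<sigma> r = []) \<Longrightarrow> exec cg \<sigma> (Tg x) (\<sigma>(0 := bits (g x)))"
    using assms(2) by (rule ptimeE) blast
  define R where "R = max Rf Rg"
  have R: "R > 0" "Rf \<le> R" "Rg \<le> R" using f(3) by (auto simp: R_def)
  show ?thesis
  proof (rule ptimeI)
    show "polyb bsize (\<lambda>x. bsize (f x, g x))"
      by (simp, intro polyb_intro assms)
    show "polyb bsize (\<lambda>x. Tf x + Tg x + 40 * (bsize x + bsize (f x)) + 100)"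
      by (intro polyb_intro f g assms)
    show "okc (R + 3) (SAVE R ;; cf ;; MOVE 0 (R + 2) ;; RESTORE R ;; cg ;; PUSH 0 True ;; PUSH 0 False ;; DOUBLE (R + 2) 0)"
      using okc_mono[OF f(2)] okc_mono[OF g(2)] R by simp
    fix x :: 'a and \<sigma> :: "nat \<Rightarrow> bool list" assume s: "\<sigma> 0 = bits x" "\<And>r. 0 < r \<Longrightarrow> r < R + 3 \<Longrightarrow> \<sigma> r = []"
    have 1: "exec (SAVE R) \<sigma> (20 * bsize x + 3) (\<sigma>(R := bits x))"
      by (rule exec_conv[OF exec_SAVE]) (use s R in auto)
    have 2: "exec cf (\<sigma>(R := bits x)) (Tf x) ((\<sigma>(R := bits x))(0 := bits (f x)))"
      by (rule f(4)) (use s R in auto)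
    have 3: "exec (MOVE 0 (R + 2)) ((\<sigma>(R := bits x))(0 := bits (f x))) (8 * bsize (f x) + 1)
       (\<sigma>(R := bits x, 0 := [], R + 2 := rev (bits (f x))))"
      by (rule exec_conv[OF exec_MOVE]) (use s R in \<open>auto simp: fun_eq_iff\<close>)
    have 4: "exec (RESTORE R) (\<sigma>(R := bits x, 0 := [], R + 2 := rev (bits (f x)))) (16 * bsize x + 3)
       (\<sigma>(R + 2 := rev (bits (f x))))"
      by (rule exec_conv[OF exec_RESTORE]) (use s R in \<open>auto simp: fun_eq_iff\<close>)
    have 5: "exec cg (\<sigma>(R + 2 := rev (bits (f x)))) (Tg x) ((\<sigma>(R + 2 := rev (bits (f x))))(0 := bits (g x)))"
      by (rule g(4)) (use s R in auto)
    have 6: "exec (DOUBLE (R + 2) 0) (\<sigma>(R + 2 := rev (bits (f x)), 0 := False # True # bits (g x)))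
        (12 * bsize (f x) + 1) (\<sigma>(0 := bits (f x, g x)))"
      by (rule exec_conv[OF exec_DOUBLE]) (use s R in \<open>auto simp: fun_eq_iff bits_simps word_pair_def\<close>)
    have 7: "exec (PUSH 0 True) ((\<sigma>(R + 2 := rev (bits (f x))))(0 := bits (g x))) 3
        (\<sigma>(R + 2 := rev (bits (f x)), 0 := True # bits (g x)))"
      by (rule exec_conv[OF exec_PUSH]) (auto simp: fun_eq_iff)
    have 8: "exec (PUSH 0 False) (\<sigma>(R + 2 := rev (bits (f x)), 0 := True # bits (g x))) 3
        (\<sigma>(R + 2 := rev (bits (f x)), 0 := False # True # bits (g x)))"
      by (rule exec_conv[OF exec_PUSH]) (auto simp: fun_eq_iff)
    show "exec (SAVE R ;; cf ;; MOVE 0 (R + 2) ;; RESTORE R ;; cg ;; PUSH 0 True ;; PUSH 0 False ;; DOUBLE (R + 2) 0)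
       \<sigma> (Tf x + Tg x + 40 * (bsize x + bsize (f x)) + 100) (\<sigma>(0 := bits (f x, g x)))"
      by (rule exec_conv[OF exec_SEQ[OF 1 exec_SEQ[OF 2 exec_SEQ[OF 3 exec_SEQ[OF 4 exec_SEQ[OF 5 exec_SEQ[OF 7 exec_SEQ[OF 8 6]]]]]]]]) auto
  qed simp
qed

lemma ptime_fst0: "ptime fst"
proof (rule ptimeI)
  show "polyb bsize (\<lambda>p :: 'a \<times> 'b. bsize (fst p))"
    by (rule polyb_mono[OF polyb_self]) simp
  show "polyb bsize (\<lambda>p :: 'a \<times> 'b. 100 * bsize p + 100)"
    by (intro polyb_intro)
  show "okc 3 (UNPAIR 1 2 ;; CLEAR 0 ;; MOVE 1 0)" by simp
  fix p :: "'a \<times> 'b" and \<sigma> :: "nat \<Rightarrow> bool list" assume s: "\<sigma> 0 = bits p" "\<And>r. 0 < r \<Longrightarrow> r < 3 \<Longrightarrow> \<sigma> r = []"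
  have 1: "exec (UNPAIR 1 2) \<sigma> (20 * bsize (fst p) + 20) (\<sigma>(0 := bits (snd p), 1 := rev (bits (fst p))))"
    by (rule exec_conv[OF exec_UNPAIR[where x = "bits (fst p)" and y = "bits (snd p)"]]) (use s in \<open>auto simp: bits_prod_def\<close>)
  have 2: "exec (CLEAR 0) (\<sigma>(0 := bits (snd p), 1 := rev (bits (fst p)))) (5 * bsize (snd p) + 1) (\<sigma>(0 := [], 1 := rev (bits (fst p))))"
    by (rule exec_conv[OF exec_CLEAR]) (auto simp: fun_eq_iff)
  have 3: "exec (MOVE 1 0) (\<sigma>(0 := [], 1 := rev (bits (fst p)))) (8 * bsize (fst p) + 1) (\<sigma>(0 := bits (fst p)))"
    by (rule exec_conv[OF exec_MOVE]) (use s in \<open>auto simp: fun_eq_iff\<close>)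
  show "exec (UNPAIR 1 2 ;; CLEAR 0 ;; MOVE 1 0) \<sigma> (100 * bsize p + 100) (\<sigma>(0 := bits (fst p)))"
    by (rule exec_conv[OF exec_SEQ[OF 1 exec_SEQ[OF 2 3]]]) auto
qed simp

lemma ptime_snd0: "ptime snd"
proof (rule ptimeI)
  show "polyb bsize (\<lambda>p :: 'a \<times> 'b. bsize (snd p))"
    by (rule polyb_mono[OF polyb_self]) simp
  show "polyb bsize (\<lambda>p :: 'a \<times> 'b. 100 * bsize p + 100)"
    by (intro polyb_intro)
  show "okc 3 (UNPAIR 1 2 ;; CLEAR 1)" by simp
  fix p :: "'a \<times> 'b" and \<sigma> :: "nat \<Rightarrow> bool list" assume s: "\<sigma> 0 = bits p" "\<And>r. 0 < r \<Longrightarrow> r < 3 \<Longrightarrow> \<sigma> r = []"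
  have 1: "exec (UNPAIR 1 2) \<sigma> (20 * bsize (fst p) + 20) (\<sigma>(0 := bits (snd p), 1 := rev (bits (fst p))))"
    by (rule exec_conv[OF exec_UNPAIR[where x = "bits (fst p)" and y = "bits (snd p)"]]) (use s in \<open>auto simp: bits_prod_def\<close>)
  have 2: "exec (CLEAR 1) (\<sigma>(0 := bits (snd p), 1 := rev (bits (fst p)))) (5 * bsize (fst p) + 1) (\<sigma>(0 := bits (snd p)))"
    by (rule exec_conv[OF exec_CLEAR]) (use s in \<open>auto simp: fun_eq_iff\<close>)
  show "exec (UNPAIR 1 2 ;; CLEAR 1) \<sigma> (100 * bsize p + 100) (\<sigma>(0 := bits (snd p)))"
    by (rule exec_conv[OF exec_SEQ[OF 1 2]]) auto
qed simp

text \<open>Closure rules are stated for composite arguments, so that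
  \<open>intro ptime_intro\<close> follows the structure of a term down to its variable.\<close>

lemmas ptime_fst [ptime_intro] = ptime_comp[OF ptime_fst0]
lemmas ptime_snd [ptime_intro] = ptime_comp[OF ptime_snd0]

lemma ptime_const [ptime_intro]: "ptime (\<lambda>_. c)"
proof (rule ptimeI)
  show "polyb bsize (\<lambda>x. 5 * bsize x + 2 + 4 * bsize c)" by (intro polyb_intro)
  show "okc 1 (CLEAR 0 ;; PUSHES 0 (bits c))" by simp
  fix x :: 'a and \<sigma> :: "nat \<Rightarrow> bool list" assume s: "\<sigma> 0 = bits x"
  show "exec (CLEAR 0 ;; PUSHES 0 (bits c)) \<sigma> (5 * bsize x + 2 + 4 * bsize c) (\<sigma>(0 := bits c))"
    by (rule exec_conv[OF exec_SEQ[OF exec_CLEAR exec_PUSHES]]) (use s in auto)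
qed (auto intro!: polyb_intro)

lemma ptime_if [ptime_intro]:
  fixes b :: "'a::bitcoded \<Rightarrow> bool" and f g :: "'a \<Rightarrow> 'b::bitcoded"
  assumes "ptime b" and "ptime f" and "ptime g"
  shows "ptime (\<lambda>x. if b x then f x else g x)"
proof -
  obtain cb Rb Tb where b: "polyb bsize Tb" "okc Rb cb" "Rb \<ge> 1"
    "\<And>x \<sigma>. \<sigma> 0 = bits x \<Longrightarrow> (\<And>r. 0 < r \<Longrightarrow> r < Rb \<Longrightarrow> \<sigma> r = []) \<Longrightarrow> exec cb \<sigma> (Tb x) (\<sigma>(0 := bits (b x)))"
    using assms(1) by (rule ptimeE) blast
  obtain cf Rf Tf where f: "polyb bsize Tf" "okc Rf cf" "Rf \<ge> 1"
    "\<And>x \<sigma>. \<sigma> 0 = bits x \<Longrightarrow> (\<And>r. 0 < r \<Longrightarrow> r < Rf \<Longrightarrow> \<sigma> r = []) \<Longrightarrow> exec cf \<sigma> (Tf x) (\<sigma>(0 := bits (f x)))"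
    using assms(2) by (rule ptimeE) blast
  obtain cg Rg Tg where g: "polyb bsize Tg" "okc Rg cg" "Rg \<ge> 1"
    "\<And>x \<sigma>. \<sigma> 0 = bits x \<Longrightarrow> (\<And>r. 0 < r \<Longrightarrow> r < Rg \<Longrightarrow> \<sigma> r = []) \<Longrightarrow> exec cg \<sigma> (Tg x) (\<sigma>(0 := bits (g x)))"
    using assms(3) by (rule ptimeE) blast
  define R where "R = max Rb (max Rf Rg)"
  have R: "R > 0" "Rb \<le> R" "Rf \<le> R" "Rg \<le> R" using f(3) by (auto simp: R_def)
  let ?c = "SAVE R ;; cb ;; IFT 0 (POP 0 ;; RESTORE R ;; cf) (POP 0 ;; RESTORE R ;; cg)"
  show ?thesis
  proof (rule ptimeI)
    show "polyb bsize (\<lambda>x. bsize (if b x then f x else g x))"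
      by (rule polyb_mono[OF polyb_add[OF polyb_bsize[OF assms(2)] polyb_bsize[OF assms(3)]]]) simp
    show "polyb bsize (\<lambda>x. Tb x + Tf x + Tg x + 40 * bsize x + 100)"
      by (intro polyb_intro b f g)
    show "okc (R + 2) ?c"
      using okc_mono[OF b(2)] okc_mono[OF f(2)] okc_mono[OF g(2)] R by simp
    fix x :: 'a and \<sigma> :: "nat \<Rightarrow> bool list" assume s: "\<sigma> 0 = bits x" "\<And>r. 0 < r \<Longrightarrow> r < R + 2 \<Longrightarrow> \<sigma> r = []"
    have 1: "exec (SAVE R) \<sigma> (20 * bsize x + 3) (\<sigma>(R := bits x))"
      by (rule exec_conv[OF exec_SAVE]) (use s R in auto)
    have 2: "exec cb (\<sigma>(R := bits x)) (Tb x) ((\<sigma>(R := bits x))(0 := [b x]))"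
      using b(4)[of "\<sigma>(R := bits x)" x] s R by (auto simp: bits_simps)
    have 3: "exec (POP 0) ((\<sigma>(R := bits x))(0 := [b x])) 1 (\<sigma>(R := bits x, 0 := []))"
      by (rule exec_conv[OF exec_POP]) (auto simp: fun_eq_iff)
    have 4: "exec (RESTORE R) (\<sigma>(R := bits x, 0 := [])) (16 * bsize x + 3) \<sigma>"
      by (rule exec_conv[OF exec_RESTORE]) (use s R in \<open>auto simp: fun_eq_iff\<close>)
    have 5: "exec cf \<sigma> (Tf x) (\<sigma>(0 := bits (f x)))" by (rule f(4)) (use s R in auto)
    have 6: "exec cg \<sigma> (Tg x) (\<sigma>(0 := bits (g x)))" by (rule g(4)) (use s R in auto)
    have 7: "exec (IFT 0 (POP 0 ;; RESTORE R ;; cf) (POP 0 ;; RESTORE R ;; cg)) ((\<sigma>(R := bits x))(0 := [b x]))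
       (16 * bsize x + 7 + Tf x + Tg x) (\<sigma>(0 := bits (if b x then f x else g x)))"
    proof (cases "b x")
      case True
      show ?thesis
        by (rule exec_conv[OF exec_IF[where t = "16 * bsize x + 6 + Tf x"]])
           (use True exec_SEQ[OF 3 exec_SEQ[OF 4 5]] in \<open>auto intro: exec_conv\<close>)
    next
      case False
      show ?thesis
        by (rule exec_conv[OF exec_IF[where t = "16 * bsize x + 6 + Tg x"]])
           (use False exec_SEQ[OF 3 exec_SEQ[OF 4 6]] in \<open>auto intro: exec_conv\<close>)
    qed
    show "exec ?c \<sigma> (Tb x + Tf x + Tg x + 40 * bsize x + 100) (\<sigma>(0 := bits (if b x then f x else g x)))"
      by (rule exec_conv[OF exec_SEQ[OF 1 exec_SEQ[OF 2 7]]]) auto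
  qed simp
qed

lemma ptime_eq0: "ptime (\<lambda>p. fst p = snd p)"
proof (rule ptimeI)
  show "polyb bsize (\<lambda>p :: 'a \<times> 'a. 100 * bsize p + 100)"
    by (intro polyb_intro)
  fix p :: "'a \<times> 'a" and \<sigma> :: "nat \<Rightarrow> bool list" assume s: "\<sigma> 0 = bits p" "\<And>r. 0 < r \<Longrightarrow> r < 4 \<Longrightarrow> \<sigma> r = []"
  show "exec EQUAL \<sigma> (100 * bsize p + 100) (\<sigma>(0 := bits (fst p = snd p)))"
    by (rule exec_conv[OF exec_EQUAL[where x = "bits (fst p)" and y = "bits (snd p)"]])
       (use s in \<open>auto simp: bits_prod_def bits_bool_def\<close>)
qed (auto simp: okc_EQUAL intro: polyb_intro)

lemma ptime_comp2:
  assumes "ptime (\<lambda>p. h (fst p) (snd p))" and "ptime f" and "ptime g"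
  shows "ptime (\<lambda>x. h (f x) (g x))"
  using ptime_comp[OF assms(1) ptime_Pair[OF assms(2,3)]] by simp

lemma ptime_comp3:
  assumes "ptime (\<lambda>p. h (fst p) (fst (snd p)) (snd (snd p)))" and "ptime f" and "ptime g" and "ptime k"
  shows "ptime (\<lambda>x. h (f x) (g x) (k x))"
  using ptime_comp[OF assms(1) ptime_Pair[OF assms(2) ptime_Pair[OF assms(3,4)]]] by simp

lemmas ptime_eq [ptime_intro] = ptime_comp2[OF ptime_eq0]

lemma ptime_not [ptime_intro]: "ptime b \<Longrightarrow> ptime (\<lambda>x. \<not> b x)"
  using ptime_if[OF _ ptime_const ptime_const, of b False True]
  by (rule back_subst[of ptime]) auto

lemma ptime_conj [ptime_intro]: "ptime b \<Longrightarrow> ptime c \<Longrightarrow> ptime (\<lambda>x. b x \<and> c x)"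
  using ptime_if[OF _ _ ptime_const, of b c False] by (rule back_subst[of ptime]) auto

lemma ptime_disj [ptime_intro]: "ptime b \<Longrightarrow> ptime c \<Longrightarrow> ptime (\<lambda>x. b x \<or> c x)"
  using ptime_not[OF ptime_conj[OF ptime_not ptime_not], of b c] by simp

lemma ptime_imp [ptime_intro]: "ptime b \<Longrightarrow> ptime c \<Longrightarrow> ptime (\<lambda>x. b x \<longrightarrow> c x)"
  using ptime_disj[OF ptime_not, of b c] by (rule back_subst[of ptime]) auto

text \<open>A nonempty list has the same code as the pair of its head and tail, so nothing has to be
  computed.\<close>

lemma ptime_Cons0: "ptime (\<lambda>p :: 'a::bitcoded \<times> 'a list. fst p # snd p)"
proof (rule ptimeI[where c = SKIP and R = 1 and T = "\<lambda>_. 0"])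
  show "polyb bsize (\<lambda>p :: 'a \<times> 'a list. bsize (fst p # snd p))"
    by (rule polyb_mono[OF polyb_self]) simp
  fix p :: "'a \<times> 'a list" and \<sigma> :: "nat \<Rightarrow> bool list" assume s: "\<sigma> 0 = bits p"
  then have "\<sigma>(0 := bits (fst p # snd p)) = \<sigma>" by (simp add: bits_prod_def bits_simps(5) fun_upd_idem_iff)
  then show "exec SKIP \<sigma> 0 (\<sigma>(0 := bits (fst p # snd p)))" by (simp add: exec_SKIP)
qed (auto intro: polyb_const)

lemmas ptime_Cons [ptime_intro] = ptime_comp2[OF ptime_Cons0]

lemma ptime_hd0: "ptime (hd :: 'a::bitcoded list \<Rightarrow> 'a)"
proof (rule ptimeI)
  show "polyb bsize (\<lambda>xs :: 'a list. bsize (hd xs))"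
  proof (rule polyb_mono)
    show "polyb bsize (\<lambda>xs :: 'a list. bsize xs + bsize (hd ([] :: 'a list)))" by (intro polyb_intro)
    show "bsize (hd xs) \<le> bsize xs + bsize (hd ([] :: 'a list))" for xs :: "'a list"
      by (cases xs) auto
  qed
  show "polyb bsize (\<lambda>xs :: 'a list. 100 * bsize xs + 4 * bsize (hd ([] :: 'a list)) + 100)"
    by (intro polyb_intro)
  let ?c = "IF 0 (\<lambda>a. a = 0) (PUSHES 0 (bits (hd ([] :: 'a list)))) (UNPAIR 1 2 ;; CLEAR 0 ;; MOVE 1 0)"
  show "okc 3 ?c" by simp
  fix xs :: "'a list" and \<sigma> :: "nat \<Rightarrow> bool list" assume s: "\<sigma> 0 = bits xs" "\<And>r. 0 < r \<Longrightarrow> r < 3 \<Longrightarrow> \<sigma> r = []"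
  show "exec ?c \<sigma> (100 * bsize xs + 4 * bsize (hd ([] :: 'a list)) + 100) (\<sigma>(0 := bits (hd xs)))"
  proof (cases xs)
    case Nil
    show ?thesis
      by (rule exec_conv[OF exec_IF[where t = "4 * bsize (hd ([] :: 'a list))"]])
         (use s Nil exec_PUSHES[of 0 "bits (hd ([] :: 'a list))" \<sigma>] in \<open>auto simp: bits_simps\<close>)
  next
    case (Cons a as)
    have 1: "exec (UNPAIR 1 2) \<sigma> (20 * bsize a + 20) (\<sigma>(0 := bits as, 1 := rev (bits a)))"
      by (rule exec_conv[OF exec_UNPAIR[where x = "bits a" and y = "bits as"]]) (use s Cons in \<open>auto simp: bits_simps\<close>)
    have 2: "exec (CLEAR 0) (\<sigma>(0 := bits as, 1 := rev (bits a))) (5 * bsize as + 1) (\<sigma>(0 := [], 1 := rev (bits a)))"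
      by (rule exec_conv[OF exec_CLEAR]) (auto simp: fun_eq_iff)
    have 3: "exec (MOVE 1 0) (\<sigma>(0 := [], 1 := rev (bits a))) (8 * bsize a + 1) (\<sigma>(0 := bits a))"
      by (rule exec_conv[OF exec_MOVE]) (use s in \<open>auto simp: fun_eq_iff\<close>)
    have "top_sym (\<sigma> 0) \<noteq> 0"
      using s Cons bits_eq_Nil[of xs] by (simp add: top_sym_eq_0)
    then show ?thesis
      by (intro exec_conv[OF exec_IF[where t = "20 * bsize a + 5 * bsize as + 8 * bsize a + 30"]])
         (use Cons exec_SEQ[OF 1 exec_SEQ[OF 2 3]] in \<open>auto intro: exec_conv\<close>)
  qed
qed simp

lemma ptime_tl0: "ptime (tl :: 'a::bitcoded list \<Rightarrow> 'a list)"
proof (rule ptimeI)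
  show "polyb bsize (\<lambda>xs :: 'a list. bsize (tl xs))"
  proof (rule polyb_mono[OF polyb_self])
    show "bsize (tl xs) \<le> bsize xs" for xs :: "'a list" by (cases xs) auto
  qed
  show "polyb bsize (\<lambda>xs :: 'a list. 100 * bsize xs + 100)"
    by (intro polyb_intro)
  let ?c = "IF 0 (\<lambda>a. a = 0) SKIP (UNPAIR 1 2 ;; CLEAR 1)"
  show "okc 3 ?c" by simp
  fix xs :: "'a list" and \<sigma> :: "nat \<Rightarrow> bool list" assume s: "\<sigma> 0 = bits xs" "\<And>r. 0 < r \<Longrightarrow> r < 3 \<Longrightarrow> \<sigma> r = []"
  show "exec ?c \<sigma> (100 * bsize xs + 100) (\<sigma>(0 := bits (tl xs)))"
  proof (cases xs)
    case Nil
    show ?thesis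
      by (rule exec_conv[OF exec_IF[where t = 0 and \<sigma>' = \<sigma>]])
         (use s Nil exec_SKIP in \<open>auto simp: bits_simps fun_eq_iff\<close>)
  next
    case (Cons a as)
    have 1: "exec (UNPAIR 1 2) \<sigma> (20 * bsize a + 20) (\<sigma>(0 := bits as, 1 := rev (bits a)))"
      by (rule exec_conv[OF exec_UNPAIR[where x = "bits a" and y = "bits as"]]) (use s Cons in \<open>auto simp: bits_simps\<close>)
    have 2: "exec (CLEAR 1) (\<sigma>(0 := bits as, 1 := rev (bits a))) (5 * bsize a + 1) (\<sigma>(0 := bits as))"
      by (rule exec_conv[OF exec_CLEAR]) (use s in \<open>auto simp: fun_eq_iff\<close>)
    have "top_sym (\<sigma> 0) \<noteq> 0"
      using s Cons bits_eq_Nil[of xs] by (simp add: top_sym_eq_0)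
    then show ?thesis
      by (intro exec_conv[OF exec_IF[where t = "20 * bsize a + 5 * bsize a + 30"]])
         (use Cons exec_SEQ[OF 1 2] in \<open>auto intro: exec_conv\<close>)
  qed
qed simp

lemmas ptime_hd [ptime_intro] = ptime_comp[OF ptime_hd0]
lemmas ptime_tl [ptime_intro] = ptime_comp[OF ptime_tl0]

lemma ptime_Suc0: "ptime Suc"
  by (rule ptimeI[where c = "PUSH 0 True" and R = 1 and T = "\<lambda>_. 3"])
     (auto intro!: polyb_intro exec_conv[OF exec_PUSH] simp: fun_eq_iff bits_simps)

lemma ptime_pred0: "ptime (\<lambda>n. n - 1 :: nat)"
proof (rule ptimeI)
  show "polyb bsize (\<lambda>n. bsize (n - 1 :: nat))" by (rule polyb_mono[OF polyb_self]) simp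
  show "polyb bsize (\<lambda>n. 1)" by (intro polyb_intro)
  show "okc 1 (POP 0)" by simp
  fix n :: nat and \<sigma> :: "nat \<Rightarrow> bool list" assume s: "\<sigma> 0 = bits n"
  show "exec (POP 0) \<sigma> 1 (\<sigma>(0 := bits (n - 1)))"
    by (rule exec_conv[OF exec_POP]) (use s in \<open>auto simp: bits_simps fun_eq_iff\<close>)
qed simp

lemmas ptime_Suc [ptime_intro] = ptime_comp[OF ptime_Suc0]
lemmas ptime_pred [ptime_intro] = ptime_comp[OF ptime_pred0]

subsection \<open>Loops\<close>

text \<open>Polynomially many rounds of a polynomial-time body do not yet give polynomial time,
  since repeated squaring lets values explode. Hence the hypothesis that all intermediate values
  stay within the polynomial bound \<open>S\<close>.\<close>

lemma ptime_while:
  fixes i :: "'x::bitcoded \<Rightarrow> 'a::bitcoded" and f :: "'a \<Rightarrow> 'a"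
  assumes "ptime i" and "ptime b" and "ptime f" and "polyb bsize N" and "polyb bsize S"
    and run: "\<And>x. \<exists>n\<le>N x. r x = (f ^^ n) (i x) \<and> \<not> b ((f ^^ n) (i x)) \<and>
      (\<forall>k<n. b ((f ^^ k) (i x))) \<and> (\<forall>k\<le>n. bsize ((f ^^ k) (i x)) \<le> S x)"
  shows "ptime r"
proof -
  obtain cb Rb Tb where b: "polyb bsize Tb" "okc Rb cb" "Rb \<ge> 1"
    "\<And>x \<sigma>. \<sigma> 0 = bits x \<Longrightarrow> (\<And>r. 0 < r \<Longrightarrow> r < Rb \<Longrightarrow> \<sigma> r = []) \<Longrightarrow> exec cb \<sigma> (Tb x) (\<sigma>(0 := bits (b x)))"
    using assms(2) by (rule ptimeE) blast
  obtain cf Rf Tf where f: "polyb bsize Tf" "okc Rf cf" "Rf \<ge> 1"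
    "\<And>x \<sigma>. \<sigma> 0 = bits x \<Longrightarrow> (\<And>r. 0 < r \<Longrightarrow> r < Rf \<Longrightarrow> \<sigma> r = []) \<Longrightarrow> exec cf \<sigma> (Tf x) (\<sigma>(0 := bits (f x)))"
    using assms(3) by (rule ptimeE) blast
  obtain ci Ri Ti where i: "polyb bsize Ti" "okc Ri ci" "Ri \<ge> 1"
    "\<And>x \<sigma>. \<sigma> 0 = bits x \<Longrightarrow> (\<And>r. 0 < r \<Longrightarrow> r < Ri \<Longrightarrow> \<sigma> r = []) \<Longrightarrow> exec ci \<sigma> (Ti x) (\<sigma>(0 := bits (i x)))"
    using assms(1) by (rule ptimeE) blast
  obtain pb where pb: "\<And>x. Tb x \<le> poly pb (bsize x)" using b(1) unfolding polyb_def by blast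
  obtain pf where pf: "\<And>x. Tf x \<le> poly pf (bsize x)" using f(1) unfolding polyb_def by blast
  define R where "R = max Rb (max Rf Ri)"
  have R: "R > 0" "Rb \<le> R" "Rf \<le> R" "Ri \<le> R" using f(3) by (auto simp: R_def)
  \<comment> \<open>The test runs on a saved copy because it overwrites register 0. Register
    \<open>R + 2\<close> is the loop flag, cleared once the test fails.\<close>
  define body where "body = (SAVE R ;; cb ;; IFT 0 (POP 0 ;; RESTORE R ;; cf) (POP 0 ;; RESTORE R ;; POP (R + 2)))"
  define D where "D m = poly pb m + poly pf m + 40 * m + 40" for m
  have D_mono: "D m \<le> D m'" if "m \<le> m'" for m m'
    using that poly_nat_mono[OF that] by (simp add: D_def add_mono)
  have body: "exec body \<sigma> (D (bsize y)) (if b y then \<sigma>(0 := bits (f y)) else \<sigma>(R + 2 := []))"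
    if s: "\<sigma> 0 = bits y" "\<sigma> (R + 2) = [True]" "\<And>r. 0 < r \<Longrightarrow> r < R + 2 \<Longrightarrow> \<sigma> r = []"
    for y and \<sigma> :: "nat \<Rightarrow> bool list"
  proof -
    have 1: "exec (SAVE R) \<sigma> (20 * bsize y + 3) (\<sigma>(R := bits y))"
      by (rule exec_conv[OF exec_SAVE]) (use s R in auto)
    have 2: "exec cb (\<sigma>(R := bits y)) (Tb y) ((\<sigma>(R := bits y))(0 := [b y]))"
      using b(4)[of "\<sigma>(R := bits y)" y] s R by (auto simp: bits_simps)
    have 3: "exec (POP 0) ((\<sigma>(R := bits y))(0 := [b y])) 1 (\<sigma>(R := bits y, 0 := []))"
      by (rule exec_conv[OF exec_POP]) (auto simp: fun_eq_iff)
    have 4: "exec (RESTORE R) (\<sigma>(R := bits y, 0 := [])) (16 * bsize y + 3) \<sigma>"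
      by (rule exec_conv[OF exec_RESTORE]) (use s R in \<open>auto simp: fun_eq_iff\<close>)
    have 5: "exec cf \<sigma> (Tf y) (\<sigma>(0 := bits (f y)))" by (rule f(4)) (use s R in auto)
    have 6: "exec (POP (R + 2)) \<sigma> 1 (\<sigma>(R + 2 := []))"
      by (rule exec_conv[OF exec_POP]) (use s in auto)
    have 7: "exec (IFT 0 (POP 0 ;; RESTORE R ;; cf) (POP 0 ;; RESTORE R ;; POP (R + 2))) ((\<sigma>(R := bits y))(0 := [b y]))
       (16 * bsize y + 8 + Tf y) (if b y then \<sigma>(0 := bits (f y)) else \<sigma>(R + 2 := []))"
    proof (cases "b y")
      case True
      show ?thesis
        by (rule exec_conv[OF exec_IF[where t = "16 * bsize y + 6 + Tf y"]])
           (use True exec_SEQ[OF 3 exec_SEQ[OF 4 5]] in \<open>auto intro: exec_conv\<close>)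
    next
      case False
      show ?thesis
        by (rule exec_conv[OF exec_IF[where t = "16 * bsize y + 7"]])
           (use False exec_SEQ[OF 3 exec_SEQ[OF 4 6]] in \<open>auto intro: exec_conv\<close>)
    qed
    show ?thesis
      unfolding body_def
      by (rule exec_conv[OF exec_SEQ[OF 1 exec_SEQ[OF 2 7]]]) (use pb[of y] pf[of y] in \<open>auto simp: D_def\<close>)
  qed
  have loop: "exec (WHN (R + 2) body) \<sigma> ((n + 1) * (D M + 2) + 1) (\<sigma>(0 := bits ((f ^^ n) y), R + 2 := []))"
    if "\<sigma> 0 = bits y" "\<sigma> (R + 2) = [True]" "\<And>r. 0 < r \<Longrightarrow> r < R + 2 \<Longrightarrow> \<sigma> r = []"
      "\<not> b ((f ^^ n) y)" "\<And>k. k < n \<Longrightarrow> b ((f ^^ k) y)" "\<And>k. k \<le> n \<Longrightarrow> bsize ((f ^^ k) y) \<le> M"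
    for y n M and \<sigma> :: "nat \<Rightarrow> bool list"
    using that
  proof (induction n arbitrary: y \<sigma>)
    case 0
    have DM: "D (bsize y) \<le> D M" using 0(6)[of 0] by (intro D_mono) simp
    have "exec body \<sigma> (D (bsize y)) (\<sigma>(R + 2 := []))"
      using body[of \<sigma> y] 0 by simp
    from exec_WHILE_True[OF _ this exec_WHILE_False] show ?case
      by (rule exec_conv) (use 0(1,2) DM in \<open>auto simp: fun_eq_iff\<close>)
  next
    case (Suc n)
    have DM: "D (bsize y) \<le> D M" using Suc(7)[of 0] by (intro D_mono) simp
    have 1: "exec body \<sigma> (D (bsize y)) (\<sigma>(0 := bits (f y)))"
      using body[of \<sigma> y] Suc(2-4) Suc(6)[of 0] by simp
    have 2: "exec (WHN (R + 2) body) (\<sigma>(0 := bits (f y))) ((n + 1) * (D M + 2) + 1)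
        ((\<sigma>(0 := bits (f y)))(0 := bits ((f ^^ n) (f y)), R + 2 := []))"
    proof (rule Suc.IH)
      show "\<not> b ((f ^^ n) (f y))" using Suc(5) by (simp add: funpow_swap1)
      show "b ((f ^^ k) (f y))" if "k < n" for k using Suc(6)[of "Suc k"] that by (simp add: funpow_swap1)
      show "bsize ((f ^^ k) (f y)) \<le> M" if "k \<le> n" for k using Suc(7)[of "Suc k"] that by (simp add: funpow_swap1)
    qed (use Suc(2-4) in auto)
    show ?case
      by (rule exec_conv[OF exec_WHILE_True[OF _ 1 2]]) (use Suc(3) DM in \<open>auto simp: funpow_swap1\<close>)
  qed
  show ?thesis
  proof (rule ptimeI)
    show "polyb bsize (\<lambda>x. bsize (r x))"
      by (rule polyb_mono[OF assms(5)]) (metis run order_refl)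
    show "polyb bsize (\<lambda>x. Ti x + ((N x + 1) * (D (S x) + 2) + 1) + 10)"
      unfolding D_def by (intro polyb_intro i(1) assms(4,5))
    show "okc (R + 3) (ci ;; PUSH (R + 2) True ;; WHN (R + 2) body)"
      using okc_mono[OF b(2)] okc_mono[OF f(2)] okc_mono[OF i(2)] R by (simp add: body_def)
    fix x :: 'x and \<sigma> :: "nat \<Rightarrow> bool list"
    assume s: "\<sigma> 0 = bits x" "\<And>r. 0 < r \<Longrightarrow> r < R + 3 \<Longrightarrow> \<sigma> r = []"
    obtain n where n: "n \<le> N x" "r x = (f ^^ n) (i x)" "\<not> b ((f ^^ n) (i x))"
      "\<And>k. k < n \<Longrightarrow> b ((f ^^ k) (i x))" "\<And>k. k \<le> n \<Longrightarrow> bsize ((f ^^ k) (i x)) \<le> S x"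
      using run[of x] by blast
    have 1: "exec ci \<sigma> (Ti x) (\<sigma>(0 := bits (i x)))" by (rule i(4)) (use s R in auto)
    have 2: "exec (PUSH (R + 2) True) (\<sigma>(0 := bits (i x))) 3 (\<sigma>(0 := bits (i x), R + 2 := [True]))"
      by (rule exec_conv[OF exec_PUSH]) (use s R in \<open>auto simp: fun_eq_iff\<close>)
    have 3: "exec (WHN (R + 2) body) (\<sigma>(0 := bits (i x), R + 2 := [True])) ((n + 1) * (D (S x) + 2) + 1)
       ((\<sigma>(0 := bits (i x), R + 2 := [True]))(0 := bits ((f ^^ n) (i x)), R + 2 := []))"
      by (rule loop) (use s R n in auto)
    have "(n + 1) * (D (S x) + 2) \<le> (N x + 1) * (D (S x) + 2)"
      using n(1) by (intro mult_le_mono) auto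
    then show "exec (ci ;; PUSH (R + 2) True ;; WHN (R + 2) body) \<sigma>
        (Ti x + ((N x + 1) * (D (S x) + 2) + 1) + 10) (\<sigma>(0 := bits (r x)))"
      by (intro exec_conv[OF exec_SEQ[OF 1 exec_SEQ[OF 2 3]]]) (use s R n(2) in \<open>auto simp: fun_eq_iff\<close>)
  qed simp
qed

text \<open>The loop body sees nothing but its own state, so the state carries the number of
  remaining rounds and the parameter \<open>x\<close> along with the value.\<close>

lemma ptime_funpow:
  fixes f :: "'x::bitcoded \<Rightarrow> 's::bitcoded \<Rightarrow> 's"
  assumes f: "ptime (\<lambda>p. f (fst p) (snd p))" and n: "ptime n" and i: "ptime i"
    and S: "polyb bsize S" and bd: "\<And>x k. k \<le> n x \<Longrightarrow> bsize ((f x ^^ k) (i x)) \<le> S x"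
  shows "ptime (\<lambda>x. (f x ^^ n x) (i x))"
proof -
  define st where "st z = (fst z - 1, fst (snd z), f (fst (snd z)) (snd (snd z)))" for z :: "nat \<times> 'x \<times> 's"
  have it: "(st ^^ k) (m, x, s) = (m - k, x, (f x ^^ k) s)" for k m x s
  proof (induction k)
    case (Suc k)
    have "st (a, b, c) = (a - 1, b, f b c)" for a b c unfolding st_def by simp
    with Suc show ?case by simp
  qed simp
  have "ptime (\<lambda>x. (st ^^ n x) (n x, x, i x))"
  proof (rule ptime_while[where b = "\<lambda>z. fst z \<noteq> 0" and f = st and N = n and i = "\<lambda>x. (n x, x, i x)"])
    show "ptime (\<lambda>x. (n x, x, i x))" by (intro ptime_intro n i)
    show "ptime (\<lambda>z :: nat \<times> 'x \<times> 's. fst z \<noteq> 0)" by (intro ptime_intro)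
    show "ptime st" unfolding st_def[abs_def] by (intro ptime_intro ptime_comp2[OF f])
    show "polyb bsize n" using polyb_bsize[OF n] by simp
    show "polyb bsize (\<lambda>x. 2 * n x + 2 + (2 * bsize x + 2 + S x))"
      by (intro polyb_intro n S)
    fix x
    show "\<exists>m\<le>n x. (st ^^ n x) (n x, x, i x) = (st ^^ m) (n x, x, i x) \<and>
          \<not> fst ((st ^^ m) (n x, x, i x)) \<noteq> 0 \<and> (\<forall>k<m. fst ((st ^^ k) (n x, x, i x)) \<noteq> 0) \<and>
          (\<forall>k\<le>m. bsize ((st ^^ k) (n x, x, i x)) \<le> 2 * n x + 2 + (2 * bsize x + 2 + S x))"
      by (intro exI[of _ "n x"]) (auto simp: it bd add_mono)
  qed
  from ptime_snd[OF ptime_snd[OF this]] show ?thesis by (simp add: it)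
qed

lemma ptime_fold:
  fixes f :: "'x::bitcoded \<Rightarrow> 'a::bitcoded \<Rightarrow> 's::bitcoded \<Rightarrow> 's"
  assumes f: "ptime (\<lambda>p. f (fst p) (fst (snd p)) (snd (snd p)))" and xs: "ptime xs" and i: "ptime i"
    and S: "polyb bsize S" and bd: "\<And>x k. bsize (fold (f x) (take k (xs x)) (i x)) \<le> S x"
  shows "ptime (\<lambda>x. fold (f x) (xs x) (i x))"
proof -
  define st where "st z = (tl (fst z), fst (snd z), f (fst (snd z)) (hd (fst z)) (snd (snd z)))"
    for z :: "'a list \<times> 'x \<times> 's"
  have it: "(st ^^ k) (ys, x, s) = (drop k ys, x, fold (f x) (take k ys) s)" if "k \<le> length ys" for k ys x s
    using that
  proof (induction k)
    case (Suc k)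
    have "st (a, b, c) = (tl a, b, f b (hd a) c)" for a b c unfolding st_def by simp
    with Suc show ?case by (simp add: take_Suc_conv_app_nth hd_drop_conv_nth drop_Suc tl_drop)
  qed simp
  have "ptime (\<lambda>x. (st ^^ length (xs x)) (xs x, x, i x))"
  proof (rule ptime_while[where b = "\<lambda>z. fst z \<noteq> []" and f = st and N = "\<lambda>x. length (xs x)"
        and i = "\<lambda>x. (xs x, x, i x)"])
    show "ptime (\<lambda>x. (xs x, x, i x))" by (intro ptime_intro xs i)
    show "ptime (\<lambda>z :: 'a list \<times> 'x \<times> 's. fst z \<noteq> [])" by (intro ptime_intro)
    show "ptime st" unfolding st_def[abs_def] by (intro ptime_intro ptime_comp3[OF f])
    show "polyb bsize (\<lambda>x. length (xs x))" by (intro polyb_intro xs)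
    show "polyb bsize (\<lambda>x. 2 * bsize (xs x) + 2 + (2 * bsize x + 2 + S x))"
      by (intro polyb_intro xs S)
    fix x
    show "\<exists>n\<le>length (xs x). (st ^^ length (xs x)) (xs x, x, i x) = (st ^^ n) (xs x, x, i x) \<and>
          \<not> fst ((st ^^ n) (xs x, x, i x)) \<noteq> [] \<and> (\<forall>k<n. fst ((st ^^ k) (xs x, x, i x)) \<noteq> []) \<and>
          (\<forall>k\<le>n. bsize ((st ^^ k) (xs x, x, i x)) \<le> 2 * bsize (xs x) + 2 + (2 * bsize x + 2 + S x))"
      by (intro exI[of _ "length (xs x)"]) (auto simp: it bd add_mono bsize_drop)
  qed
  from ptime_snd[OF ptime_snd[OF this]] show ?thesis by (simp add: it)
qed

subsection \<open>Lists and numbers\<close>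

lemma ptime_rev0: "ptime (rev :: 'a::bitcoded list \<Rightarrow> 'a list)"
proof -
  have "ptime (\<lambda>xs :: 'a list. fold (\<lambda>a s. a # s) xs [])"
    by (rule ptime_fold[where f = "\<lambda>_ a s. a # s" and S = bsize])
       (intro ptime_intro polyb_intro | simp add: fold_Cons_rev bsize_take)+
  then show ?thesis by (simp add: fold_Cons_rev)
qed

lemmas ptime_rev [ptime_intro] = ptime_comp[OF ptime_rev0]

lemma ptime_append0: "ptime (\<lambda>p :: 'a::bitcoded list \<times> 'a list. fst p @ snd p)"
proof -
  have "ptime (\<lambda>p :: 'a list \<times> 'a list. fold (\<lambda>a s. a # s) (rev (fst p)) (snd p))"
  proof (rule ptime_fold[where f = "\<lambda>_ a s. a # s" and S = bsize])
    fix p :: "'a list \<times> 'a list" and k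
    show "bsize (fold (\<lambda>a s. a # s) (take k (rev (fst p))) (snd p)) \<le> bsize p"
      using bsize_take[of k "rev (fst p)"] by (simp add: fold_Cons_rev)
  qed (intro ptime_intro polyb_intro)+
  then show ?thesis by (simp add: fold_Cons_rev)
qed

lemmas ptime_append [ptime_intro] = ptime_comp2[OF ptime_append0]

lemma ptime_length0: "ptime (length :: 'a::bitcoded list \<Rightarrow> nat)"
proof -
  have l: "fold (\<lambda>_. Suc) xs n = length xs + n" for xs :: "'a list" and n
    by (induction xs arbitrary: n) auto
  have "ptime (\<lambda>xs :: 'a list. fold (\<lambda>_. Suc) xs 0)"
  proof (rule ptime_fold[where f = "\<lambda>_ _. Suc" and S = bsize])
    fix xs :: "'a list" and k
    show "bsize (fold (\<lambda>_. Suc) (take k xs) 0) \<le> bsize xs"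
      using length_le_bsize[of xs] by (simp add: l)
  qed (intro ptime_intro polyb_intro)+
  then show ?thesis by (simp add: l)
qed

lemmas ptime_length [ptime_intro] = ptime_comp[OF ptime_length0]

text \<open>Since \<open>f\<close> may depend on \<open>x\<close>, its cost is measured on the pair
  of \<open>x\<close> and the element. All images obey one polynomial bound in the sizes of
  \<open>x\<close> and of the list, and this bounds the size of the result.\<close>

lemma ptime_map [ptime_intro]:
  assumes f: "ptime (\<lambda>p. f (fst p) (snd p))" and xs: "ptime xs"
  shows "ptime (\<lambda>x. map (f x) (xs x))"
proof -
  have m: "fold (\<lambda>a s. f x a # s) as s = rev (map (f x) as) @ s" for x as s
    by (induction as arbitrary: s) auto
  obtain q where q: "\<And>p. bsize (f (fst p) (snd p)) \<le> poly q (bsize p)"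
    using polyb_bsize[OF f] unfolding polyb_def by blast
  define S where "S x = bsize (xs x) * (2 * poly q (2 * bsize x + 2 + bsize (xs x)) + 2)" for x
  have "ptime (\<lambda>x. fold (\<lambda>a s. f x a # s) (xs x) [])"
  proof (rule ptime_fold[where f = "\<lambda>x a s. f x a # s" and S = S])
    show "ptime (\<lambda>p. f (fst p) (fst (snd p)) # snd (snd p))" by (intro ptime_intro ptime_comp2[OF f])
    show "polyb bsize S" unfolding S_def by (intro polyb_intro xs)
    fix x k
    have "bsize (map (f x) (take k (xs x))) \<le> length (map (f x) (take k (xs x))) * (2 * poly q (2 * bsize x + 2 + bsize (xs x)) + 2)"
    proof (rule bsize_list_bound)
      fix y assume "y \<in> set (map (f x) (take k (xs x)))"
      then obtain a where a: "a \<in> set (xs x)" "y = f x a" using set_take_subset by fastforce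
      have "bsize (f x a) \<le> poly q (bsize (x, a))" using q[of "(x, a)"] by simp
      also have "\<dots> \<le> poly q (2 * bsize x + 2 + bsize (xs x))"
        using bsize_mem[OF a(1)] by (intro poly_nat_mono) simp
      finally show "bsize y \<le> poly q (2 * bsize x + 2 + bsize (xs x))" using a by simp
    qed
    also have "\<dots> \<le> S x"
      unfolding S_def using length_le_bsize[of "xs x"] by (intro mult_le_mono) auto
    finally show "bsize (fold (\<lambda>a s. f x a # s) (take k (xs x)) []) \<le> S x" by (simp add: m)
  qed (intro ptime_intro xs)+
  then have "ptime (\<lambda>x. rev (fold (\<lambda>a s. f x a # s) (xs x) []))" by (rule ptime_rev)
  then show ?thesis by (simp add: m)
qed

lemma ptime_filter [ptime_intro]:
  assumes f: "ptime (\<lambda>p. P (fst p) (snd p))" and xs: "ptime xs"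
  shows "ptime (\<lambda>x. filter (P x) (xs x))"
proof -
  have m: "fold (\<lambda>a s. if P x a then a # s else s) as s = rev (filter (P x) as) @ s" for x as s
    by (induction as arbitrary: s) auto
  have fs: "bsize (filter Q as) \<le> bsize as" for Q and as :: "'b list"
    by (induction as) auto
  have "ptime (\<lambda>x. fold (\<lambda>a s. if P x a then a # s else s) (xs x) [])"
  proof (rule ptime_fold[where f = "\<lambda>x a s. if P x a then a # s else s" and S = "\<lambda>x. bsize (xs x)"])
    fix x k
    show "bsize (fold (\<lambda>a s. if P x a then a # s else s) (take k (xs x)) []) \<le> bsize (xs x)"
      using order_trans[OF fs bsize_take] by (simp add: m)
  qed (intro ptime_intro polyb_intro ptime_comp2[OF f] xs)+
  then have "ptime (\<lambda>x. rev (fold (\<lambda>a s. if P x a then a # s else s) (xs x) []))" by (rule ptime_rev)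
  then show ?thesis by (simp add: m)
qed

lemma ptime_concat0: "ptime (concat :: 'a::bitcoded list list \<Rightarrow> 'a list)"
proof -
  have m: "fold (\<lambda>a s. s @ a) as s = s @ concat as" for as and s :: "'a list"
    by (induction as arbitrary: s) auto
  have "bsize (concat as) \<le> bsize as" for as :: "'a list list"
    by (induction as) auto
  note b = order_trans[OF this bsize_take]
  have "ptime (\<lambda>xs :: 'a list list. fold (\<lambda>a s. s @ a) xs [])"
    by (rule ptime_fold[where f = "\<lambda>_ a s. s @ a" and S = bsize])
       (intro ptime_intro polyb_intro | simp add: m b)+
  then show ?thesis by (simp add: m)
qed

lemmas ptime_concat [ptime_intro] = ptime_comp[OF ptime_concat0]

lemma ptime_Ball [ptime_intro]:
  assumes "ptime (\<lambda>p. P (fst p) (snd p))" and "ptime xs"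
  shows "ptime (\<lambda>x. \<forall>a\<in>set (xs x). P x a)"
proof -
  have "ptime (\<lambda>x. filter (\<lambda>a. \<not> P x a) (xs x) = [])"
    by (intro ptime_intro assms)
  then show ?thesis by (rule back_subst[of ptime]) (auto simp: filter_empty_conv)
qed

lemma ptime_Bex [ptime_intro]:
  assumes "ptime (\<lambda>p. P (fst p) (snd p))" and "ptime xs"
  shows "ptime (\<lambda>x. \<exists>a\<in>set (xs x). P x a)"
proof -
  have "ptime (\<lambda>x. filter (\<lambda>a. P x a) (xs x) \<noteq> [])"
    by (intro ptime_intro assms)
  then show ?thesis by (rule back_subst[of ptime]) (auto simp: filter_empty_conv)
qed

lemma ptime_mem [ptime_intro]:
  assumes "ptime f" and "ptime xs"
  shows "ptime (\<lambda>x. f x \<in> set (xs x))"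
proof -
  have "ptime (\<lambda>x. \<exists>a\<in>set (xs x). a = f x)"
    by (intro ptime_intro assms ptime_comp[OF assms(1)])
  then show ?thesis by (rule back_subst[of ptime]) auto
qed

lemma ptime_add0: "ptime (\<lambda>p. fst p + snd p :: nat)"
proof -
  have "ptime (\<lambda>p. (Suc ^^ fst p) (snd p))"
  proof (rule ptime_funpow[where f = "\<lambda>_. Suc" and S = "\<lambda>p. bsize p"])
    fix p :: "nat \<times> nat" and k assume "k \<le> fst p"
    then show "bsize ((Suc ^^ k) (snd p)) \<le> bsize p" by (simp add: Suc_funpow)
  qed (intro ptime_intro polyb_intro)+
  then show ?thesis by (simp add: Suc_funpow)
qed

lemmas ptime_add [ptime_intro] = ptime_comp2[OF ptime_add0]

lemma ptime_minus0: "ptime (\<lambda>p. fst p - snd p :: nat)"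
proof -
  have m: "((\<lambda>k. k - 1) ^^ n) m = m - n" for m n :: nat
    by (induction n) auto
  have "ptime (\<lambda>p. ((\<lambda>k. k - 1 :: nat) ^^ snd p) (fst p :: nat))"
  proof (rule ptime_funpow[where f = "\<lambda>_ k. k - 1" and S = "\<lambda>p. bsize p"])
    fix p :: "nat \<times> nat" and k assume "k \<le> snd p"
    show "bsize (((\<lambda>k. k - 1) ^^ k) (fst p)) \<le> bsize p" unfolding m by simp
  qed (intro ptime_intro polyb_intro)+
  then show ?thesis unfolding m .
qed

lemmas ptime_minus [ptime_intro] = ptime_comp2[OF ptime_minus0]

lemma ptime_mult0: "ptime (\<lambda>p. fst p * snd p :: nat)"
proof -
  have m: "((\<lambda>s. s + m) ^^ n) 0 = n * m" for m n :: nat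
    by (induction n) auto
  have "ptime (\<lambda>p. ((\<lambda>s. s + snd p) ^^ fst p) (0 :: nat))"
  proof (rule ptime_funpow[where f = "\<lambda>p s. s + snd p" and S = "\<lambda>p. fst p * snd p"])
    show "polyb bsize (\<lambda>p :: nat \<times> nat. fst p * snd p)" by (intro polyb_intro ptime_intro)
  qed (auto simp: m intro!: ptime_intro)
  then show ?thesis unfolding m .
qed

lemmas ptime_mult [ptime_intro] = ptime_comp2[OF ptime_mult0]

lemma ptime_le [ptime_intro]: "ptime f \<Longrightarrow> ptime g \<Longrightarrow> ptime (\<lambda>x. f x \<le> (g x :: nat))"
  using ptime_eq[OF ptime_minus ptime_const, of f g 0] by simp

lemma ptime_less [ptime_intro]: "ptime f \<Longrightarrow> ptime g \<Longrightarrow> ptime (\<lambda>x. f x < (g x :: nat))"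
  using ptime_le[OF ptime_Suc, of f g] by (simp add: Suc_le_eq)

lemma ptime_upt [ptime_intro]:
  assumes "ptime f" and "ptime g"
  shows "ptime (\<lambda>x. [f x..<g x])"
proof -
  have m: "((\<lambda>l. l @ [length l]) ^^ n) [] = [0..<n]" for n
    by (induction n) auto
  have "ptime (\<lambda>n. ((\<lambda>l. l @ [length l]) ^^ n) [])"
  proof (rule ptime_funpow[where f = "\<lambda>_ l. l @ [length l]" and S = "\<lambda>n. n * (2 * n + 2)"])
    show "polyb bsize (\<lambda>n::nat. n * (2 * n + 2))" by (intro polyb_intro ptime_intro)
    fix n k :: nat assume k: "k \<le> n"
    have "bsize [0..<k] \<le> length [0..<k] * (2 * n + 2)"
      by (rule bsize_list_bound) (use k in auto)
    also have "\<dots> \<le> n * (2 * n + 2)" using k by (intro mult_le_mono) auto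
    finally show "bsize (((\<lambda>l. l @ [length l]) ^^ k) []) \<le> n * (2 * n + 2)" unfolding m .
  qed (intro ptime_intro)+
  then have "ptime (\<lambda>n. [0..<n])" unfolding m .
  then have "ptime (\<lambda>x. [0..<g x - f x])" by (rule ptime_comp) (intro ptime_intro assms)
  then have "ptime (\<lambda>x. map (\<lambda>i. i + f x) [0..<g x - f x])"
    by (intro ptime_intro ptime_comp[OF assms(1)])
  moreover have "map (\<lambda>i. i + f x) [0..<g x - f x] = [f x..<g x]" for x
    by (cases "f x \<le> g x") (auto simp: map_add_upt)
  ultimately show ?thesis by simp
qed

lemma ptime_drop0: "ptime (\<lambda>p :: nat \<times> 'a::bitcoded list. drop (fst p) (snd p))"
proof -
  have m: "(tl ^^ n) xs = drop n xs" for n and xs :: "'a list"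
    by (induction n) (auto simp: drop_Suc tl_drop)
  have "ptime (\<lambda>p :: nat \<times> 'a list. (tl ^^ fst p) (snd p))"
  proof (rule ptime_funpow[where f = "\<lambda>_. tl" and S = bsize])
    fix p :: "nat \<times> 'a list" and k
    show "bsize ((tl ^^ k) (snd p)) \<le> bsize p"
      using bsize_drop[of k "snd p"] by (simp add: m)
  qed (intro ptime_intro polyb_intro)+
  then show ?thesis unfolding m .
qed

lemmas ptime_drop [ptime_intro] = ptime_comp2[OF ptime_drop0]

definition nthd :: "'a \<Rightarrow> 'a list \<Rightarrow> nat \<Rightarrow> 'a" where
  "nthd d xs i = (if i < length xs then xs ! i else d)"

lemma nthd_nth [simp]: "i < length xs \<Longrightarrow> nthd d xs i = xs ! i"
  by (simp add: nthd_def)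

lemma ptime_nthd [ptime_intro]:
  assumes "ptime d" and "ptime xs" and "ptime i"
  shows "ptime (\<lambda>x. nthd (d x) (xs x) (i x))"
proof -
  have "ptime (\<lambda>x. if i x < length (xs x) then hd (drop (i x) (xs x)) else d x)"
    by (intro ptime_intro assms)
  then show ?thesis by (rule back_subst[of ptime]) (auto simp: nthd_def hd_drop_conv_nth)
qed

lemma ptime_zip [ptime_intro]:
  assumes "ptime xs" and "ptime ys"
  shows "ptime (\<lambda>x. zip (xs x) (ys x))"
proof -
  have "ptime (\<lambda>x. map (\<lambda>i. (hd (drop i (xs x)), hd (drop i (ys x))))
      [0..<if length (xs x) \<le> length (ys x) then length (xs x) else length (ys x)])"
    by (intro ptime_intro assms ptime_comp[OF assms(1)] ptime_comp[OF assms(2)])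
  then show ?thesis
    by (rule back_subst[of ptime]) (auto simp: fun_eq_iff hd_drop_conv_nth intro!: nth_equalityI)
qed

lemma ptime_replicate [ptime_intro]:
  assumes "ptime n" and "ptime a"
  shows "ptime (\<lambda>x. replicate (n x) (a x))"
proof -
  have "ptime (\<lambda>x. map (\<lambda>_. a x) [0..<n x])"
    by (intro ptime_intro assms ptime_comp[OF assms(2)])
  then show ?thesis by (simp add: map_replicate_const)
qed

lemma ptime_poly [ptime_intro]: "ptime f \<Longrightarrow> ptime (\<lambda>x. poly p (f x :: nat))"
  by (induction p) (auto intro!: ptime_intro)

subsection \<open>Decoding\<close>

lemma bsize_bools: "bsize (w :: bool list) = 4 * length w"
  by (induction w) auto

lemma ptime_unw0: "ptime unw"
proof -
  have "ptime (\<lambda>w. (unw_step ^^ length w) (False, [], w))"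
  proof (rule ptime_funpow[where f = "\<lambda>_. unw_step" and S = "\<lambda>w. 100 * bsize w + 100"])
    show "ptime (\<lambda>p :: bool list \<times> _. unw_step (snd p))"
      unfolding unw_step_def Let_def by (intro ptime_intro)
    fix w :: "bool list" and k
    show "bsize ((unw_step ^^ k) (False, [], w)) \<le> 100 * bsize w + 100"
      using unw_iter_size[of k "(False, [], w)"] by (simp add: bsize_bools)
  qed (intro ptime_intro polyb_intro)+
  then show ?thesis
    unfolding unw_def[abs_def] Let_def by (intro ptime_intro)
qed

lemmas ptime_unw [ptime_intro] = ptime_comp[OF ptime_unw0]

lemma unwl_iter_size:
  "length (snd ((unwl_step ^^ k) ([], w))) \<le> length w \<and>
   length (fst ((unwl_step ^^ k) ([], w))) \<le> k \<and>
   (\<forall>v\<in>set (fst ((unwl_step ^^ k) ([], w))). length v \<le> length w)"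
proof (induction k)
  case (Suc k)
  define s where "s = (unwl_step ^^ k) ([], w)"
  have "length (fst (unw (snd s))) \<le> length w" "length (snd (unw (snd s))) \<le> length w"
    using unw_size[of "snd s"] Suc by (auto simp: s_def)
  then show ?case
    using Suc unwl_step_def[of s] unfolding funpow.simps comp_apply s_def[symmetric] by auto
qed simp

lemma ptime_unwl0: "ptime unwl"
proof -
  have "ptime (\<lambda>w. (unwl_step ^^ length w) ([], w))"
  proof (rule ptime_funpow[where f = "\<lambda>_. unwl_step" and S = "\<lambda>w. 2 * (bsize w * (2 * bsize w + 2)) + 2 + bsize w"])
    show "ptime (\<lambda>p :: bool list \<times> _. unwl_step (snd p))"
      unfolding unwl_step_def by (intro ptime_intro)
    fix w :: "bool list" and k assume k: "k \<le> length w"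
    have "bsize (fst ((unwl_step ^^ k) ([], w))) \<le> length (fst ((unwl_step ^^ k) ([], w))) * (2 * bsize w + 2)"
      by (rule bsize_list_bound) (use unwl_iter_size[of k w] in \<open>auto simp: bsize_bools\<close>)
    also have "\<dots> \<le> bsize w * (2 * bsize w + 2)"
      using unwl_iter_size[of k w] k by (intro mult_le_mono) (auto simp: bsize_bools)
    finally show "bsize ((unwl_step ^^ k) ([], w)) \<le> 2 * (bsize w * (2 * bsize w + 2)) + 2 + bsize w"
      using unwl_iter_size[of k w] by (simp add: bsize_bools)
  qed (intro ptime_intro polyb_intro)+
  then show ?thesis
    unfolding unwl_def[abs_def] by (intro ptime_intro)
qed

lemmas ptime_unwl [ptime_intro] = ptime_comp[OF ptime_unwl0]

lemma ptime_unbits_bool: "ptime (unbits :: bool list \<Rightarrow> bool)"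
  unfolding unbits_bool_def[abs_def] by (intro ptime_intro)

lemma ptime_unbits_nat: "ptime (unbits :: bool list \<Rightarrow> nat)"
  unfolding unbits_nat_def[abs_def] by (intro ptime_intro)

lemma ptime_unbits_prod:
  assumes "ptime (unbits :: bool list \<Rightarrow> 'a::bitcoded)" and "ptime (unbits :: bool list \<Rightarrow> 'b::bitcoded)"
  shows "ptime (unbits :: bool list \<Rightarrow> 'a \<times> 'b)"
  unfolding unbits_prod_def[abs_def]
  by (intro ptime_intro ptime_comp[OF assms(1)] ptime_comp[OF assms(2)])

lemma ptime_unbits_list:
  assumes "ptime (unbits :: bool list \<Rightarrow> 'a::bitcoded)"
  shows "ptime (unbits :: bool list \<Rightarrow> 'a list)"
  unfolding unbits_list_def[abs_def]
  by (intro ptime_intro ptime_comp[OF assms])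

lemmas ptime_unbits = ptime_unbits_list ptime_unbits_prod ptime_unbits_nat ptime_unbits_bool

subsection \<open>Interface to Turing machines\<close>

text \<open>The machine receives and returns bare words, whereas a program for
  \<open>bool list\<close> arguments expects \<open>bits w\<close>, in which each letter occupies
  four letters. These two programs translate between the formats.\<close>

definition WRAP :: com where
  "WRAP = (MOVE 0 1 ;; EACH 1 (\<lambda>b. PUSH 0 True ;; PUSH 0 False ;; PUSH 0 b ;; PUSH 0 b))"

definition UNWRAP :: com where
  "UNWRAP = (WHN 0 (IFT 0
     (POP 0 ;; POP 0 ;; POP 0 ;; POP 0 ;; PUSH 1 True)
     (POP 0 ;; POP 0 ;; POP 0 ;; POP 0 ;; PUSH 1 False)) ;; MOVE 1 0)"

lemma bits_bools_Cons: "bits (b # bs :: bool list) = b # b # False # True # bits bs"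
  by (simp add: bits_list_def bits_bool_def)

lemma exec_WRAP:
  assumes "\<sigma> 0 = w" "\<sigma> 1 = []"
  shows "exec WRAP \<sigma> (40 * length w + 10) (\<sigma>(0 := bits w))"
proof -
  define g where "g b \<tau> = \<tau>(0 := b # b # False # True # \<tau> 0)" for b :: bool and \<tau> :: "nat \<Rightarrow> bool list"
  have exg: "exec (PUSH 0 True ;; PUSH 0 False ;; PUSH 0 b ;; PUSH 0 b) \<tau> 15 (g b \<tau>)" for b \<tau>
    by (rule exec_conv[OF exec_SEQ[OF exec_PUSH exec_SEQ[OF exec_PUSH exec_SEQ[OF exec_PUSH exec_PUSH]]]])
       (auto simp: g_def fun_eq_iff)
  have gfold: "fold g (rev u) \<tau> = \<tau>(0 := bits u)" if "\<tau> 0 = []" for u \<tau>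
  proof (induction u)
    case Nil
    show ?case using that by (simp add: bits_simps fun_eq_iff)
  next
    case (Cons b u)
    have "fold g (rev (b # u)) \<tau> = g b (fold g (rev u) \<tau>)" by simp
    also have "fold g (rev u) \<tau> = \<tau>(0 := bits u)" by (rule Cons)
    also have "g b (\<tau>(0 := bits u)) = \<tau>(0 := bits (b # u))"
      unfolding g_def bits_bools_Cons by (rule ext) simp
    finally show ?case .
  qed
  have 1: "exec (MOVE 0 1) \<sigma> (8 * length w + 1) (\<sigma>(0 := [], 1 := rev w))"
    by (rule exec_conv[OF exec_MOVE]) (use assms in auto)
  have 2: "exec (EACH 1 (\<lambda>b. PUSH 0 True ;; PUSH 0 False ;; PUSH 0 b ;; PUSH 0 b)) (\<sigma>(0 := [], 1 := rev w))
      (20 * length w + 1) (\<sigma>(0 := bits w))"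
  proof (rule exec_conv[OF exec_EACH[OF exg]])
    show "g b (\<tau>(1 := ys)) = (g b \<tau>)(1 := ys)" for b \<tau> ys by (auto simp: g_def fun_eq_iff)
    show "(fold g ((\<sigma>(0 := [], 1 := rev w)) 1) (\<sigma>(0 := [], 1 := rev w)))(1 := []) = \<sigma>(0 := bits w)"
      using assms gfold[of "\<sigma>(0 := [], 1 := rev w)" w] by (auto simp: fun_eq_iff)
  qed simp
  show ?thesis
    unfolding WRAP_def by (rule exec_conv[OF exec_SEQ[OF 1 2]]) auto
qed

lemma exec_UNWRAP:
  assumes "\<sigma> 0 = bits w" "\<sigma> 1 = []"
  shows "exec UNWRAP \<sigma> (40 * length w + 10) (\<sigma>(0 := w))"
proof -
  have loop: "exec (WHN 0 (IFT 0
     (POP 0 ;; POP 0 ;; POP 0 ;; POP 0 ;; PUSH 1 True)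
     (POP 0 ;; POP 0 ;; POP 0 ;; POP 0 ;; PUSH 1 False))) \<sigma> (20 * length w + 1) (\<sigma>(0 := [], 1 := rev w @ \<sigma> 1))"
    (is "exec (WHN 0 ?b) _ _ _") if "\<sigma> 0 = bits w" for \<sigma>
    using that
  proof (induction w arbitrary: \<sigma>)
    case Nil
    then show ?case by (intro exec_conv[OF exec_WHILE_False]) (auto simp: bits_simps fun_eq_iff)
  next
    case (Cons b w)
    have 1: "exec (POP 0 ;; POP 0 ;; POP 0 ;; POP 0 ;; PUSH 1 b) \<sigma> 11 (\<sigma>(0 := bits w, 1 := b # \<sigma> 1))"
      by (rule exec_conv[OF exec_SEQ[OF exec_POP exec_SEQ[OF exec_POP exec_SEQ[OF exec_POP exec_SEQ[OF exec_POP exec_PUSH]]]]])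
         (use Cons.prems in \<open>auto simp: fun_eq_iff bits_bools_Cons\<close>)
    have 2: "exec ?b \<sigma> 12 (\<sigma>(0 := bits w, 1 := b # \<sigma> 1))"
      by (rule exec_conv[OF exec_IF[where t = 11]]) (use 1 Cons.prems in \<open>auto simp: bits_bools_Cons\<close>)
    show ?case
      by (rule exec_conv[OF exec_WHILE_True[OF _ 2 Cons.IH]]) (use Cons.prems in \<open>auto simp: bits_bools_Cons fun_eq_iff\<close>)
  qed
  show ?thesis
    unfolding UNWRAP_def by (rule exec_conv[OF exec_SEQ[OF loop exec_MOVE]]) (use assms in \<open>auto simp: fun_eq_iff\<close>)
qed

text \<open>The output tape is written from left to right, so that the output starts at position 0.\<close>

definition EMIT :: "nat \<Rightarrow> com" where
  "EMIT v = WHN 0 (IFT 0 (ACT v (\<lambda>_. (2, Move_Right)) ;; POP 0) (ACT v (\<lambda>_. (1, Move_Right)) ;; POP 0))"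

lemma tape_word_snoc: "(tape_word ys)(int (length ys) := sym_of b) = tape_word (ys @ [b])"
proof
  fix i
  show "((tape_word ys)(int (length ys) := sym_of b)) i = tape_word (ys @ [b]) i"
    by (cases "i = int (length ys)") (auto simp: tape_word_def nth_append nat_less_iff)
qed

lemma EMIT_steps:
  assumes "stk (s 0) xs" and "s v = (int (length ys), tape_word ys)" and "v \<noteq> 0"
  shows "\<exists>s'. (cstep ^^ (6 * length xs + 1)) (EMIT v, s) = (SKIP, s') \<and> snd (s' v) = tape_word (ys @ xs)"
  using assms
proof (induction xs arbitrary: s ys)
  case Nil
  then have "read_tape (s 0) = 0" by (simp add: read_stk)
  then show ?case using Nil by (simp add: EMIT_def cstep_WHILE)
next
  case (Cons b xs)
  have rd: "read_tape (s 0) = sym_of b" using Cons.prems by (simp add: read_stk)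
  define s1 where "s1 = s(v := act_tape (sym_of b, Move_Right) (s v))"
  define s2 where "s2 = s1(0 := act_tape (0, Move_Right) (s1 0))"
  let ?B = "ACT v (\<lambda>_. (sym_of b, Move_Right)) ;; POP 0"
  have 1: "cstep (EMIT v, s) = (IFT 0 (ACT v (\<lambda>_. (2, Move_Right)) ;; POP 0) (ACT v (\<lambda>_. (1, Move_Right)) ;; POP 0) ;; EMIT v, s)"
    using rd by (simp add: EMIT_def cstep_WHILE)
  have 2: "cstep (IFT 0 (ACT v (\<lambda>_. (2, Move_Right)) ;; POP 0) (ACT v (\<lambda>_. (1, Move_Right)) ;; POP 0) ;; EMIT v, s) = (?B ;; EMIT v, s)"
    using rd by (simp add: cstep_Pair)
  have 3: "cstep (?B ;; EMIT v, s) = ((SKIP ;; POP 0) ;; EMIT v, s1)"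
    by (auto simp: cstep_Pair s1_def fun_eq_iff)
  have 4: "cstep ((SKIP ;; POP 0) ;; EMIT v, s1) = (POP 0 ;; EMIT v, s1)"
    by (simp add: cstep_Pair)
  have 5: "cstep (POP 0 ;; EMIT v, s1) = (SKIP ;; EMIT v, s2)"
    by (auto simp: cstep_Pair s2_def fun_eq_iff POP_def)
  have 6: "cstep (SKIP ;; EMIT v, s2) = (EMIT v, s2)"
    by (simp add: cstep_Pair)
  have six: "(cstep ^^ 6) (EMIT v, s) = (EMIT v, s2)"
    using 1 2 3 4 5 6 by (simp add: eval_nat_numeral)
  have "stk (s2 0) xs"
    using Cons.prems(1,3)
    by (auto simp: s2_def s1_def stk_def act_tape_def fun_eq_iff tape_word_Cons tape_word_neg algebra_simps)
  moreover have "s2 v = (int (length (ys @ [b])), tape_word (ys @ [b]))"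
    using Cons.prems by (simp add: s2_def s1_def act_tape_def tape_word_snoc)
  ultimately obtain s' where "(cstep ^^ (6 * length xs + 1)) (EMIT v, s2) = (SKIP, s')" "snd (s' v) = tape_word ((ys @ [b]) @ xs)"
    using Cons.IH[of s2 "ys @ [b]"] Cons.prems(3) by blast
  moreover have "(cstep ^^ (6 * length (b # xs) + 1)) (EMIT v, s) = (cstep ^^ (6 * length xs + 1)) (EMIT v, s2)"
    using six funpow_add[of "6 * length xs + 1" 6 cstep] by (simp del: funpow.simps)
  ultimately show ?case by auto
qed

lemma rep_store0: "rep (\<lambda>r. if r = 0 then w else []) (store0 w)"
  by (auto simp: rep_def stk_def store0_def)

theorem poly_time_computable_ptime:
  assumes "ptime f"
  shows "poly_time_computable f"
proof -
  obtain c R T where c: "polyb bsize T" "okc R c" "R \<ge> 1"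
    "\<And>x \<sigma>. \<sigma> 0 = bits x \<Longrightarrow> (\<And>r. 0 < r \<Longrightarrow> r < R \<Longrightarrow> \<sigma> r = []) \<Longrightarrow> exec c \<sigma> (T x) (\<sigma>(0 := bits (f x)))"
    using assms by (rule ptimeE) blast
  \<comment> \<open>\<open>WRAP\<close> and \<open>UNWRAP\<close> work on registers 0 and 1, hence
    at least 2. With \<open>v + 1\<close> tapes, \<open>v\<close> is the last tape, where the output
    is expected.\<close>
  define v where "v = max R 2"
  have v: "v \<ge> 2" "R \<le> v" by (auto simp: v_def)
  define main where "main = (WRAP ;; c ;; UNWRAP)"
  have okm: "okc v main"
    using okc_mono[OF c(2) v(2)] v by (simp add: main_def WRAP_def UNWRAP_def)
  have okE: "okc (v + 1) (main ;; EMIT v)"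
    using okc_mono[OF okm, of "v + 1"] by (simp add: EMIT_def)
  obtain M where M: "wf_tm M" "ntapes M = v + 1"
    "\<And>t w. snd ((tm_step M ^^ t) (tm_init M w)) = map (snd ((cstep ^^ t) ((main ;; EMIT v) ;; SKIP, store0 w))) [0..<v + 1]"
    "\<And>t w. fst ((cstep ^^ t) ((main ;; EMIT v) ;; SKIP, store0 w)) = SKIP \<Longrightarrow> fst ((tm_step M ^^ t) (tm_init M w)) = 1"
    using tm_of_com[OF okE] by auto
  define U where "U w = 40 * length w + T w + 100 * length (f w) + 40" for w
  have "polyb bsize U"
    unfolding U_def by (intro polyb_intro ptime_id c(1) assms)
  then have "polyb length U"
  proof (rule polyb_trans[of bsize U length "\<lambda>x. x"])
    show "polyb length (\<lambda>x :: bool list. bsize x)"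
      unfolding bsize_bools by (intro polyb_intro)
  qed
  then obtain p where p: "\<And>w. U w \<le> poly p (length w)" unfolding polyb_def by blast
  have "computes_in_time M f (poly p)"
    unfolding computes_in_time_def Let_def
  proof
    fix w
    define \<sigma> where "\<sigma> = (\<lambda>r :: nat. if r = 0 then w else [] :: bool list)"
    have 1: "exec WRAP \<sigma> (40 * length w + 10) (\<sigma>(0 := bits w))"
      by (rule exec_WRAP) (auto simp: \<sigma>_def)
    have 2: "exec c (\<sigma>(0 := bits w)) (T w) (\<sigma>(0 := bits (f w)))"
      by (rule exec_conv[OF c(4)]) (auto simp: \<sigma>_def)
    have 3: "exec UNWRAP (\<sigma>(0 := bits (f w))) (40 * length (f w) + 10) (\<sigma>(0 := f w))"
      by (rule exec_conv[OF exec_UNWRAP]) (auto simp: \<sigma>_def)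
    define t where "t = 40 * length w + 10 + (T w + (40 * length (f w) + 10) + 1) + 1"
    have "exec main \<sigma> t (\<sigma>(0 := f w))"
      unfolding main_def t_def by (rule exec_SEQ[OF 1 exec_SEQ[OF 2 3]])
    then obtain s where s: "(cstep ^^ t) (main, store0 w) = (SKIP, s)" "rep (\<sigma>(0 := f w)) s"
      using rep_store0[of w] unfolding exec_def \<sigma>_def by blast
    have "s v = store0 w v" using csteps_untouched[OF okm, of v t "store0 w"] s by simp
    then have so: "s v = (int (length []), tape_word [])" using v by (simp add: store0_def)
    have s0: "stk (s 0) (f w)" using s(2) by (auto simp: rep_def dest: spec[of _ 0])
    obtain s' where s': "(cstep ^^ (6 * length (f w) + 1)) (EMIT v, s) = (SKIP, s')" "snd (s' v) = tape_word (f w)"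
      using EMIT_steps[OF s0 so] v by auto
    have "(cstep ^^ (t + (6 * length (f w) + 1) + 1 + 0 + 1)) ((main ;; EMIT v) ;; SKIP, store0 w) = (SKIP, s')"
      by (rule csteps_SEQ_SKIP[OF csteps_SEQ_SKIP[OF s(1) s'(1)]]) simp
    then have fin: "(cstep ^^ poly p (length w)) ((main ;; EMIT v) ;; SKIP, store0 w) = (SKIP, s')"
      by (rule csteps_SKIP_mono) (use p[of w] in \<open>simp add: t_def U_def\<close>)
    then show "fst ((tm_step M ^^ poly p (length w)) (tm_init M w)) = 1 \<and>
        snd (last (snd ((tm_step M ^^ poly p (length w)) (tm_init M w)))) = tape_word (f w)"
      using M(3)[of "poly p (length w)" w] M(4)[of "poly p (length w)" w] s'(2) by simp
  qed
  then show ?thesis using M(1) unfolding poly_time_computable_def by blast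
qed

lemma P_classI: "ptime (\<lambda>w. P w) \<Longrightarrow> {w. P w} \<in> P_class"
  unfolding P_class_def by (auto intro!: poly_time_computable_ptime ptime_intro)

section \<open>Fixed-point characterization of the strategic operators\<close>

section \<open>Solving the games of the temporal operators\<close>

text \<open>The tuple \<alpha> is complete for convenience; only its entries for agents in
  \<open>A\<close> constrain \<beta>.\<close>

definition Cpre :: "nat \<Rightarrow> ('q, 'p) cgs \<Rightarrow> nat set \<Rightarrow> 'q set \<Rightarrow> 'q set" where
  "Cpre k C A X = {q \<in> states C. \<exists>\<alpha>\<in>act_tuples k C q. \<forall>\<beta>\<in>act_tuples k C q.
     (\<forall>a\<in>A. \<beta> ! a = \<alpha> ! a) \<longrightarrow> trans C q \<beta> \<in> X}"

fun game :: "nat \<Rightarrow> ('q, 'p) cgs \<Rightarrow> nat set \<Rightarrow> temp_op \<Rightarrow> 'q set \<Rightarrow> nat \<Rightarrow> 'q set" where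
  "game k C A t X 0 = X"
| "game k C A Finally X (Suc i) = X \<union> Cpre k C A (game k C A Finally X i)"
| "game k C A Globally X (Suc i) = X \<inter> Cpre k C A (game k C A Globally X i)"

lemma Cpre_mono: "X \<subseteq> Y \<Longrightarrow> Cpre k C A X \<subseteq> Cpre k C A Y"
  unfolding Cpre_def by blast

text \<open>If each of the first \<open>card U + 1\<close> inclusions were strict, some
  \<open>S i\<close> would have more than \<open>card U\<close> elements. After the first repetition
  the sequence is constant by \<open>det\<close>.\<close>

lemma chain_stable:
  fixes S :: "nat \<Rightarrow> 'q set"
  assumes "finite U" and "\<And>i. S i \<subseteq> U" and inc: "\<And>i. S i \<subseteq> S (Suc i)"
    and det: "\<And>i. S i = S (Suc i) \<Longrightarrow> S (Suc i) = S (Suc (Suc i))"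
  shows "S i \<subseteq> S (card U)"
proof -
  have "\<exists>i\<le>card U. S i = S (Suc i)"
  proof (rule ccontr)
    assume "\<not> ?thesis"
    then have lt: "S i \<subset> S (Suc i)" if "i \<le> card U" for i using inc that by blast
    have "i \<le> card (S i)" if "i \<le> Suc (card U)" for i
      using that
    proof (induction i)
      case (Suc i)
      have "card (S i) < card (S (Suc i))"
        using lt[of i] Suc.prems finite_subset[OF assms(2,1)] by (intro psubset_card_mono) auto
      then show ?case using Suc by linarith
    qed simp
    from this[of "Suc (card U)"] show False
      using card_mono[OF assms(1,2)] by (metis Suc_n_not_le_n order_refl order_trans)
  qed
  then obtain j where j: "j \<le> card U" "S j = S (Suc j)" by blast
  have mono: "S a \<subseteq> S b" if "a \<le> b" for a b using that inc by (rule lift_Suc_mono_le[of S, rotated])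
  have "S (j + d) = S j \<and> S (Suc (j + d)) = S j" for d
  proof (induction d)
    case (Suc d)
    then show ?case using det[of "j + d"] by simp
  qed (use j in simp)
  then have "S i \<subseteq> S j" using mono by (metis le_add_diff_inverse nle_le order_refl)
  then show ?thesis using mono[OF j(1)] by blast
qed

locale game_structure =
  fixes k :: nat and Props :: "'p set" and C :: "('q, 'p) cgs" and A :: "nat set"
  assumes cgs: "is_cgs k Props C" and A: "A \<subseteq> {..<k}"
begin

lemma zeros: "q \<in> states C \<Longrightarrow> replicate k 0 \<in> act_tuples k C q"
  using cgs by (fastforce simp: is_cgs_def act_tuples_def)

lemma trans_states: "q \<in> states C \<Longrightarrow> \<alpha> \<in> act_tuples k C q \<Longrightarrow> trans C q \<alpha> \<in> states C"
  using cgs by (auto simp: is_cgs_def)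

lemma outcomes_states:
  assumes "q \<in> states C" and "\<rho> \<in> outcomes k C A q s"
  shows "\<rho> i \<in> states C"
proof (induction i)
  case (Suc i)
  then show ?case using assms(2) trans_states unfolding outcomes_def by fastforce
qed (use assms in \<open>simp add: outcomes_def\<close>)

text \<open>Strategies may use the whole history; this one looks only at the last state. Such
  memoryless strategies are enough for the coalition in both games below.\<close>

lemma positional:
  assumes w: "\<And>q. q \<in> states C \<Longrightarrow> w q \<in> act_tuples k C q"
  obtains s where "is_profile C A s"
    "\<And>q \<rho> i. q \<in> states C \<Longrightarrow> \<rho> \<in> outcomes k C A q s \<Longrightarrow>
       \<exists>\<beta>\<in>act_tuples k C (\<rho> i). (\<forall>a\<in>A. \<beta> ! a = w (\<rho> i) ! a) \<and> \<rho> (Suc i) = trans C (\<rho> i) \<beta>"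
proof (rule that[of "\<lambda>a h. w (last h) ! a"])
  show "is_profile C A (\<lambda>a h. w (last h) ! a)"
    unfolding is_profile_def is_strategy_def
  proof (intro ballI allI impI)
    fix a h assume "a \<in> A" and h: "h \<noteq> [] \<and> set h \<subseteq> states C"
    then have "last h \<in> states C" "a < k" using A last_in_set by auto
    with w show "w (last h) ! a < num_act C (last h) a" by (auto simp: act_tuples_def)
  qed
  fix q \<rho> i assume "\<rho> \<in> outcomes k C A q (\<lambda>a h. w (last h) ! a)"
  then show "\<exists>\<beta>\<in>act_tuples k C (\<rho> i). (\<forall>a\<in>A. \<beta> ! a = w (\<rho> i) ! a) \<and> \<rho> (Suc i) = trans C (\<rho> i) \<beta>"
    unfolding outcomes_def by simp
qed

text \<open>The opponents may choose their actions after those of the coalition.\<close>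

lemma counter_path:
  assumes s: "is_profile C A s" and q: "q \<in> states C"
    and c: "\<And>q \<alpha>. q \<in> states C \<Longrightarrow> \<alpha> \<in> act_tuples k C q \<Longrightarrow>
      c q \<alpha> \<in> act_tuples k C q \<and> (\<forall>a\<in>A. c q \<alpha> ! a = \<alpha> ! a)"
  obtains \<rho> where "\<rho> \<in> outcomes k C A q s"
    "\<And>n. \<exists>\<alpha>\<in>act_tuples k C (\<rho> n). \<rho> (Suc n) = trans C (\<rho> n) (c (\<rho> n) \<alpha>)"
proof -
  \<comment> \<open>The actions dictated by the strategies after history \<open>h\<close>; the other
    agents play 0, which is legal as every agent has an action. The counter-response
    \<open>c\<close> then replaces the entries of the opponents.\<close>
  define mv where "mv h = map (\<lambda>a. if a \<in> A then s a h else 0) [0..<k]" for h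
  define hist where "hist = rec_nat [q] (\<lambda>_ h. h @ [trans C (last h) (c (last h) (mv h))])"
  have hist0: "hist 0 = [q]" and histS: "hist (Suc n) = hist n @ [trans C (last (hist n)) (c (last (hist n)) (mv (hist n)))]" for n
    by (simp_all add: hist_def)
  define \<rho> where "\<rho> n = last (hist n)" for n
  have map: "hist n = map \<rho> [0..<Suc n]" for n
    by (induction n) (auto simp: hist0 histS \<rho>_def)
  have mv: "mv h \<in> act_tuples k C (last h)" if "h \<noteq> []" "set h \<subseteq> states C" for h
  proof -
    have "last h \<in> states C" using that by auto
    then show ?thesis
      using s that zeros[of "last h"] by (auto simp: mv_def act_tuples_def is_profile_def is_strategy_def)
  qed
  have st: "set (hist n) \<subseteq> states C \<and> hist n \<noteq> []" for n
  proof (induction n)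
    case (Suc n)
    then have "last (hist n) \<in> states C" by auto
    then show ?case using Suc c mv trans_states by (simp add: histS)
  qed (use q in \<open>simp add: hist0\<close>)
  have \<rho>S: "\<rho> (Suc n) = trans C (\<rho> n) (c (\<rho> n) (mv (hist n)))" for n by (simp add: \<rho>_def histS)
  have \<rho>st: "\<rho> n \<in> states C" for n using st[of n] by (auto simp: \<rho>_def)
  have mvt: "mv (hist n) \<in> act_tuples k C (\<rho> n)" for n using mv st unfolding \<rho>_def by blast
  show ?thesis
  proof (rule that[of \<rho>])
    show "\<rho> \<in> outcomes k C A q s"
      unfolding outcomes_def
    proof (intro CollectI conjI allI)
      show "\<rho> 0 = q" by (simp add: \<rho>_def hist0)
      fix i
      have "mv h ! a = s a h" if "a \<in> A" for a h using that A by (auto simp: mv_def)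
      then show "\<exists>\<alpha>\<in>act_tuples k C (\<rho> i). (\<forall>a\<in>A. \<alpha> ! a = s a (map \<rho> [0..<Suc i])) \<and> \<rho> (Suc i) = trans C (\<rho> i) \<alpha>"
        using c[OF \<rho>st mvt, of i] unfolding map[symmetric] \<rho>S by (intro bexI[of _ "c (\<rho> i) (mv (hist i))"]) auto
    qed
    show "\<exists>\<alpha>\<in>act_tuples k C (\<rho> n). \<rho> (Suc n) = trans C (\<rho> n) (c (\<rho> n) \<alpha>)" for n
      using mvt \<rho>S by blast
  qed
qed

lemma not_Cpre_response:
  assumes "q \<in> states C" and "q \<notin> Cpre k C A X" and "\<alpha> \<in> act_tuples k C q"
  shows "\<exists>\<beta>\<in>act_tuples k C q. (\<forall>a\<in>A. \<beta> ! a = \<alpha> ! a) \<and> trans C q \<beta> \<notin> X"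
  using assms unfolding Cpre_def by blast

lemma game_subset: "X \<subseteq> states C \<Longrightarrow> game k C A t X i \<subseteq> states C"
  by (cases t; induction i) (auto simp: Cpre_def)

lemma game_Finally_inc: "game k C A Finally X i \<subseteq> game k C A Finally X (Suc i)"
proof (induction i)
  case (Suc i)
  then show ?case using Cpre_mono[OF Suc, of k C A] by simp blast
qed simp

lemma game_Globally_dec: "game k C A Globally X (Suc i) \<subseteq> game k C A Globally X i"
proof (induction i)
  case (Suc i)
  then show ?case using Cpre_mono[OF Suc, of k C A] by simp blast
qed simp

lemma game_Finally_stable:
  assumes "X \<subseteq> states C"
  shows "game k C A Finally X i \<subseteq> game k C A Finally X (card (states C))"
proof (rule chain_stable)
  show "finite (states C)" using cgs by (simp add: is_cgs_def)
qed (use game_subset[OF assms] game_Finally_inc in simp_all)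

lemma game_Globally_stable:
  assumes "X \<subseteq> states C"
  shows "game k C A Globally X (card (states C)) \<subseteq> game k C A Globally X i"
proof -
  let ?S = "\<lambda>i. states C - game k C A Globally X i"
  have "?S i \<subseteq> ?S (card (states C))"
  proof (rule chain_stable)
    show "finite (states C)" using cgs by (simp add: is_cgs_def)
    show "?S i \<subseteq> ?S (Suc i)" for i using game_Globally_dec by blast
    fix i assume "?S i = ?S (Suc i)"
    then have "game k C A Globally X i = game k C A Globally X (Suc i)"
      using game_subset[OF assms, of Globally i] game_subset[OF assms, of Globally "Suc i"] by blast
    then show "?S (Suc i) = ?S (Suc (Suc i))" by simp
  qed auto
  then show ?thesis using game_subset[OF assms, of Globally "card (states C)"] by blast
qed

text \<open>Read \<open>R i j\<close> as: position \<open>j\<close> of a path has rank at most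
  \<open>i\<close>. The least rank drops with every step, so \<open>G\<close> is reached at rank 0
  at the latest. It serves the coalition for \<open>Finally\<close> (entering the sets of the
  iteration) and the opponents for \<open>Globally\<close> (dropping out of them).\<close>

lemma reach_rank:
  assumes "\<And>j. R 0 j \<Longrightarrow> G" and "\<And>i j. R (Suc i) j \<Longrightarrow> \<not> R i j \<Longrightarrow> R i (Suc j) \<or> G" and "R i (j::nat)"
  shows G
  using assms(3)
proof (induction i arbitrary: j rule: less_induct)
  case (less i)
  define r where "r = (LEAST i. R i j)"
  have r: "R r j" "r \<le> i" "\<And>i'. i' < r \<Longrightarrow> \<not> R i' j"
    using less.prems unfolding r_def by (auto intro: LeastI Least_le dest: not_less_Least)
  show ?case
  proof (cases r)
    case 0
    then show ?thesis using r(1) assms(1) by simp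
  next
    case (Suc m)
    then have "R m (Suc j) \<or> G" using assms(2)[of m j] r by simp
    then show ?thesis using less.IH[of m] Suc r(2) by auto
  qed
qed

lemma sat_Finally:
  assumes q: "q \<in> states C"
  shows "sat k C (Strat A Finally \<phi>) q \<longleftrightarrow> q \<in> game k C A Finally {q \<in> states C. sat k C \<phi> q} (card (states C))"
proof
  define X where "X = {q \<in> states C. sat k C \<phi> q}"
  let ?G = "game k C A Finally X"
  have X: "X \<subseteq> states C" by (auto simp: X_def)
  assume "q \<in> game k C A Finally {q \<in> states C. sat k C \<phi> q} (card (states C))"
  then have qG: "q \<in> ?G (card (states C))" by (simp add: X_def)
  \<comment> \<open>The move must work for the round at which the state enters the increasing sets.
    The definition quantifies over all \<open>i\<close>, but at most one satisfies both premises, so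
    a single move suffices.\<close>
  define good where "good q \<alpha> \<longleftrightarrow> \<alpha> \<in> act_tuples k C q \<and> (\<forall>i. q \<in> ?G (Suc i) \<longrightarrow> q \<notin> ?G i \<longrightarrow>
     (\<forall>\<beta>\<in>act_tuples k C q. (\<forall>a\<in>A. \<beta> ! a = \<alpha> ! a) \<longrightarrow> trans C q \<beta> \<in> ?G i))" for q \<alpha>
  have good: "\<exists>\<alpha>. good q \<alpha>" if q: "q \<in> states C" for q
  proof (cases "\<exists>i. q \<in> ?G (Suc i) \<and> q \<notin> ?G i")
    case True
    then obtain i where i: "q \<in> ?G (Suc i)" "q \<notin> ?G i" by blast
    have mono: "?G a \<subseteq> ?G b" if "a \<le> b" for a b
      using that game_Finally_inc by (rule lift_Suc_mono_le[of ?G, rotated])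
    have uniq: "i' = i" if "q \<in> ?G (Suc i')" "q \<notin> ?G i'" for i'
      using that i mono by (metis le_antisym not_less_eq_eq subsetD)
    have "X \<subseteq> ?G i" using mono[of 0 i] by simp
    then have "q \<in> Cpre k C A (?G i)" using i by auto
    then show ?thesis unfolding good_def Cpre_def using uniq by blast
  next
    case False
    then show ?thesis using zeros[OF q] unfolding good_def by blast
  qed
  define w where "w q = (SOME \<alpha>. good q \<alpha>)" for q
  have w: "good q (w q)" if "q \<in> states C" for q
    using good[OF that] unfolding w_def by (rule someI_ex)
  obtain s where s: "is_profile C A s"
    "\<And>q \<rho> i. q \<in> states C \<Longrightarrow> \<rho> \<in> outcomes k C A q s \<Longrightarrow>
       \<exists>\<beta>\<in>act_tuples k C (\<rho> i). (\<forall>a\<in>A. \<beta> ! a = w (\<rho> i) ! a) \<and> \<rho> (Suc i) = trans C (\<rho> i) \<beta>"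
    by (rule positional[of w]) (use w in \<open>auto simp: good_def\<close>)
  have "\<exists>i. sat k C \<phi> (\<rho> i)" if \<rho>: "\<rho> \<in> outcomes k C A q s" for \<rho>
  proof (rule reach_rank[where R = "\<lambda>i j. \<rho> j \<in> ?G i"])
    show "\<exists>i. sat k C \<phi> (\<rho> i)" if "\<rho> j \<in> ?G 0" for j using that by (auto simp: X_def)
    show "\<rho> 0 \<in> ?G (card (states C))" using qG \<rho> by (simp add: outcomes_def)
    show "\<rho> (Suc j) \<in> ?G i \<or> (\<exists>i. sat k C \<phi> (\<rho> i))" if "\<rho> j \<in> ?G (Suc i)" "\<rho> j \<notin> ?G i" for i j
      using w[OF outcomes_states[OF q \<rho>], of j] s(2)[OF q \<rho>, of j] that unfolding good_def by metis
  qed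
  then show "sat k C (Strat A Finally \<phi>) q" using s(1) by auto
next
  define X where "X = {q \<in> states C. sat k C \<phi> q}"
  define Z where "Z = game k C A Finally X (card (states C))"
  have X: "X \<subseteq> states C" by (auto simp: X_def)
  assume "sat k C (Strat A Finally \<phi>) q"
  then obtain s where s: "is_profile C A s" "\<And>\<rho>. \<rho> \<in> outcomes k C A q s \<Longrightarrow> \<exists>i. sat k C \<phi> (\<rho> i)" by auto
  \<comment> \<open>As \<open>Z\<close> is closed under \<open>Cpre\<close>, the opponents can
    answer every move made outside \<open>Z\<close> by staying outside, and then never meet
    \<open>X\<close>.\<close>
  have Z: "X \<subseteq> Z" "Cpre k C A Z \<subseteq> Z"
    using game_Finally_stable[OF X, of 0] game_Finally_stable[OF X, of "Suc (card (states C))"]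
    by (auto simp: Z_def)
  define good where "good q \<alpha> \<beta> \<longleftrightarrow> \<beta> \<in> act_tuples k C q \<and> (\<forall>a\<in>A. \<beta> ! a = \<alpha> ! a) \<and>
     (q \<notin> Z \<longrightarrow> trans C q \<beta> \<notin> Z)" for q \<alpha> \<beta>
  have good: "\<exists>\<beta>. good q \<alpha> \<beta>" if q: "q \<in> states C" "\<alpha> \<in> act_tuples k C q" for q \<alpha>
    using not_Cpre_response[of q Z \<alpha>] Z q unfolding good_def by blast
  define c where "c q \<alpha> = (SOME \<beta>. good q \<alpha> \<beta>)" for q \<alpha>
  have c: "good q \<alpha> (c q \<alpha>)" if "q \<in> states C" "\<alpha> \<in> act_tuples k C q" for q \<alpha>
    using good[OF that] unfolding c_def by (rule someI_ex)
  obtain \<rho> where \<rho>: "\<rho> \<in> outcomes k C A q s"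
    "\<And>n. \<exists>\<alpha>\<in>act_tuples k C (\<rho> n). \<rho> (Suc n) = trans C (\<rho> n) (c (\<rho> n) \<alpha>)"
    by (rule counter_path[OF s(1) q, of c]) (use c in \<open>auto simp: good_def\<close>)
  have "q \<in> Z"
  proof (rule ccontr)
    assume qZ: "q \<notin> Z"
    have "\<rho> n \<notin> Z" for n
    proof (induction n)
      case 0
      show ?case using \<rho>(1) qZ by (simp add: outcomes_def)
    next
      case (Suc n)
      then show ?case using \<rho>(2)[of n] c[OF outcomes_states[OF q \<rho>(1)], of _ n] unfolding good_def by auto
    qed
    then show False using s(2)[OF \<rho>(1)] Z(1) outcomes_states[OF q \<rho>(1)] by (auto simp: X_def)
  qed
  then show "q \<in> game k C A Finally {q \<in> states C. sat k C \<phi> q} (card (states C))" by (simp add: Z_def X_def)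
qed

text \<open>Mirror image of \<open>sat_Finally\<close>: here the coalition remains inside a set
  contained in its own \<open>Cpre\<close>, and the opponents descend along the rounds of the
  iteration.\<close>

lemma sat_Globally:
  assumes q: "q \<in> states C"
  shows "sat k C (Strat A Globally \<phi>) q \<longleftrightarrow> q \<in> game k C A Globally {q \<in> states C. sat k C \<phi> q} (card (states C))"
proof
  define X where "X = {q \<in> states C. sat k C \<phi> q}"
  define Z where "Z = game k C A Globally X (card (states C))"
  have X: "X \<subseteq> states C" by (auto simp: X_def)
  assume "q \<in> game k C A Globally {q \<in> states C. sat k C \<phi> q} (card (states C))"
  then have qZ: "q \<in> Z" by (simp add: X_def Z_def)
  have Z: "Z \<subseteq> X" "Z \<subseteq> Cpre k C A Z"
    using game_Globally_stable[OF X, of 0] game_Globally_stable[OF X, of "Suc (card (states C))"]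
    by (auto simp: Z_def)
  define good where "good q \<alpha> \<longleftrightarrow> \<alpha> \<in> act_tuples k C q \<and> (q \<in> Z \<longrightarrow>
     (\<forall>\<beta>\<in>act_tuples k C q. (\<forall>a\<in>A. \<beta> ! a = \<alpha> ! a) \<longrightarrow> trans C q \<beta> \<in> Z))" for q \<alpha>
  have good: "\<exists>\<alpha>. good q \<alpha>" if q: "q \<in> states C" for q
  proof (cases "q \<in> Z")
    case True
    then show ?thesis using Z(2) unfolding good_def Cpre_def by blast
  next
    case False
    then show ?thesis using zeros[OF q] unfolding good_def by blast
  qed
  define w where "w q = (SOME \<alpha>. good q \<alpha>)" for q
  have w: "good q (w q)" if "q \<in> states C" for q
    using good[OF that] unfolding w_def by (rule someI_ex)
  obtain s where s: "is_profile C A s"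
    "\<And>q \<rho> i. q \<in> states C \<Longrightarrow> \<rho> \<in> outcomes k C A q s \<Longrightarrow>
       \<exists>\<beta>\<in>act_tuples k C (\<rho> i). (\<forall>a\<in>A. \<beta> ! a = w (\<rho> i) ! a) \<and> \<rho> (Suc i) = trans C (\<rho> i) \<beta>"
    by (rule positional[of w]) (use w in \<open>auto simp: good_def\<close>)
  have "sat k C \<phi> (\<rho> i)" if \<rho>: "\<rho> \<in> outcomes k C A q s" for \<rho> i
  proof -
    have "\<rho> i \<in> Z"
    proof (induction i)
      case 0
      show ?case using \<rho> qZ by (simp add: outcomes_def)
    next
      case (Suc i)
      then show ?case
        using w[OF outcomes_states[OF q \<rho>], of i] s(2)[OF q \<rho>, of i] unfolding good_def by metis
    qed
    then show ?thesis using Z(1) by (auto simp: X_def)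
  qed
  then show "sat k C (Strat A Globally \<phi>) q" using s(1) by auto
next
  define X where "X = {q \<in> states C. sat k C \<phi> q}"
  let ?G = "game k C A Globally X"
  have X: "X \<subseteq> states C" by (auto simp: X_def)
  assume "sat k C (Strat A Globally \<phi>) q"
  then obtain s where s: "is_profile C A s" "\<And>\<rho> i. \<rho> \<in> outcomes k C A q s \<Longrightarrow> sat k C \<phi> (\<rho> i)" by auto
  \<comment> \<open>The opponents leave \<open>?G i\<close> from a state that belongs to
    \<open>?G i\<close> but not to the next set. By monotonicity there is at most one such
    \<open>i\<close>, so one answer covers all.\<close>
  define good where "good q \<alpha> \<beta> \<longleftrightarrow> \<beta> \<in> act_tuples k C q \<and> (\<forall>a\<in>A. \<beta> ! a = \<alpha> ! a) \<and>
     (\<forall>i. q \<notin> ?G (Suc i) \<longrightarrow> q \<in> ?G i \<longrightarrow> trans C q \<beta> \<notin> ?G i)" for q \<alpha> \<beta>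
  have good: "\<exists>\<beta>. good q \<alpha> \<beta>" if q: "q \<in> states C" "\<alpha> \<in> act_tuples k C q" for q \<alpha>
  proof (cases "\<exists>i. q \<notin> ?G (Suc i) \<and> q \<in> ?G i")
    case True
    then obtain i where i: "q \<notin> ?G (Suc i)" "q \<in> ?G i" by blast
    have mono: "?G b \<subseteq> ?G a" if "a \<le> b" for a b
      using that game_Globally_dec by (rule lift_Suc_antimono_le[of ?G, rotated])
    have uniq: "i' = i" if "q \<notin> ?G (Suc i')" "q \<in> ?G i'" for i'
      using that i mono by (metis le_antisym not_less_eq_eq subsetD)
    have "?G i \<subseteq> X" using mono[of 0 i] by simp
    then have "q \<notin> Cpre k C A (?G i)" using i by auto
    from not_Cpre_response[OF q(1) this q(2)] show ?thesis unfolding good_def using uniq by blast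
  next
    case False
    then show ?thesis using q unfolding good_def by blast
  qed
  define c where "c q \<alpha> = (SOME \<beta>. good q \<alpha> \<beta>)" for q \<alpha>
  have c: "good q \<alpha> (c q \<alpha>)" if "q \<in> states C" "\<alpha> \<in> act_tuples k C q" for q \<alpha>
    using good[OF that] unfolding c_def by (rule someI_ex)
  obtain \<rho> where \<rho>: "\<rho> \<in> outcomes k C A q s"
    "\<And>n. \<exists>\<alpha>\<in>act_tuples k C (\<rho> n). \<rho> (Suc n) = trans C (\<rho> n) (c (\<rho> n) \<alpha>)"
    by (rule counter_path[OF s(1) q, of c]) (use c in \<open>auto simp: good_def\<close>)
  have "q \<in> ?G (card (states C))"
  proof (rule ccontr)
    assume "q \<notin> ?G (card (states C))"
    then have "\<rho> 0 \<notin> ?G (card (states C))" using \<rho>(1) by (simp add: outcomes_def)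
    then show False
    proof (rule reach_rank[where R = "\<lambda>i j. \<rho> j \<notin> ?G i", rotated 2])
      show False if "\<rho> j \<notin> ?G 0" for j
        using that s(2)[OF \<rho>(1)] outcomes_states[OF q \<rho>(1)] by (auto simp: X_def)
      show "\<rho> (Suc j) \<notin> ?G i \<or> False" if "\<rho> j \<notin> ?G (Suc i)" "\<not> \<rho> j \<notin> ?G i" for i j
        using \<rho>(2)[of j] c[OF outcomes_states[OF q \<rho>(1)], of _ j] that unfolding good_def by metis
    qed
  qed
  then show "q \<in> game k C A Globally {q \<in> states C. sat k C \<phi> q} (card (states C))" by (simp add: X_def)
qed

lemma sat_Strat:
  "q \<in> states C \<Longrightarrow> sat k C (Strat A t \<phi>) q \<longleftrightarrow> q \<in> game k C A t {q \<in> states C. sat k C \<phi> q} (card (states C))"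
  using sat_Finally sat_Globally by (cases t) blast+

lemma sat_Finally_iff:
  "q \<in> states C \<Longrightarrow> sat k C (Strat A Finally \<phi>) q \<longleftrightarrow> (\<exists>i. q \<in> game k C A Finally {q \<in> states C. sat k C \<phi> q} i)"
  using sat_Finally game_Finally_stable[of "{q \<in> states C. sat k C \<phi> q}"] by blast

lemma sat_Globally_iff:
  "q \<in> states C \<Longrightarrow> sat k C (Strat A Globally \<phi>) q \<longleftrightarrow> (\<forall>i. q \<in> game k C A Globally {q \<in> states C. sat k C \<phi> q} i)"
  using sat_Globally game_Globally_stable[of "{q \<in> states C. sat k C \<phi> q}"] by blast

end

section \<open>Satisfiability of clauses as learnability from chains\<close>

section \<open>Chain games\<close>

text \<open>
  Action 1 is a vote for leaving the state. For \<open>g\<close>, the operator is \<open>\<^bold>G\<close>, and labels, coalitions and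
  truth values are complemented, which reduces \<open>\<^bold>G\<close> to \<open>\<^bold>F\<close>.
\<close>

definition chain :: "bool \<Rightarrow> (nat \<Rightarrow> nat set \<Rightarrow> bool) \<Rightarrow> nat \<Rightarrow> (nat, nat) cgs" where
  "chain g U l = \<lparr>states = {..<Suc l}, init = {l}, label = (\<lambda>q. if (q = 0) \<noteq> g then {0} else {}),
     num_act = (\<lambda>_ _. 2),
     trans = (\<lambda>q \<alpha>. if q \<noteq> 0 \<and> U q {a. a < 3 \<and> \<alpha> ! a = 1} then q - 1 else q)\<rparr>"

abbreviation op_of :: "bool \<Rightarrow> temp_op" where
  "op_of g \<equiv> if g then Globally else Finally"

abbreviation dual :: "bool \<Rightarrow> nat set \<Rightarrow> nat set" where
  "dual g A \<equiv> if g then {..<3} - A else A"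

text \<open>For \<open>g\<close> this is falsity: \<open>sat\<close> corresponds to
  \<open>val g U \<phi> q \<noteq> g\<close>. Hence arguments and result are negated around binary
  operators, while atoms and strategic operators read the same in both cases.\<close>

primrec val :: "bool \<Rightarrow> (nat \<Rightarrow> nat set \<Rightarrow> bool) \<Rightarrow> nat atl \<Rightarrow> nat \<Rightarrow> bool" where
  "val g U (Atom p) q \<longleftrightarrow> q = 0"
| "val g U (Bin b \<phi> \<psi>) q \<longleftrightarrow> bin_sem b (val g U \<phi> q \<noteq> g) (val g U \<psi> q \<noteq> g) \<noteq> g"
| "val g U (Strat A t \<phi>) q \<longleftrightarrow> (\<exists>j\<le>q. val g U \<phi> j \<and> (\<forall>m. j < m \<and> m \<le> q \<longrightarrow> U m (dual g A)))"

definition upward :: "(nat \<Rightarrow> nat set \<Rightarrow> bool) \<Rightarrow> bool" where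
  "upward U \<longleftrightarrow> (\<forall>m A B. U m A \<longrightarrow> A \<subseteq> B \<longrightarrow> U m B)"

lemma upwardD: "upward U \<Longrightarrow> U m A \<Longrightarrow> A \<subseteq> B \<Longrightarrow> U m B"
  unfolding upward_def by blast

lemma std_chain: "std_cgs 3 1 (chain g U l)"
  by (auto simp: std_cgs_def is_cgs_def chain_def)

lemma chain_simps [simp]:
  "states (chain g U l) = {..<Suc l}" "init (chain g U l) = {l}"
  "trans (chain g U l) q \<alpha> = (if q \<noteq> 0 \<and> U q {a. a < 3 \<and> \<alpha> ! a = 1} then q - 1 else q)"
  "act_tuples 3 (chain g U l) q = {\<alpha>. length \<alpha> = 3 \<and> (\<forall>a<3. \<alpha> ! a < 2)}"
  by (auto simp: chain_def act_tuples_def)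

text \<open>As the families are upward closed, the opponents do best by abstaining and the coalition
  by voting unanimously, so only \<open>U m A\<close> counts. Unwanted votes can only speed up the
  descent, which goes one level at a time and skips no target.\<close>

lemma game_chain_Finally:
  assumes U: "upward U" and A: "A \<subseteq> {..<3}" and q: "q \<le> l"
  shows "(\<exists>i. q \<in> game 3 (chain g U l) A Finally {q. q \<le> l \<and> X q} i) \<longleftrightarrow>
    (\<exists>j\<le>q. X j \<and> (\<forall>m. j < m \<and> m \<le> q \<longrightarrow> U m A))" (is "(\<exists>i. q \<in> ?G i) \<longleftrightarrow> ?W q")
proof
  have "q \<in> ?G i \<Longrightarrow> ?W q" for i q
  proof (induction i arbitrary: q)
    case 0
    then show ?case by auto
  next
    case (Suc i)
    then consider "X q" | "q \<in> Cpre 3 (chain g U l) A (?G i)" by auto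
    then show ?case
    proof cases
      case 2
      then obtain \<alpha> where \<alpha>: "length \<alpha> = 3" "\<forall>a<3. \<alpha> ! a < 2"
        "\<And>\<beta>. length \<beta> = 3 \<Longrightarrow> \<forall>a<3. \<beta> ! a < 2 \<Longrightarrow> \<forall>a\<in>A. \<beta> ! a = \<alpha> ! a \<Longrightarrow>
           trans (chain g U l) q \<beta> \<in> ?G i"
        unfolding Cpre_def chain_simps(4) by blast
      define \<beta> where "\<beta> = map (\<lambda>a. if a \<in> A then \<alpha> ! a else 0) [0..<3]"
      have "trans (chain g U l) q \<beta> \<in> ?G i"
        by (rule \<alpha>(3)) (use \<alpha>(2) A in \<open>auto simp: \<beta>_def\<close>)
      moreover have "{a. a < 3 \<and> \<beta> ! a = 1} \<subseteq> A" by (auto simp: \<beta>_def split: if_splits)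
      ultimately consider "q \<in> ?G i" | "q \<noteq> 0" "U q A" "q - 1 \<in> ?G i"
        using upwardD[OF U] by (auto split: if_splits)
      then show ?thesis
      proof cases
        case 1
        then show ?thesis by (rule Suc.IH)
      next
        case 2
        obtain j where "j \<le> q - 1" "X j" "\<forall>m. j < m \<and> m \<le> q - 1 \<longrightarrow> U m A"
          using Suc.IH[OF 2(3)] by blast
        then show ?thesis using 2 by (intro exI[of _ j]) (auto simp: le_Suc_eq elim: less_SucE dest: le_neq_implies_less)
      qed
    qed auto
  qed
  then show "\<exists>i. q \<in> ?G i \<Longrightarrow> ?W q" by blast
next
  assume "?W q"
  then obtain j where j: "j \<le> q" "X j" "\<And>m. j < m \<Longrightarrow> m \<le> q \<Longrightarrow> U m A" by blast
  have "j + d \<le> q \<Longrightarrow> j + d \<in> ?G d" for d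
  proof (induction d)
    case 0
    then show ?case using j q by simp
  next
    case (Suc d)
    define \<alpha> where "\<alpha> = map (\<lambda>a. if a \<in> A then 1 else 0 :: nat) [0..<3]"
    have "j + Suc d \<in> Cpre 3 (chain g U l) A (?G d)"
      unfolding Cpre_def
    proof (intro CollectI conjI bexI[of _ \<alpha>] ballI impI)
      show "\<alpha> \<in> act_tuples 3 (chain g U l) (j + Suc d)" by (simp add: \<alpha>_def)
      fix \<beta> assume \<beta>: "\<forall>a\<in>A. \<beta> ! a = \<alpha> ! a"
      have "A \<subseteq> {a. a < 3 \<and> \<beta> ! a = 1}" using \<beta> A by (auto simp: \<alpha>_def)
      then have "U (j + Suc d) {a. a < 3 \<and> \<beta> ! a = 1}"
        using upwardD[OF U] j(3)[of "j + Suc d"] Suc.prems by auto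
      then show "trans (chain g U l) (j + Suc d) \<beta> \<in> ?G d" using Suc by simp
    qed (use Suc.prems q in simp)
    then show ?case by simp
  qed
  from this[of "q - j"] show "\<exists>i. q \<in> ?G i" using j(1) by auto
qed

text \<open>Now the coalition wants to avoid the descent and does best by abstaining, so the
  opponents pass a level iff their own set belongs to the family. This is where the complement in
  \<open>dual\<close> comes from.\<close>

lemma game_chain_Globally:
  assumes U: "upward U" and A: "A \<subseteq> {..<3}" and q: "q \<le> l"
  shows "(\<exists>i. q \<notin> game 3 (chain g U l) A Globally {q. q \<le> l \<and> X q} i) \<longleftrightarrow>
    (\<exists>j\<le>q. \<not> X j \<and> (\<forall>m. j < m \<and> m \<le> q \<longrightarrow> U m ({..<3} - A)))" (is "(\<exists>i. q \<notin> ?G i) \<longleftrightarrow> ?W q")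
proof
  have "q \<le> l \<Longrightarrow> q \<notin> ?G i \<Longrightarrow> ?W q" for i q
  proof (induction i arbitrary: q)
    case 0
    then show ?case by auto
  next
    case (Suc i)
    then consider "\<not> X q" | "q \<notin> Cpre 3 (chain g U l) A (?G i)" by auto
    then show ?case
    proof cases
      case 2
      have "replicate 3 0 \<in> act_tuples 3 (chain g U l) q" by simp
      then obtain \<beta> where \<beta>: "\<forall>a\<in>A. \<beta> ! a = replicate 3 0 ! a" "trans (chain g U l) q \<beta> \<notin> ?G i"
        using 2 Suc.prems(1) unfolding Cpre_def by (simp only: chain_simps(1) lessThan_iff less_Suc_eq_le mem_Collect_eq) blast
      have "{a. a < 3 \<and> \<beta> ! a = 1} \<subseteq> {..<3} - A" using \<beta>(1) by auto
      with \<beta>(2) consider "q \<notin> ?G i" | "q \<noteq> 0" "U q ({..<3} - A)" "q - 1 \<notin> ?G i"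
        using upwardD[OF U] by (auto split: if_splits)
      then show ?thesis
      proof cases
        case 1
        then show ?thesis by (rule Suc.IH[OF Suc.prems(1)])
      next
        case 2
        have "q - 1 \<le> l" using Suc.prems(1) by simp
        then obtain j where "j \<le> q - 1" "\<not> X j" "\<forall>m. j < m \<and> m \<le> q - 1 \<longrightarrow> U m ({..<3} - A)"
          using Suc.IH[OF _ 2(3)] by blast
        then show ?thesis using 2 by (intro exI[of _ j]) (auto simp: le_Suc_eq elim: less_SucE dest: le_neq_implies_less)
      qed
    qed auto
  qed
  then show "\<exists>i. q \<notin> ?G i \<Longrightarrow> ?W q" using q by blast
next
  assume "?W q"
  then obtain j where j: "j \<le> q" "\<not> X j" "\<And>m. j < m \<Longrightarrow> m \<le> q \<Longrightarrow> U m ({..<3} - A)" by blast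
  have "j + d \<le> q \<Longrightarrow> j + d \<notin> ?G d" for d
  proof (induction d)
    case 0
    then show ?case using j q by simp
  next
    case (Suc d)
    have "j + Suc d \<notin> Cpre 3 (chain g U l) A (?G d)"
    proof
      assume "j + Suc d \<in> Cpre 3 (chain g U l) A (?G d)"
      then obtain \<alpha> where \<alpha>: "\<forall>a<3. \<alpha> ! a < 2"
        "\<And>\<beta>. length \<beta> = 3 \<Longrightarrow> \<forall>a<3. \<beta> ! a < 2 \<Longrightarrow> \<forall>a\<in>A. \<beta> ! a = \<alpha> ! a \<Longrightarrow>
           trans (chain g U l) (j + Suc d) \<beta> \<in> ?G d"
        unfolding Cpre_def chain_simps(4) by blast
      define \<beta> where "\<beta> = map (\<lambda>a. if a \<in> A then \<alpha> ! a else 1) [0..<3]"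
      have "trans (chain g U l) (j + Suc d) \<beta> \<in> ?G d"
        by (rule \<alpha>(2)) (use \<alpha>(1) A in \<open>auto simp: \<beta>_def\<close>)
      moreover have "{..<3} - A \<subseteq> {a. a < 3 \<and> \<beta> ! a = 1}" by (auto simp: \<beta>_def)
      then have "U (j + Suc d) {a. a < 3 \<and> \<beta> ! a = 1}"
        using upwardD[OF U] j(3)[of "j + Suc d"] Suc.prems by auto
      ultimately show False using Suc by simp
    qed
    then show ?case by simp
  qed
  from this[of "q - j"] show "\<exists>i. q \<notin> ?G i" using j(1) by (metis le_add_diff_inverse order_refl)
qed

lemma sat_chain:
  assumes U: "upward U"
  shows "\<phi> \<in> ATL 3 {..<1} {op_of g} Bl \<Longrightarrow> q \<le> l \<Longrightarrow> sat 3 (chain g U l) \<phi> q \<longleftrightarrow> (val g U \<phi> q \<noteq> g)"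
proof (induction arbitrary: q rule: ATL.induct)
  case (1 p)
  then show ?case by (auto simp: chain_def)
next
  case (2 b \<phi> \<psi>)
  then show ?case by auto
next
  case (3 A t \<phi>)
  interpret game_structure 3 "{..<1}" "chain g U l" A
    by standard (use 3 std_chain[of g U l] in \<open>auto simp: std_cgs_def\<close>)
  have q: "q \<in> states (chain g U l)" using 3 by simp
  have X: "{q \<in> states (chain g U l). sat 3 (chain g U l) \<phi> q} = {q. q \<le> l \<and> val g U \<phi> q \<noteq> g}"
    using 3(4) by auto
  have le: "\<And>j. j \<le> q \<Longrightarrow> j \<le> l" using 3(5) by simp
  show ?case
  proof (cases g)
    case True
    then have t: "t = Globally" using 3(2) by simp
    show ?thesis
      using sat_Globally_iff[OF q, of \<phi>] game_chain_Globally[OF U A 3(5), of g "\<lambda>q. val g U \<phi> q \<noteq> g"] True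
      unfolding X t by auto
  next
    case False
    then have t: "t = Finally" using 3(2) by simp
    show ?thesis
      using sat_Finally_iff[OF q, of \<phi>] game_chain_Finally[OF U A 3(5), of g "\<lambda>q. val g U \<phi> q \<noteq> g"] False
      unfolding X t by auto
  qed
qed

subsection \<open>Formulas without binary operators\<close>

primrec sdepth :: "'p atl \<Rightarrow> nat" where
  "sdepth (Atom p) = 0"
| "sdepth (Bin b \<phi> \<psi>) = max (sdepth \<phi>) (sdepth \<psi>)"
| "sdepth (Strat A t \<phi>) = Suc (sdepth \<phi>)"

text \<open>This is what leaves no room for binary operators below the size bound.\<close>

lemma val_periodic:
  assumes per: "\<And>m. m \<ge> 1 \<Longrightarrow> U (m + 2) = U m"
  shows "sdepth \<phi> < q \<Longrightarrow> val g U \<phi> (q + 2) = val g U \<phi> q"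
proof (induction \<phi> arbitrary: q)
  case (Strat A t \<phi>)
  let ?U = "\<lambda>m. U m (dual g A)"
  \<comment> \<open>The strategic operator itself uses up one unit of depth, so the induction
    hypothesis also applies at \<open>q - 1\<close>. It compares the levels \<open>q - 1\<close> and
    \<open>q + 1\<close>, which takes care of descents ending just below the top.\<close>
  have q: "q \<ge> 2" "sdepth \<phi> < q" "sdepth \<phi> < q - 1" using Strat.prems by auto
  have v1: "val g U \<phi> (q + 2) = val g U \<phi> q" using Strat.IH[OF q(2)] .
  have v2: "val g U \<phi> (q + 1) = val g U \<phi> (q - 1)" using Strat.IH[OF q(3)] q(1)
    by (simp add: numeral_2_eq_2 Suc_diff_le)
  have u1: "?U (q + 2) = ?U q" using per[of q] q by simp
  have u2: "?U (q + 1) = ?U (q - 1)" using per[of "q - 1"] q by (simp add: numeral_2_eq_2 Suc_diff_le)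
  show ?case
  proof
    assume "val g U (Strat A t \<phi>) (q + 2)"
    then obtain j where j: "j \<le> q + 2" "val g U \<phi> j" "\<And>m. j < m \<Longrightarrow> m \<le> q + 2 \<Longrightarrow> ?U m" by auto
    consider "j = q + 2" | "j = q + 1" | "j \<le> q" using j(1) by linarith
    then show "val g U (Strat A t \<phi>) q"
    proof cases
      case 1
      then show ?thesis using j v1 by auto
    next
      case 2
      then have v: "val g U \<phi> (q - 1)" and u: "?U q" using j v2 u1 by auto
      have "?U m" if "q - 1 < m" "m \<le> q" for m
      proof -
        have "m = q" using that by simp
        then show ?thesis using u by simp
      qed
      with v show ?thesis unfolding val.simps by (intro exI[of _ "q - 1"]) auto
    next
      case 3
      then show ?thesis using j by auto
    qed
  next
    assume "val g U (Strat A t \<phi>) q"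
    then obtain j where j: "j \<le> q" "val g U \<phi> j" "\<And>m. j < m \<Longrightarrow> m \<le> q \<Longrightarrow> ?U m" by auto
    consider "j = q" | "j = q - 1" | "j < q - 1" using j(1) by linarith
    then show "val g U (Strat A t \<phi>) (q + 2)"
    proof cases
      case 1
      then show ?thesis using j v1 by auto
    next
      case 2
      then have v: "val g U \<phi> (q + 1)" and u: "?U (q + 2)" using j v2 u1 q by auto
      have "?U m" if "q + 1 < m" "m \<le> q + 2" for m
      proof -
        have "m = q + 2" using that by simp
        then show ?thesis using u by simp
      qed
      with v show ?thesis unfolding val.simps by (intro exI[of _ "q + 1"]) auto
    next
      case 3
      then have "?U (q + 1)" "?U (q + 2)" using j(3)[of q] j(3)[of "q - 1"] u1 u2 by auto
      moreover have "m \<le> q \<or> m = q + 1 \<or> m = q + 2" if "m \<le> q + 2" for m using that by linarith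
      ultimately have "\<forall>m. j < m \<and> m \<le> q + 2 \<longrightarrow> ?U m" using j(3) by metis
      then show ?thesis using j(1,2) unfolding val.simps by (intro exI[of _ j]) simp
    qed
  qed
qed auto

abbreviation is_Bin :: "'p atl \<Rightarrow> bool" where
  "is_Bin \<psi> \<equiv> \<exists>b \<psi>\<^sub>1 \<psi>\<^sub>2. \<psi> = Bin b \<psi>\<^sub>1 \<psi>\<^sub>2"

lemma finite_subformulas: "finite (subformulas \<phi>)"
  by (induction \<phi>) auto

lemma subformulas_refl: "\<phi> \<in> subformulas \<phi>"
  by (cases \<phi>) auto

lemma size_subformulas: "\<psi> \<in> subformulas \<phi> \<Longrightarrow> size \<psi> \<le> size \<phi>"
  by (induction \<phi>) auto

lemma Strat_notin_subformulas: "Strat A t \<phi> \<notin> subformulas \<phi>"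
  using size_subformulas[of "Strat A t \<phi>" \<phi>] by auto

text \<open>Along a branch with the most strategic operators, the subformulas they start and the
  final atom are pairwise distinct and not binary. Depth \<open>2 * N\<close> thus exhausts a size
  bound of \<open>2 * N + 1\<close>.\<close>

lemma sdepth_le: "sdepth \<phi> + 1 \<le> card {\<psi> \<in> subformulas \<phi>. \<not> is_Bin \<psi>}"
proof (induction \<phi>)
  case (Atom p)
  have "{\<psi> \<in> subformulas (Atom p). \<not> is_Bin \<psi>} = {Atom p}" by auto
  then show ?case by simp
next
  case (Bin b \<phi> \<psi>)
  let ?N = "\<lambda>\<phi>. {\<psi> \<in> subformulas \<phi>. \<not> is_Bin \<psi>}"
  have "card (?N \<phi>) \<le> card (?N (Bin b \<phi> \<psi>))" "card (?N \<psi>) \<le> card (?N (Bin b \<phi> \<psi>))"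
    using finite_subformulas[of \<phi>] finite_subformulas[of \<psi>] by (auto intro!: card_mono)
  then show ?case using Bin by (simp only: sdepth.simps)
next
  case (Strat A t \<phi>)
  have "{\<psi> \<in> subformulas (Strat A t \<phi>). \<not> is_Bin \<psi>} = insert (Strat A t \<phi>) {\<psi> \<in> subformulas \<phi>. \<not> is_Bin \<psi>}"
    by auto
  then show ?case using Strat Strat_notin_subformulas[of A t \<phi>] finite_subformulas[of \<phi>] by simp
qed

lemma atl_size_split: "atl_size \<phi> = card {\<psi> \<in> subformulas \<phi>. \<not> is_Bin \<psi>} + atl_size_Bin \<phi>"
proof -
  have "subformulas \<phi> = {\<psi> \<in> subformulas \<phi>. \<not> is_Bin \<psi>} \<union> {\<psi> \<in> subformulas \<phi>. is_Bin \<psi>}" by blast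
  moreover have "{\<psi> \<in> subformulas \<phi>. \<not> is_Bin \<psi>} \<inter> {\<psi> \<in> subformulas \<phi>. is_Bin \<psi>} = {}" by blast
  ultimately show ?thesis
    unfolding atl_size_def atl_size_Bin_def
    using finite_subformulas[of \<phi>] by (metis (no_types, lifting) card_Un_disjoint finite_Un)
qed

definition nest :: "temp_op \<Rightarrow> nat set list \<Rightarrow> nat atl" where
  "nest t As = foldr (\<lambda>A. Strat A t) As (Atom 0)"

lemma nest_simps [simp]: "nest t [] = Atom 0" "nest t (A # As) = Strat A t (nest t As)"
  by (simp_all add: nest_def)

lemma sdepth_nest [simp]: "sdepth (nest t As) = length As"
  by (induction As) auto

lemma nest_ATL: "set As \<subseteq> Pow {..<3} \<Longrightarrow> nest t As \<in> ATL 3 {..<1} {t} Bl"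
  by (induction As) (auto intro: ATL.intros)

lemma atl_size_nest: "atl_size (nest t As) = length As + 1"
proof (induction As)
  case (Cons A As)
  then show ?case
    using Strat_notin_subformulas[of A t "nest t As"] finite_subformulas[of "nest t As"] by (simp add: atl_size_def)
qed (simp add: atl_size_def)

lemma atl_size_Bin_nest: "atl_size_Bin (nest t As) = 0"
proof -
  have "\<not> is_Bin \<psi>" if "\<psi> \<in> subformulas (nest t As)" for \<psi>
    using that by (induction As) auto
  then have "{\<psi> \<in> subformulas (nest t As). is_Bin \<psi>} = {}" by blast
  then show ?thesis unfolding atl_size_Bin_def by (simp only: card.empty)
qed

lemma nest_of_no_Bin:
  assumes "\<phi> \<in> ATL 3 {..<1} {t} Bl" and "atl_size_Bin \<phi> = 0"
  shows "\<exists>As. set As \<subseteq> Pow {..<3} \<and> \<phi> = nest t As"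
proof -
  have "\<forall>\<psi>\<in>subformulas \<phi>. \<not> is_Bin \<psi>"
    using assms(2) finite_subformulas[of \<phi>] unfolding atl_size_Bin_def by (simp add: card_eq_0_iff)
  with assms(1) show ?thesis
  proof (induction rule: ATL.induct)
    case (1 p)
    then show ?case by (intro exI[of _ "[]"]) auto
  next
    case (2 b \<phi> \<psi>)
    then show ?case using subformulas_refl[of "Bin b \<phi> \<psi>"] by blast
  next
    case (3 A t' \<phi>)
    then obtain As where "set As \<subseteq> Pow {..<3}" "\<phi> = nest t As" by auto
    then show ?case using 3 by (intro exI[of _ "A # As"]) auto
  qed
qed

primrec passes :: "(nat \<Rightarrow> nat set \<Rightarrow> bool) \<Rightarrow> nat set list \<Rightarrow> nat \<Rightarrow> bool" where
  "passes U [] q \<longleftrightarrow> q = 0"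
| "passes U (A # As) q \<longleftrightarrow> (\<exists>j\<le>q. passes U As j \<and> (\<forall>m. j < m \<and> m \<le> q \<longrightarrow> U m A))"

lemma val_nest: "val g U (nest t As) q \<longleftrightarrow> passes U (map (dual g) As) q"
  by (induction As arbitrary: q) simp_all

definition majority :: "nat \<Rightarrow> nat set \<Rightarrow> bool" where
  "majority m A \<longleftrightarrow> (\<exists>a\<in>A. \<exists>b\<in>A. a \<noteq> b)"

lemma passes_majority: "passes majority As q \<Longrightarrow> q = 1 \<Longrightarrow> \<exists>A\<in>set As. majority 1 A"
proof (induction As arbitrary: q)
  case (Cons A As)
  then obtain j where j: "j \<le> 1" "passes majority As j" "\<forall>m. j < m \<and> m \<le> 1 \<longrightarrow> majority m A" by auto
  show ?case
  proof (cases "j = 1")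
    case True
    then show ?thesis using Cons.IH[OF j(2)] by auto
  next
    case False
    then show ?thesis using j by auto
  qed
qed simp

lemma majority_passes: "A \<in> set As \<Longrightarrow> majority 1 A \<Longrightarrow> passes majority As 1"
proof (induction As)
  case (Cons B As)
  have 0: "passes majority As 0" by (induction As) auto
  show ?case
  proof (cases "majority 1 B")
    case True
    then show ?thesis using 0 by (auto intro!: exI[of _ 0] simp: le_Suc_eq)
  next
    case False
    then have "passes majority As 1" using Cons by auto
    then show ?thesis by (auto intro!: exI[of _ 1])
  qed
qed simp

text \<open>
  The level of a variable \<open>v\<close> (even states) is passed by agent 0, who stands for making \<open>v\<close> true,
  and by agent 1, who stands for making it false, unless this satisfies the clause \<open>c\<close>. Agent 2
  passes the levels in between. Hence a sequence of coalitions passes the chain of a clause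
  iff the assignment it stands for falsifies the clause.
\<close>

definition clause_level :: "'v list \<Rightarrow> (bool \<times> 'v) list \<Rightarrow> nat \<Rightarrow> nat set \<Rightarrow> bool" where
  "clause_level vs c m A \<longleftrightarrow>
     (if even m then (let v = hd (drop (m div 2 - 1) vs)
        in (0 \<in> A \<and> (True, v) \<notin> set c) \<or> (1 \<in> A \<and> (False, v) \<notin> set c))
      else 2 \<in> A)"

lemma upward_clause_level: "upward (clause_level vs c)"
  by (auto simp: upward_def clause_level_def Let_def)

lemma upward_majority: "upward majority"
  by (auto simp: upward_def majority_def)

lemma clause_level_imp_Nil: "clause_level vs c m A \<Longrightarrow> clause_level vs [] m A"
  by (auto simp: clause_level_def Let_def split: if_splits)

lemma clause_level_Nil_periodic: "m \<ge> 1 \<Longrightarrow> clause_level vs [] (m + 2) = clause_level vs' [] m"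
  by (auto simp: clause_level_def fun_eq_iff)

text \<open>Adjacent levels have different parity: one asks for agent 2, the other for agent 0 or 1,
  so a coalition passing both has two members.\<close>

lemma clause_level_adjacent:
  assumes "clause_level vs [] m A" and "clause_level vs [] (Suc m) A"
  shows "majority 1 A"
proof -
  have "2 \<in> A \<and> (0 \<in> A \<or> 1 \<in> A)"
    using assms by (auto simp: clause_level_def Let_def split: if_splits)
  moreover have "(2::nat) \<noteq> 0" "(2::nat) \<noteq> 1" by auto
  ultimately show ?thesis unfolding majority_def by blast
qed

text \<open>Without two-member coalitions, each coalition descends by at most one level. If there
  are as many levels as coalitions, none may idle, and the \<open>i\<close>-th one has to pass level
  \<open>q - i\<close>.\<close>

lemma passes_exact:
  assumes U: "\<And>m A. U m A \<Longrightarrow> clause_level vs [] m A"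
  shows "\<forall>A\<in>set As. \<not> majority 1 A \<Longrightarrow> passes U As q \<Longrightarrow>
    q \<le> length As \<and> (q = length As \<longrightarrow> (\<forall>i<q. U (q - i) (As ! i)))"
proof (induction As arbitrary: q)
  case (Cons A As)
  then obtain j where j: "j \<le> q" "passes U As j" "\<And>m. j < m \<Longrightarrow> m \<le> q \<Longrightarrow> U m A" by auto
  have IH: "j \<le> length As" "j = length As \<Longrightarrow> (\<forall>i<j. U (j - i) (As ! i))"
    using Cons.IH[OF _ j(2)] Cons.prems(1) by auto
  have "\<not> j + 2 \<le> q"
  proof
    assume "j + 2 \<le> q"
    then have "clause_level vs [] (j + 1) A" "clause_level vs [] (Suc (j + 1)) A"
      using U j(3) by auto
    from clause_level_adjacent[OF this] Cons.prems(1) show False by simp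
  qed
  then have qj: "q = j \<or> q = Suc j" using j(1) by linarith
  then show ?case
  proof
    assume "q = Suc j"
    moreover have "U (Suc j - i) ((A # As) ! i)" if "j = length As" "i < Suc j" for i
    proof (cases i)
      case (Suc i')
      then show ?thesis using IH(2)[OF that(1)] that by auto
    qed (use j(3)[of "Suc j"] \<open>q = Suc j\<close> in simp)
    ultimately show ?thesis using IH(1) by auto
  qed (use IH(1) in auto)
qed simp

lemma passes_step: "(\<And>i. i < length As \<Longrightarrow> U (length As - i) (As ! i)) \<Longrightarrow> passes U As (length As)"
proof (induction As)
  case (Cons A As)
  have "passes U As (length As)"
  proof (rule Cons.IH)
    show "U (length As - i) (As ! i)" if "i < length As" for i using Cons.prems[of "Suc i"] that by simp
  qed
  moreover have "U (length (A # As)) A" using Cons.prems[of 0] by simp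
  ultimately show ?case by (auto intro!: exI[of _ "length As"] simp: le_Suc_eq)
qed simp

subsection \<open>From satisfiability to learning\<close>

definition pos_chain :: "bool \<Rightarrow> 'v list \<Rightarrow> (nat, nat) cgs" where
  "pos_chain g vs = chain g (clause_level vs []) (2 * length vs)"

definition neg_chains :: "bool \<Rightarrow> 'v list \<Rightarrow> (bool \<times> 'v) list list \<Rightarrow> (nat, nat) cgs list" where
  "neg_chains g vs cs = chain g majority 1 # chain g (clause_level vs []) (2 * length vs + 2) #
     map (\<lambda>c. chain g (clause_level vs c) (2 * length vs)) cs"

lemma cgs_sat_chain:
  assumes "upward U" and "\<phi> \<in> ATL 3 {..<1} {op_of g} Bl"
  shows "cgs_sat 3 (chain g U l) \<phi> \<longleftrightarrow> (val g U \<phi> l \<noteq> g)"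
  using sat_chain[OF assms order_refl] by (simp add: cgs_sat_def)

lemma learnable_chains:
  "learnable 3 {op_of g} Bl n {..<1}
     (if g then set (neg_chains g vs cs) else {pos_chain g vs})
     (if g then {pos_chain g vs} else set (neg_chains g vs cs)) B \<longleftrightarrow>
   (\<exists>\<phi>\<in>ATL 3 {..<1} {op_of g} Bl. atl_size \<phi> \<le> B \<and> atl_size_Bin \<phi> \<le> n \<and>
      val g (clause_level vs []) \<phi> (2 * length vs) \<and> \<not> val g majority \<phi> 1 \<and>
      \<not> val g (clause_level vs []) \<phi> (2 * length vs + 2) \<and>
      (\<forall>c\<in>set cs. \<not> val g (clause_level vs c) \<phi> (2 * length vs)))"
  unfolding learnable_def
  by (intro bex_cong refl)
     (auto simp: pos_chain_def neg_chains_def cgs_sat_chain[OF upward_clause_level] cgs_sat_chain[OF upward_majority])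

theorem learnable_iff_satisfiable:
  fixes vs :: "'v list"
  assumes dist: "distinct vs" and vars: "\<And>c b v. c \<in> set cs \<Longrightarrow> (b, v) \<in> set c \<Longrightarrow> v \<in> set vs"
  shows "learnable 3 {op_of g} Bl n {..<1}
     (if g then set (neg_chains g vs cs) else {pos_chain g vs})
     (if g then {pos_chain g vs} else set (neg_chains g vs cs)) (2 * length vs + 1) \<longleftrightarrow>
   (\<exists>\<tau>. \<forall>c\<in>set cs. \<exists>(b, v)\<in>set c. \<tau> v = b)"
  unfolding learnable_chains
proof
  let ?l = "2 * length vs"
  assume "\<exists>\<phi>\<in>ATL 3 {..<1} {op_of g} Bl. atl_size \<phi> \<le> ?l + 1 \<and> atl_size_Bin \<phi> \<le> n \<and>
      val g (clause_level vs []) \<phi> ?l \<and> \<not> val g majority \<phi> 1 \<and>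
      \<not> val g (clause_level vs []) \<phi> (?l + 2) \<and> (\<forall>c\<in>set cs. \<not> val g (clause_level vs c) \<phi> ?l)"
  then obtain \<phi> where \<phi>: "\<phi> \<in> ATL 3 {..<1} {op_of g} Bl" "atl_size \<phi> \<le> ?l + 1"
    "val g (clause_level vs []) \<phi> ?l" "\<not> val g majority \<phi> 1" "\<not> val g (clause_level vs []) \<phi> (?l + 2)"
    "\<And>c. c \<in> set cs \<Longrightarrow> \<not> val g (clause_level vs c) \<phi> ?l" by blast
  have "\<not> sdepth \<phi> < ?l"
    using val_periodic[of "clause_level vs []" \<phi> ?l g] clause_level_Nil_periodic \<phi>(3,5) by blast
  then have "atl_size_Bin \<phi> = 0" using sdepth_le[of \<phi>] atl_size_split[of \<phi>] \<phi>(2) by linarith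
  then obtain Bs where Bs: "set Bs \<subseteq> Pow {..<3}" "\<phi> = nest (op_of g) Bs"
    using nest_of_no_Bin[OF \<phi>(1)] by blast
  define As where "As = map (dual g) Bs"
  have len: "length As = ?l"
    using \<open>\<not> sdepth \<phi> < ?l\<close> \<phi>(2) Bs(2) by (simp add: atl_size_nest As_def)
  have val: "val g U \<phi> q \<longleftrightarrow> passes U As q" for U q by (simp add: Bs(2) val_nest As_def)
  have nomaj: "\<forall>A\<in>set As. \<not> majority 1 A" using \<phi>(4) majority_passes unfolding val by blast
  have lev: "\<forall>i<?l. clause_level vs [] (?l - i) (As ! i)"
    using passes_exact[of "clause_level vs []" vs As ?l] nomaj \<phi>(3) len unfolding val by simp
  \<comment> \<open>Coalitions are listed from the top level down, so this is the one that meets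
    level \<open>2 * (r + 1)\<close>, the level of the variable with index \<open>r\<close>.\<close>
  define A where "A r = As ! (?l - 2 * (r + 1))" for r
  define \<tau> where "\<tau> v = (\<exists>r<length vs. vs ! r = v \<and> 0 \<in> A r)" for v
  have "\<exists>(b, v)\<in>set c. \<tau> v = b" if c: "c \<in> set cs" for c
  proof -
    obtain i where i: "i < ?l" "\<not> clause_level vs c (?l - i) (As ! i)"
      using passes_step[of As "clause_level vs c"] \<phi>(6)[OF c] len unfolding val by auto
    \<comment> \<open>The coalition passes its level without the clause but not with it. Clauses
      affect even levels only, so this is the level of a variable, and the value chosen there
      satisfies the clause.\<close>
    have ev: "even (?l - i)" using i lev by (auto simp: clause_level_def Let_def split: if_splits)
    define r where "r = (?l - i) div 2 - 1"
    obtain h where h: "?l - i = 2 * h" using ev by (elim evenE)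
    then have rh: "r = h - 1" by (simp add: r_def)
    have r1: "?l - i = 2 * (r + 1)" using h i(1) by (cases h) (simp_all add: rh)
    then have r: "?l - i = 2 * (r + 1)" "r < length vs" "i = ?l - 2 * (r + 1)"
      using i(1) by auto
    have v: "hd (drop ((?l - i) div 2 - 1) vs) = vs ! r"
      unfolding r_def[symmetric] by (rule hd_drop_conv_nth[OF r(2)])
    have Ai: "As ! i = A r" using r(3) by (simp add: A_def)
    have ne: "0 \<in> A r \<or> 1 \<in> A r" using lev i(1) ev Ai by (auto simp: clause_level_def Let_def)
    have no: "\<not> (0 \<in> A r \<and> (True, vs ! r) \<notin> set c)" "\<not> (1 \<in> A r \<and> (False, vs ! r) \<notin> set c)"
      using i(2) ev unfolding clause_level_def v Let_def Ai by auto
    have \<tau>r: "\<tau> (vs ! r) \<longleftrightarrow> 0 \<in> A r"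
      using r(2) dist unfolding \<tau>_def by (metis nth_eq_iff_index_eq)
    then have "(\<tau> (vs ! r), vs ! r) \<in> set c" using ne no by (cases "0 \<in> A r") simp_all
    then show ?thesis by blast
  qed
  then show "\<exists>\<tau>. \<forall>c\<in>set cs. \<exists>(b, v)\<in>set c. \<tau> v = b" by blast
next
  let ?l = "2 * length vs"
  assume "\<exists>\<tau>. \<forall>c\<in>set cs. \<exists>(b, v)\<in>set c. \<tau> v = b"
  then obtain \<tau> where \<tau>: "\<And>c. c \<in> set cs \<Longrightarrow> \<exists>(b, v)\<in>set c. \<tau> v = b" by blast
  define co where "co m = (if even m then (if \<tau> (vs ! (m div 2 - 1)) then {0} else {1}) else {2 :: nat})" for m :: nat
  define As where "As = map (\<lambda>i. co (?l - i)) [0..<?l]"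
  \<comment> \<open>\<open>dual\<close> is an involution on sets of the three agents, so dualizing
    here makes \<open>As\<close> the sequence that is evaluated.\<close>
  define Bs where "Bs = map (dual g) As"
  have co: "co m \<subseteq> {..<3}" "\<not> majority 1 (co m)" for m by (auto simp: co_def majority_def)
  have As: "map (dual g) Bs = As" using co(1) by (auto simp: Bs_def As_def double_diff)
  have Bs: "set Bs \<subseteq> Pow {..<3}" using co(1) by (auto simp: Bs_def As_def)
  have val: "val g U (nest (op_of g) Bs) q \<longleftrightarrow> passes U As q" for U q by (simp only: val_nest As)
  have len: "length As = ?l" "length Bs = ?l" by (auto simp: As_def Bs_def)
  have nth: "As ! i = co (?l - i)" if "i < ?l" for i using that by (simp add: As_def)
  have nomaj: "\<forall>A\<in>set As. \<not> majority 1 A" using co(2) by (auto simp: As_def)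
  have "passes (clause_level vs []) As ?l"
    using passes_step[of As "clause_level vs []"] len nth by (auto simp: clause_level_def co_def Let_def)
  moreover have "\<not> passes majority As 1" using passes_majority[of As 1] nomaj by blast
  \<comment> \<open>One-member coalitions pass at most as many levels as there are coalitions, two
    fewer than this chain has.\<close>
  moreover have "\<not> passes (clause_level vs []) As (?l + 2)"
    using passes_exact[of "clause_level vs []" vs As "?l + 2"] nomaj len by auto
  moreover have "\<not> passes (clause_level vs c) As ?l" if c: "c \<in> set cs" for c
  proof
    assume "passes (clause_level vs c) As ?l"
    with passes_exact[of "clause_level vs c" vs As ?l] clause_level_imp_Nil[of vs c] nomaj len
    have "\<forall>i<?l. clause_level vs c (?l - i) (As ! i)" by simp
    then have lev: "\<And>i. i < ?l \<Longrightarrow> clause_level vs c (?l - i) (co (?l - i))" using nth by simp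
    obtain b v where bv: "(b, v) \<in> set c" "\<tau> v = b" using \<tau>[OF c] by blast
    then obtain r where r: "r < length vs" "v = vs ! r" using vars[OF c] by (metis in_set_conv_nth)
    have "?l - (?l - 2 * (r + 1)) = 2 * (r + 1)" "?l - 2 * (r + 1) < ?l" using r(1) by auto
    then have "clause_level vs c (2 * (r + 1)) (co (2 * (r + 1)))" using lev[of "?l - 2 * (r + 1)"] by simp
    then show False
      using bv r by (auto simp: clause_level_def co_def Let_def hd_drop_conv_nth split: if_splits)
  qed
  ultimately show "\<exists>\<phi>\<in>ATL 3 {..<1} {op_of g} Bl. atl_size \<phi> \<le> ?l + 1 \<and> atl_size_Bin \<phi> \<le> n \<and>
      val g (clause_level vs []) \<phi> ?l \<and> \<not> val g majority \<phi> 1 \<and>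
      \<not> val g (clause_level vs []) \<phi> (?l + 2) \<and> (\<forall>c\<in>set cs. \<not> val g (clause_level vs c) \<phi> ?l)"
    using Bs len by (intro bexI[of _ "nest (op_of g) Bs"] nest_ATL) (simp_all add: val atl_size_nest atl_size_Bin_nest)
qed

section \<open>A polynomial-time verifier for learning instances\<close>

section \<open>Membership in NP\<close>

subsection \<open>Instances as data\<close>

text \<open>Certificates may be taken from any coded type: the verifier decodes the given word
  first. Words that are not codes do no harm because soundness is assumed for every value
  \<open>y\<close>.\<close>

lemma NP_classI:
  fixes R :: "bool list \<Rightarrow> 'c::bitcoded \<Rightarrow> bool"
  assumes R: "ptime (\<lambda>p. R (fst p) (snd p))" and u: "ptime (unbits :: bool list \<Rightarrow> 'c)"
    and S: "polyb length S" and complete: "\<And>x. x \<in> L \<Longrightarrow> \<exists>y. R x y \<and> bsize y \<le> S x"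
    and sound: "\<And>x y. R x y \<Longrightarrow> x \<in> L"
  shows "L \<in> NP_class"
proof -
  define V where "V = {w. R (fst (unw w)) (unbits (snd (unw w)))}"
  have "V \<in> P_class"
    unfolding V_def by (intro P_classI ptime_comp2[OF R] ptime_comp[OF u] ptime_intro)
  moreover obtain p where p: "\<And>x. S x \<le> poly p (length x)" using S unfolding polyb_def by blast
  have "x \<in> L \<longleftrightarrow> (\<exists>u. length u \<le> poly p (length x) \<and> word_pair x u \<in> V)" for x
  proof
    assume "x \<in> L"
    then obtain y where "R x y" "bsize y \<le> S x" using complete by blast
    then show "\<exists>u. length u \<le> poly p (length x) \<and> word_pair x u \<in> V"
      using p[of x] by (intro exI[of _ "bits y"]) (auto simp: V_def)
  qed (auto simp: V_def intro: sound)
  ultimately show ?thesis unfolding NP_class_def by blast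
qed

type_synonym srep = "bool \<times> bool list \<times> (nat \<times> nat \<times> nat) \<times> nat list"
type_synonym irep = "nat \<times> srep list list \<times> srep list list \<times> nat"

abbreviation s_init :: "srep \<Rightarrow> bool" where "s_init s \<equiv> fst s"
abbreviation s_label :: "srep \<Rightarrow> bool list" where "s_label s \<equiv> fst (snd s)"
abbreviation s_acts :: "srep \<Rightarrow> nat \<times> nat \<times> nat" where "s_acts s \<equiv> fst (snd (snd s))"
abbreviation s_trans :: "srep \<Rightarrow> nat list" where "s_trans s \<equiv> snd (snd (snd s))"

definition tuples3 :: "nat \<times> nat \<times> nat \<Rightarrow> nat list list" where
  "tuples3 d = product_lists [[0..<fst d], [0..<fst (snd d)], [0..<snd (snd d)]]"

definition rep_state :: "nat \<Rightarrow> (nat, nat) cgs \<Rightarrow> nat \<Rightarrow> srep" where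
  "rep_state m C q = (let d = (num_act C q 0, num_act C q 1, num_act C q 2) in
     (q \<in> init C, map (\<lambda>p. p \<in> label C q) [0..<m], d, map (trans C q) (tuples3 d)))"

definition rep_of :: "nat \<Rightarrow> (nat, nat) cgs \<Rightarrow> srep list" where
  "rep_of m C = map (rep_state m C) [0..<card (states C)]"

definition valid_rep :: "nat \<Rightarrow> srep list \<Rightarrow> bool" where
  "valid_rep m ss \<longleftrightarrow> (\<forall>s\<in>set ss. length (s_label s) = m \<and>
     1 \<le> fst (s_acts s) \<and> 1 \<le> fst (snd (s_acts s)) \<and> 1 \<le> snd (snd (s_acts s)) \<and>
     length (s_trans s) = length (tuples3 (s_acts s)) \<and> (\<forall>q\<in>set (s_trans s). q < length ss))"

definition cgs_of :: "srep list \<Rightarrow> (nat, nat) cgs" where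
  "cgs_of ss = \<lparr>states = {..<length ss}, init = {q. q < length ss \<and> s_init (ss ! q)},
     label = (\<lambda>q. {p. p < length (s_label (ss ! q)) \<and> s_label (ss ! q) ! p}),
     num_act = (\<lambda>q a. if a = 0 then fst (s_acts (ss ! q)) else if a = 1 then fst (snd (s_acts (ss ! q)))
       else snd (snd (s_acts (ss ! q)))),
     trans = (\<lambda>q \<alpha>. the (map_of (zip (tuples3 (s_acts (ss ! q))) (s_trans (ss ! q))) \<alpha>))\<rparr>"

definition enc_srep :: "srep \<Rightarrow> bool list" where
  "enc_srep s = [s_init s] @ s_label s @ enc_nat (fst (s_acts s)) @ enc_nat (fst (snd (s_acts s))) @
     enc_nat (snd (snd (s_acts s))) @ concat (map enc_nat (s_trans s))"

definition enc_rep :: "srep list \<Rightarrow> bool list" where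
  "enc_rep ss = enc_nat (length ss) @ concat (map enc_srep ss)"

definition enc_irep :: "irep \<Rightarrow> bool list" where
  "enc_irep z = enc_nat (fst z) @
     enc_nat (length (fst (snd z))) @ concat (map enc_rep (fst (snd z))) @
     enc_nat (length (fst (snd (snd z)))) @ concat (map enc_rep (fst (snd (snd z)))) @
     enc_nat (snd (snd (snd z)))"

lemma upt3: "[0..<3] = [0, 1, 2 :: nat]"
  by (simp add: upt_rec)

lemma tuples3_product_lists:
  "tuples3 (num_act C q 0, num_act C q 1, num_act C q 2) = product_lists (map (\<lambda>a. [0..<num_act C q a]) [0..<3])"
  by (simp only: tuples3_def upt3 list.map fst_conv snd_conv)

lemma set_tuples3: "set (tuples3 (num_act C q 0, num_act C q 1, num_act C q 2)) = act_tuples 3 C q"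
  by (simp only: tuples3_product_lists set_product_lists_act_tuples)

lemma distinct_tuples3: "distinct (tuples3 d)"
  unfolding tuples3_def by (rule distinct_product_lists) auto

lemma enc_state_rep: "enc_state 3 m C = (\<lambda>q. enc_srep (rep_state m C q))"
  unfolding enc_state_def enc_srep_def rep_state_def Let_def fst_conv snd_conv tuples3_product_lists
  by (simp add: fun_eq_iff upt3 comp_def del: product_lists.simps)

lemma enc_cgs_rep: "enc_cgs 3 m = (\<lambda>C. enc_rep (rep_of m C))"
  by (simp add: fun_eq_iff enc_cgs_def enc_rep_def rep_of_def enc_state_rep comp_def)

lemma enc_instance_rep:
  "enc_instance 3 m Ps Ns B = enc_irep (m, map (rep_of m) Ps, map (rep_of m) Ns, B)"
  by (simp add: enc_instance_def enc_irep_def enc_cgs_rep comp_def)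

lemma valid_rep_of:
  assumes "std_cgs 3 m C"
  shows "valid_rep m (rep_of m C)"
proof -
  have st: "states C = {..<card (states C)}" and cgs: "is_cgs 3 {..<m} C"
    using assms by (auto simp: std_cgs_def)
  have *: "length (s_label s) = m \<and>
     1 \<le> fst (s_acts s) \<and> 1 \<le> fst (snd (s_acts s)) \<and> 1 \<le> snd (snd (s_acts s)) \<and>
     length (s_trans s) = length (tuples3 (s_acts s)) \<and> (\<forall>r\<in>set (s_trans s). r < card (states C))"
    if q: "q \<in> states C" and s: "s = rep_state m C q" for s q
  proof -
    have "\<And>a. a < 3 \<Longrightarrow> num_act C q a \<ge> 1" "\<And>\<alpha>. \<alpha> \<in> act_tuples 3 C q \<Longrightarrow> trans C q \<alpha> \<in> states C"
      using cgs q by (auto simp: is_cgs_def)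
    moreover have "r \<in> states C \<Longrightarrow> r < card (states C)" for r using st by blast
    ultimately show ?thesis
      using s by (auto simp: rep_state_def Let_def set_tuples3[simplified])
  qed
  show ?thesis
    unfolding valid_rep_def
  proof
    fix s assume "s \<in> set (rep_of m C)"
    then obtain q where q: "q < card (states C)" "s = rep_state m C q" by (auto simp: rep_of_def)
    then have "q \<in> states C" using st by blast
    moreover have "length (rep_of m C) = card (states C)" by (simp add: rep_of_def)
    ultimately show "length (s_label s) = m \<and>
     1 \<le> fst (s_acts s) \<and> 1 \<le> fst (snd (s_acts s)) \<and> 1 \<le> snd (snd (s_acts s)) \<and>
     length (s_trans s) = length (tuples3 (s_acts s)) \<and> (\<forall>r\<in>set (s_trans s). r < length (rep_of m C))"
      using * q(2) by simp
  qed
qed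

lemma act_tuples_cgs_of: "act_tuples 3 (cgs_of ss) q = set (tuples3 (s_acts (ss ! q)))"
proof -
  have "(num_act (cgs_of ss) q 0, num_act (cgs_of ss) q 1, num_act (cgs_of ss) q 2) = s_acts (ss ! q)"
    by (simp add: cgs_of_def)
  then show ?thesis by (metis set_tuples3)
qed

lemma trans_cgs_of:
  assumes "length (s_trans (ss ! q)) = length (tuples3 (s_acts (ss ! q)))"
  shows "map (trans (cgs_of ss) q) (tuples3 (s_acts (ss ! q))) = s_trans (ss ! q)"
proof (rule nth_equalityI)
  fix i assume "i < length (map (trans (cgs_of ss) q) (tuples3 (s_acts (ss ! q))))"
  then show "map (trans (cgs_of ss) q) (tuples3 (s_acts (ss ! q))) ! i = s_trans (ss ! q) ! i"
    using assms distinct_tuples3[of "s_acts (ss ! q)"] by (simp add: cgs_of_def map_of_zip_nth)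
qed (use assms in simp)

text \<open>The two maps are inverse in this order only. \<open>rep_of\<close> forgets what a
  structure does outside its states and legal action tuples, so the converse composition need not
  return the same structure.\<close>

lemma cgs_of_valid:
  assumes v: "valid_rep m ss"
  shows "std_cgs 3 m (cgs_of ss)" and "rep_of m (cgs_of ss) = ss"
proof -
  have s: "length (s_label (ss ! q)) = m" "1 \<le> fst (s_acts (ss ! q))" "1 \<le> fst (snd (s_acts (ss ! q)))"
     "1 \<le> snd (snd (s_acts (ss ! q)))" "length (s_trans (ss ! q)) = length (tuples3 (s_acts (ss ! q)))"
     "\<forall>r\<in>set (s_trans (ss ! q)). r < length ss" if "q < length ss" for q
    using bspec[OF v[unfolded valid_rep_def] nth_mem[OF that]] by simp_all
  have tr: "trans (cgs_of ss) q \<alpha> < length ss" if "q < length ss" "\<alpha> \<in> set (tuples3 (s_acts (ss ! q)))" for q \<alpha>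
  proof -
    have "trans (cgs_of ss) q \<alpha> \<in> set (map (trans (cgs_of ss) q) (tuples3 (s_acts (ss ! q))))"
      using that(2) by simp
    then show ?thesis unfolding trans_cgs_of[OF s(5)[OF that(1)]] using s(6)[OF that(1)] by blast
  qed
  show "std_cgs 3 m (cgs_of ss)"
    unfolding std_cgs_def is_cgs_def
  proof (intro conjI ballI allI impI)
    fix q \<alpha> assume "q \<in> states (cgs_of ss)" "\<alpha> \<in> act_tuples 3 (cgs_of ss) q"
    then show "trans (cgs_of ss) q \<alpha> \<in> states (cgs_of ss)"
      using tr unfolding act_tuples_cgs_of by (simp add: cgs_of_def)
  qed (use s in \<open>auto simp: cgs_of_def\<close>)
  have st: "rep_state m (cgs_of ss) q = ss ! q" if "q < length ss" for q
  proof -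
    have d: "(num_act (cgs_of ss) q 0, num_act (cgs_of ss) q 1, num_act (cgs_of ss) q 2) = s_acts (ss ! q)"
      by (simp add: cgs_of_def)
    have "map (\<lambda>p. p \<in> label (cgs_of ss) q) [0..<m] = s_label (ss ! q)"
      using s(1)[OF that] by (auto simp: cgs_of_def intro!: nth_equalityI)
    moreover have "(q \<in> init (cgs_of ss)) = s_init (ss ! q)" using that by (simp add: cgs_of_def)
    ultimately show ?thesis
      unfolding rep_state_def Let_def d trans_cgs_of[OF s(5)[OF that]] by simp
  qed
  have "card (states (cgs_of ss)) = length ss" by (simp add: cgs_of_def)
  then show "rep_of m (cgs_of ss) = ss"
    unfolding rep_of_def using st by (auto intro!: nth_equalityI)
qed

subsection \<open>Formulas as directed acyclic graphs\<close>

text \<open>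
  A node consists of a kind (0 for atoms, 1 to 10 for the binary operators, larger for the strategic
  operator), a coalition, and two numbers: the proposition or the positions of the immediate
  subformulas. Repeated subformulas are shared, so the number of nodes is the size of the formula.
\<close>

type_synonym node = "nat \<times> bool list \<times> nat \<times> nat"

definition bin_ops :: "bin_lg list" where
  "bin_ops = [Or, And, Imp, RevImp, Iff, NotOr, NotAnd, NotImp, NotRevImp, NotIff]"

lemma set_bin_ops: "b \<in> set bin_ops"
  by (cases b) (auto simp: bin_ops_def)

definition coalition :: "bool list \<Rightarrow> nat set" where
  "coalition L = {a. a < 3 \<and> nthd False L a}"

definition form_node :: "temp_op \<Rightarrow> nat atl list \<Rightarrow> node \<Rightarrow> nat atl" where
  "form_node t fs z = (let k = fst z; i = fst (snd (snd z)); j = snd (snd (snd z)) in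
     if k = 0 then Atom i
     else if k \<le> 10 then Bin (bin_ops ! (k - 1)) (fs ! i) (fs ! j)
     else Strat (coalition (fst (snd z))) t (fs ! i))"

definition forms :: "temp_op \<Rightarrow> node list \<Rightarrow> nat atl list" where
  "forms t ns = fold (\<lambda>z fs. fs @ [form_node t fs z]) ns []"

text \<open>The set \<open>Bl\<close> belongs to the problem and not to its input, so this list is a
  constant for the verifier, and operators can be handled as numbers.\<close>

definition ok_kinds :: "bin_lg set \<Rightarrow> nat list" where
  "ok_kinds Bl = filter (\<lambda>k. bin_ops ! (k - 1) \<in> Bl) [1..<11]"

definition ok_node :: "bin_lg set \<Rightarrow> nat \<Rightarrow> nat \<Rightarrow> node \<Rightarrow> bool" where
  "ok_node Bl m pos z \<longleftrightarrow> (let k = fst z; i = fst (snd (snd z)); j = snd (snd (snd z)) in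
     if k = 0 then i < m
     else if k \<le> 10 then k \<in> set (ok_kinds Bl) \<and> i < pos \<and> j < pos
     else i < pos)"

definition ok_dag :: "bin_lg set \<Rightarrow> nat \<Rightarrow> node list \<Rightarrow> bool" where
  "ok_dag Bl m ns \<longleftrightarrow> (\<forall>z\<in>set (zip [0..<length ns] ns). ok_node Bl m (fst z) (snd z))"

abbreviation bin_node :: "node \<Rightarrow> bool" where
  "bin_node z \<equiv> fst z \<noteq> 0 \<and> fst z \<le> 10"

lemma forms_snoc: "forms t (ns @ [z]) = forms t ns @ [form_node t (forms t ns) z]"
  by (simp add: forms_def)

lemma forms_Nil [simp]: "forms t [] = []"
  by (simp add: forms_def)

lemma length_forms [simp]: "length (forms t ns) = length ns"
  by (induction ns rule: rev_induct) (auto simp: forms_snoc)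

lemma ok_dag_snoc: "ok_dag Bl m (ns @ [z]) \<longleftrightarrow> ok_dag Bl m ns \<and> ok_node Bl m (length ns) z"
  by (auto simp: ok_dag_def)

lemma ok_dag_sound:
  assumes "ok_dag Bl m ns"
  shows "\<forall>f\<in>set (forms t ns). f \<in> ATL 3 {..<m} {t} Bl \<and> subformulas f \<subseteq> set (forms t ns)" (is ?A)
    and "card {f \<in> set (forms t ns). is_Bin f} \<le> length (filter bin_node ns)" (is ?B)
proof -
  have "?A \<and> ?B"
    using assms
  proof (induction ns rule: rev_induct)
    case (snoc z ns)
    let ?fs = "forms t ns" and ?f = "form_node t (forms t ns) z"
    have ok: "ok_node Bl m (length ns) z" and IH: "\<forall>f\<in>set ?fs. f \<in> ATL 3 {..<m} {t} Bl \<and> subformulas f \<subseteq> set ?fs"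
      "card {f \<in> set ?fs. is_Bin f} \<le> length (filter bin_node ns)"
      using snoc by (auto simp: ok_dag_snoc)
    have child: "?fs ! i \<in> ATL 3 {..<m} {t} Bl" "subformulas (?fs ! i) \<subseteq> set ?fs" if "i < length ns" for i
      using IH(1) that by (metis length_forms nth_mem)+
    have A: "?f \<in> ATL 3 {..<m} {t} Bl \<and> subformulas ?f \<subseteq> insert ?f (set ?fs) \<and> (is_Bin ?f \<longrightarrow> bin_node z)"
      using ok child by (auto simp: form_node_def ok_node_def ok_kinds_def Let_def coalition_def split: if_splits
          intro!: ATL.intros dest: subsetD)
    have "{f \<in> set (forms t (ns @ [z])). is_Bin f} \<subseteq>
        (if is_Bin ?f then insert ?f {f \<in> set ?fs. is_Bin f} else {f \<in> set ?fs. is_Bin f})"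
      by (auto simp: forms_snoc) metis
    then have "card {f \<in> set (forms t (ns @ [z])). is_Bin f} \<le>
        card (if is_Bin ?f then insert ?f {f \<in> set ?fs. is_Bin f} else {f \<in> set ?fs. is_Bin f})"
      by (intro card_mono) auto
    then have "card {f \<in> set (forms t (ns @ [z])). is_Bin f} \<le>
        card {f \<in> set ?fs. is_Bin f} + (if is_Bin ?f then 1 else 0)"
      by (rule order_trans) (auto simp: card_insert_if)
    then have "card {f \<in> set (forms t (ns @ [z])). is_Bin f} \<le> length (filter bin_node (ns @ [z]))"
      using A IH(2) by (cases "is_Bin ?f") simp_all
    moreover have "\<forall>f\<in>set (forms t (ns @ [z])). f \<in> ATL 3 {..<m} {t} Bl \<and> subformulas f \<subseteq> set (forms t (ns @ [z]))"
      using A IH(1) by (auto simp: forms_snoc)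
    ultimately show ?case by blast
  qed simp
  then show ?A ?B by blast+
qed

text \<open>Only inequalities hold: a certificate may list a formula several times, or nodes that
  the last one never uses. This suffices because the checks are upper bounds.\<close>

lemma dag_formula:
  assumes "ok_dag Bl m ns" and "ns \<noteq> []" and "\<phi> = last (forms t ns)"
  shows "\<phi> \<in> ATL 3 {..<m} {t} Bl" and "atl_size \<phi> \<le> length ns" and "atl_size_Bin \<phi> \<le> length (filter bin_node ns)"
proof -
  have "forms t ns \<noteq> []" using assms(2) length_forms by (metis length_0_conv)
  then have "\<phi> \<in> set (forms t ns)" using assms(3) by simp
  then have \<phi>: "\<phi> \<in> ATL 3 {..<m} {t} Bl" "subformulas \<phi> \<subseteq> set (forms t ns)"
    using ok_dag_sound(1)[OF assms(1)] by auto
  show "\<phi> \<in> ATL 3 {..<m} {t} Bl" by (rule \<phi>)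
  have "atl_size \<phi> \<le> card (set (forms t ns))" unfolding atl_size_def by (intro card_mono \<phi>) simp
  also have "\<dots> \<le> length ns" using card_length[of "forms t ns"] by simp
  finally show "atl_size \<phi> \<le> length ns" .
  have "atl_size_Bin \<phi> \<le> card {f \<in> set (forms t ns). is_Bin f}"
    unfolding atl_size_Bin_def using \<phi>(2) by (intro card_mono) auto
  also note ok_dag_sound(2)[OF assms(1)]
  finally show "atl_size_Bin \<phi> \<le> length (filter bin_node ns)" .
qed

definition index_of :: "'b list \<Rightarrow> 'b \<Rightarrow> nat" where
  "index_of xs x = (SOME i. i < length xs \<and> xs ! i = x)"

lemma index_of: "x \<in> set xs \<Longrightarrow> index_of xs x < length xs \<and> xs ! index_of xs x = x"
  unfolding index_of_def in_set_conv_nth by (rule someI_ex)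

fun node_of :: "nat atl list \<Rightarrow> nat atl \<Rightarrow> node" where
  "node_of fs (Atom p) = (0, [], p, 0)"
| "node_of fs (Bin b \<phi> \<psi>) = (Suc (index_of bin_ops b), [], index_of fs \<phi>, index_of fs \<psi>)"
| "node_of fs (Strat A t \<phi>) = (11, map (\<lambda>a. a \<in> A) [0..<3], index_of fs \<phi>, 0)"

lemma subformulas_trans: "\<chi> \<in> subformulas \<psi> \<Longrightarrow> \<psi> \<in> subformulas \<phi> \<Longrightarrow> \<chi> \<in> subformulas \<phi>"
  by (induction \<phi>) auto

lemma subformulas_ATL: "\<phi> \<in> ATL k P T Bl \<Longrightarrow> \<psi> \<in> subformulas \<phi> \<Longrightarrow> \<psi> \<in> ATL k P T Bl"
  by (induction rule: ATL.induct) (auto intro: ATL.intros)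

lemma size_proper_subformula: "\<psi> \<in> subformulas \<phi> \<Longrightarrow> \<psi> \<noteq> \<phi> \<Longrightarrow> size \<psi> < size \<phi>"
  by (cases \<phi>) (auto dest!: size_subformulas)

text \<open>Listing the subformulas by increasing size puts proper subformulas before the formulas
  that contain them. Each occurs once, so the counts are exact. The bound on the nodes keeps the
  certificate polynomial.\<close>

lemma dag_complete:
  assumes \<phi>: "\<phi> \<in> ATL 3 {..<m} {t} Bl"
  obtains ns where "ok_dag Bl m ns" "ns \<noteq> []" "last (forms t ns) = \<phi>" "length ns = atl_size \<phi>"
    "length (filter bin_node ns) = atl_size_Bin \<phi>"
    "\<And>z. z \<in> set ns \<Longrightarrow> bsize z \<le> 100 + 3 * (m + atl_size \<phi>)"
proof -
  obtain gs where gs: "set gs = subformulas \<phi>" "distinct gs"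
    using finite_distinct_list[OF finite_subformulas] by blast
  define fs where "fs = sort_key size gs"
  have fs: "set fs = subformulas \<phi>" "distinct fs" "sorted (map size fs)"
    using gs by (auto simp: fs_def)
  have len: "length fs = atl_size \<phi>"
    using distinct_card[OF fs(2)] fs(1) by (simp add: atl_size_def)
  have before: "index_of fs \<psi> < i" if "i < length fs" "\<psi> \<in> set fs" "size \<psi> < size (fs ! i)" for i \<psi>
  proof (rule ccontr)
    assume "\<not> index_of fs \<psi> < i"
    then have "size (fs ! i) \<le> size (fs ! index_of fs \<psi>)"
      using index_of[OF that(2)] sorted_nth_mono[OF fs(3), of i "index_of fs \<psi>"] by simp
    then show False using index_of[OF that(2)] that(3) by simp
  qed
  define ns where "ns = map (node_of fs) fs"
  have idx: "index_of bin_ops b < 10" "bin_ops ! index_of bin_ops b = b" for b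
    using index_of[OF set_bin_ops[of b]] by (simp_all add: bin_ops_def)
  have pre: "ok_dag Bl m (take i ns) \<and> forms t (take i ns) = take i fs" if "i \<le> length fs" for i
    using that
  proof (induction i)
    case (Suc i)
    then have i: "i < length fs" and IH: "ok_dag Bl m (take i ns)" "forms t (take i ns) = take i fs" by auto
    have take: "take (Suc i) ns = take i ns @ [node_of fs (fs ! i)]"
      using i by (simp add: ns_def take_Suc_conv_app_nth)
    have mem: "fs ! i \<in> subformulas \<phi>" using fs(1) i nth_mem by blast
    then have atl: "fs ! i \<in> ATL 3 {..<m} {t} Bl" using subformulas_ATL[OF \<phi>] by blast
    have ch: "index_of fs \<psi> < i \<and> take i fs ! index_of fs \<psi> = \<psi>"
      if "\<psi> \<in> subformulas (fs ! i)" "\<psi> \<noteq> fs ! i" for \<psi>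
    proof -
      have "\<psi> \<in> set fs" using subformulas_trans[OF that(1) mem] fs(1) by simp
      then show ?thesis using before[OF i] size_proper_subformula[OF that] index_of by fastforce
    qed
    have "ok_node Bl m i (node_of fs (fs ! i)) \<and> form_node t (take i fs) (node_of fs (fs ! i)) = fs ! i"
      using atl
    proof (cases rule: ATL.cases)
      case (1 p)
      then show ?thesis by (simp add: ok_node_def form_node_def)
    next
      case (2 b \<psi> \<chi>)
      have "\<psi> \<noteq> fs ! i" "\<chi> \<noteq> fs ! i" unfolding 2(1) by simp_all
      then have "index_of fs \<psi> < i \<and> take i fs ! index_of fs \<psi> = \<psi>" "index_of fs \<chi> < i \<and> take i fs ! index_of fs \<chi> = \<chi>"
        using ch[of \<psi>] ch[of \<chi>] subformulas_refl[of \<psi>] subformulas_refl[of \<chi>] unfolding 2(1) by auto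
      then show ?thesis unfolding 2(1) using 2(2) idx[of b] by (simp add: ok_node_def ok_kinds_def form_node_def)
    next
      case (3 A t' \<psi>)
      have "\<psi> \<noteq> fs ! i" unfolding 3(1) by simp
      then have c: "index_of fs \<psi> < i \<and> take i fs ! index_of fs \<psi> = \<psi>"
        using ch[of \<psi>] subformulas_refl[of \<psi>] unfolding 3(1) by auto
      have "coalition (map (\<lambda>a. a \<in> A) [0..<3]) = A" using 3(2) by (auto simp: coalition_def)
      then show ?thesis unfolding 3(1) using 3(3) c by (simp add: ok_node_def form_node_def)
    qed
    then show ?case
      unfolding take ok_dag_snoc forms_snoc IH(2) using IH(1) i by (simp add: ns_def take_Suc_conv_app_nth)
  qed (simp add: ok_dag_def)
  have dag: "ok_dag Bl m ns" "forms t ns = fs" using pre[of "length fs"] by (simp_all add: ns_def)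
  have fne: "fs \<noteq> []" using fs(1) subformulas_refl[of \<phi>] by auto
  \<comment> \<open>All other subformulas are strictly smaller, so the formula itself is last in the
    order by size.\<close>
  have last: "last fs = \<phi>"
  proof (rule ccontr)
    assume "last fs \<noteq> \<phi>"
    then have "size (last fs) < size \<phi>" using size_proper_subformula[of "last fs" \<phi>] fs(1) last_in_set[OF fne] by simp
    moreover have i: "index_of fs \<phi> < length fs" "fs ! index_of fs \<phi> = \<phi>"
      using index_of[of \<phi> fs] fs(1) subformulas_refl by auto
    then have "size \<phi> \<le> size (last fs)"
      using sorted_nth_mono[OF fs(3), of "index_of fs \<phi>" "length fs - 1"] fne by (simp add: last_conv_nth)
    ultimately show False by simp
  qed
  have bn: "bin_node (node_of fs \<psi>) = is_Bin \<psi>" for \<psi>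
  proof (cases \<psi>)
    case (Bin b \<chi>\<^sub>1 \<chi>\<^sub>2)
    then show ?thesis using idx(1)[of b] by simp
  qed simp_all
  have "length (filter bin_node ns) = length (filter (\<lambda>\<psi>. bin_node (node_of fs \<psi>)) fs)"
    by (simp add: ns_def filter_map comp_def)
  then have "length (filter bin_node ns) = length (filter is_Bin fs)" unfolding bn .
  also have "\<dots> = card (set (filter is_Bin fs))" by (rule distinct_card[OF distinct_filter[OF fs(2)], symmetric])
  also have "set (filter is_Bin fs) = {\<psi> \<in> subformulas \<phi>. is_Bin \<psi>}" unfolding set_filter fs(1) ..
  finally have bins: "length (filter bin_node ns) = atl_size_Bin \<phi>" unfolding atl_size_Bin_def .
  have "bsize z \<le> 100 + 3 * (m + atl_size \<phi>)" if z: "z \<in> set ns" for z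
  proof -
    obtain \<psi> where \<psi>: "\<psi> \<in> set fs" "z = node_of fs \<psi>" using z by (auto simp: ns_def)
    have mem: "\<psi> \<in> subformulas \<phi>" using \<psi> fs(1) by simp
    have ch: "index_of fs \<chi> < atl_size \<phi>" if "\<chi> \<in> subformulas \<psi>" for \<chi>
      using index_of[of \<chi> fs] subformulas_trans[OF that mem] fs(1) len by auto
    show ?thesis
    proof (cases \<psi>)
      case (Atom p)
      then have "p < m" using subformulas_ATL[OF \<phi> mem] by (auto elim: ATL.cases)
      then show ?thesis using Atom \<psi>(2) by simp
    next
      case (Bin b \<chi>\<^sub>1 \<chi>\<^sub>2)
      then have "index_of fs \<chi>\<^sub>1 < atl_size \<phi>" "index_of fs \<chi>\<^sub>2 < atl_size \<phi>"
        by (auto intro!: ch subformulas_refl)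
      then show ?thesis using Bin \<psi>(2) idx(1)[of b] by simp
    next
      case (Strat A t' \<chi>)
      then have "index_of fs \<chi> < atl_size \<phi>" by (auto intro!: ch subformulas_refl)
      then show ?thesis using Strat \<psi>(2) by (simp add: bsize_bools)
    qed
  qed
  with that[of ns] dag last bins len fne show ?thesis by (simp add: ns_def)
qed

subsection \<open>Model checking\<close>

definition agree :: "bool list \<Rightarrow> nat list \<Rightarrow> nat list \<Rightarrow> bool" where
  "agree L \<alpha> \<beta> \<longleftrightarrow> (\<forall>z\<in>set (zip L (zip \<alpha> \<beta>)). fst z \<longrightarrow> fst (snd z) = snd (snd z))"

definition mc_cpre :: "bool list \<Rightarrow> bool list \<Rightarrow> srep \<Rightarrow> bool" where
  "mc_cpre L Z s \<longleftrightarrow> (\<exists>x\<in>set (zip (tuples3 (s_acts s)) (s_trans s)).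
     \<forall>y\<in>set (zip (tuples3 (s_acts s)) (s_trans s)). agree L (fst x) (fst y) \<longrightarrow> nthd False Z (snd y))"

definition mc_step :: "bool \<Rightarrow> srep list \<Rightarrow> bool list \<Rightarrow> bool list \<Rightarrow> bool list \<Rightarrow> bool list" where
  "mc_step g ss L X Z = map (\<lambda>y. if g then snd y \<and> mc_cpre L Z (fst y) else snd y \<or> mc_cpre L Z (fst y)) (zip ss X)"

text \<open>All truth tables as one constant list; a binary node is then evaluated by a membership
  test.\<close>

definition mc_bin :: "(nat \<times> bool \<times> bool) list" where
  "mc_bin = filter (\<lambda>z. bin_sem (bin_ops ! (fst z - 1)) (fst (snd z)) (snd (snd z)))
     (List.product [1..<11] (List.product [True, False] [True, False]))"

text \<open>A strategic node runs one round per state, which reaches the fixed point by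
  \<open>sat_Strat\<close>. The default \<open>[]\<close> keeps the function total on nodes that
  point nowhere.\<close>

definition mc_node :: "bool \<Rightarrow> srep list \<Rightarrow> bool list list \<Rightarrow> node \<Rightarrow> bool list" where
  "mc_node g ss vs z = (let k = fst z; i = fst (snd (snd z)); j = snd (snd (snd z)) in
     if k = 0 then map (\<lambda>s. nthd False (s_label s) i) ss
     else if k \<le> 10 then map (\<lambda>y. (k, fst y, snd y) \<in> set mc_bin) (zip (nthd [] vs i) (nthd [] vs j))
     else (mc_step g ss (fst (snd z)) (nthd [] vs i) ^^ length ss) (nthd [] vs i))"

definition mc :: "bool \<Rightarrow> srep list \<Rightarrow> node list \<Rightarrow> bool list list" where
  "mc g ss ns = fold (\<lambda>z vs. vs @ [mc_node g ss vs z]) ns []"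

definition mc_holds :: "bool \<Rightarrow> srep list \<Rightarrow> node list \<Rightarrow> bool" where
  "mc_holds g ss ns \<longleftrightarrow> (\<forall>y\<in>set (zip ss (hd (rev (mc g ss ns)))). s_init (fst y) \<longrightarrow> snd y)"

lemma mc_bin_iff: "k \<noteq> 0 \<Longrightarrow> k \<le> 10 \<Longrightarrow> (k, x, y) \<in> set mc_bin \<longleftrightarrow> bin_sem (bin_ops ! (k - 1)) x y"
  by (auto simp: mc_bin_def)

lemma agree_iff:
  assumes "length \<alpha> = 3" and "length \<beta> = 3"
  shows "agree L \<alpha> \<beta> \<longleftrightarrow> (\<forall>a\<in>coalition L. \<beta> ! a = \<alpha> ! a)"
proof -
  have "agree L \<alpha> \<beta> \<longleftrightarrow> (\<forall>a. a < length L \<and> a < 3 \<longrightarrow> L ! a \<longrightarrow> \<alpha> ! a = \<beta> ! a)"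
    using assms by (auto simp: agree_def all_set_conv_all_nth)
  also have "\<dots> \<longleftrightarrow> (\<forall>a\<in>coalition L. \<beta> ! a = \<alpha> ! a)"
    by (auto simp: coalition_def nthd_def split: if_splits)
  finally show ?thesis .
qed

definition vec :: "(nat, nat) cgs \<Rightarrow> nat set \<Rightarrow> bool list" where
  "vec C X = map (\<lambda>q. q \<in> X) [0..<card (states C)]"

context
  fixes m :: nat and C :: "(nat, nat) cgs"
  assumes std: "std_cgs 3 m C"
begin

lemma std_states: "q \<in> states C \<longleftrightarrow> q < card (states C)"
  using std unfolding std_cgs_def by blast

lemma std_is_cgs: "is_cgs 3 {..<m} C"
  using std by (simp add: std_cgs_def)

lemma mc_cpre_iff:
  assumes q: "q < card (states C)"
  shows "mc_cpre L (vec C Z) (rep_state m C q) \<longleftrightarrow> q \<in> Cpre 3 C (coalition L) Z"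
proof -
  define d where "d = (num_act C q 0, num_act C q 1, num_act C q 2)"
  have q': "q \<in> states C" using q std_states by blast
  have "zip (tuples3 d) (map (trans C q) (tuples3 d)) = map (\<lambda>\<alpha>. (\<alpha>, trans C q \<alpha>)) (tuples3 d)"
    by (simp add: zip_map2 zip_same_conv_map)
  then have z: "set (zip (tuples3 d) (map (trans C q) (tuples3 d))) = (\<lambda>\<alpha>. (\<alpha>, trans C q \<alpha>)) ` act_tuples 3 C q"
    using set_tuples3[of C q] by (simp add: d_def)
  have tr: "nthd False (vec C Z) (trans C q \<beta>) \<longleftrightarrow> trans C q \<beta> \<in> Z" if "\<beta> \<in> act_tuples 3 C q" for \<beta>
  proof -
    have "trans C q \<beta> \<in> states C" using std_is_cgs q' that by (auto simp: is_cgs_def)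
    then have "trans C q \<beta> < card (states C)" using std_states by blast
    then show ?thesis by (simp add: vec_def)
  qed
  have ag: "agree L \<alpha> \<beta> \<longleftrightarrow> (\<forall>a\<in>coalition L. \<beta> ! a = \<alpha> ! a)"
    if "\<alpha> \<in> act_tuples 3 C q" "\<beta> \<in> act_tuples 3 C q" for \<alpha> \<beta>
    using that by (intro agree_iff) (auto simp: act_tuples_def)
  show ?thesis
    unfolding mc_cpre_def rep_state_def Let_def d_def[symmetric] fst_conv snd_conv z Cpre_def
    using q' tr ag by auto
qed

lemma mc_step_iff:
  "mc_step g (rep_of m C) L (vec C X) (vec C Z) =
     vec C (if g then X \<inter> Cpre 3 C (coalition L) Z else X \<union> Cpre 3 C (coalition L) Z)"
proof -
  have "zip (rep_of m C) (vec C X) = map (\<lambda>q. (rep_state m C q, q \<in> X)) [0..<card (states C)]"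
    by (simp add: rep_of_def vec_def zip_map_map zip_same_conv_map)
  then show ?thesis
    unfolding mc_step_def by (simp add: vec_def comp_def mc_cpre_iff[unfolded vec_def] cong: map_cong)
qed

lemma mc_solve:
  "(mc_step g (rep_of m C) L (vec C X) ^^ i) (vec C X) = vec C (game 3 C (coalition L) (op_of g) X i)"
proof (induction i)
  case (Suc i)
  show ?case unfolding funpow.simps comp_apply Suc mc_step_iff by (cases g) simp_all
qed simp

lemma mc_correct:
  assumes "ok_dag Bl m ns"
  shows "mc g (rep_of m C) ns = map (\<lambda>\<phi>. vec C {q. sat 3 C \<phi> q}) (forms (op_of g) ns)"
  using assms
proof (induction ns rule: rev_induct)
  case Nil
  then show ?case by (simp add: mc_def)
next
  case (snoc z ns)
  let ?fs = "forms (op_of g) ns"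
  have ok: "ok_node Bl m (length ns) z"
    and IH: "mc g (rep_of m C) ns = map (\<lambda>\<phi>. vec C {q. sat 3 C \<phi> q}) ?fs"
    using snoc by (auto simp: ok_dag_snoc)
  obtain k L i j where z: "z = (k, L, i, j)" by (cases z)
  have nth: "nthd [] (map (\<lambda>\<phi>. vec C {q. sat 3 C \<phi> q}) ?fs) i = vec C {q. sat 3 C (?fs ! i) q}"
    if "i < length ns" for i using that by simp
  have "mc_node g (rep_of m C) (map (\<lambda>\<phi>. vec C {q. sat 3 C \<phi> q}) ?fs) z = vec C {q. sat 3 C (form_node (op_of g) ?fs z) q}"
  proof -
    consider "k = 0" | "k \<noteq> 0" "k \<le> 10" | "k > 10" by linarith
    then show ?thesis
    proof cases
      case 1
      then have "i < m" using ok z by (simp add: ok_node_def)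
      then show ?thesis
        using 1 z by (simp add: mc_node_def form_node_def vec_def rep_of_def rep_state_def Let_def)
    next
      case 2
      then have ij: "i < length ns" "j < length ns" using ok z by (auto simp: ok_node_def)
      have zv: "zip (vec C A) (vec C B) = map (\<lambda>q. (q \<in> A, q \<in> B)) [0..<card (states C)]" for A B
        by (simp add: vec_def zip_map_map zip_same_conv_map)
      show ?thesis
        unfolding z mc_node_def form_node_def Let_def fst_conv snd_conv nth[OF ij(1)] nth[OF ij(2)] zv
        using 2 by (simp add: mc_bin_iff vec_def)
    next
      case 3
      then have i: "i < length ns" using ok z by (simp add: ok_node_def)
      let ?A = "coalition L" and ?\<phi> = "?fs ! i"
      interpret game_structure 3 "{..<m}" C ?A
        by standard (auto simp: std_is_cgs coalition_def)
      have vX: "vec C {q. sat 3 C \<phi> q} = vec C {q \<in> states C. sat 3 C \<phi> q}" for \<phi>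
        by (simp add: vec_def std_states)
      have "vec C (game 3 C ?A (op_of g) {q \<in> states C. sat 3 C ?\<phi> q} (card (states C))) =
          vec C {q. sat 3 C (Strat ?A (op_of g) ?\<phi>) q}"
        unfolding vec_def
      proof (intro map_cong refl)
        fix q assume "q \<in> set [0..<card (states C)]"
        then have "q \<in> states C" by (simp add: std_states)
        then show "(q \<in> game 3 C ?A (op_of g) {q \<in> states C. sat 3 C ?\<phi> q} (card (states C))) =
            (q \<in> {q. sat 3 C (Strat ?A (op_of g) ?\<phi>) q})"
          using sat_Strat[of q "op_of g" ?\<phi>] by simp
      qed
      moreover have "length (rep_of m C) = card (states C)" by (simp add: rep_of_def)
      ultimately show ?thesis
        unfolding z mc_node_def form_node_def Let_def fst_conv snd_conv nth[OF i] vX[of ?\<phi>] mc_solve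
        using 3 by simp
    qed
  qed
  then show ?case using IH by (simp add: mc_def forms_snoc)
qed

lemma mc_holds_iff:
  assumes "ok_dag Bl m ns" and "ns \<noteq> []"
  shows "mc_holds g (rep_of m C) ns \<longleftrightarrow> cgs_sat 3 C (last (forms (op_of g) ns))"
proof -
  let ?\<phi> = "last (forms (op_of g) ns)"
  have "forms (op_of g) ns \<noteq> []" using assms(2) length_forms by (metis length_0_conv)
  then have h: "hd (rev (mc g (rep_of m C) ns)) = vec C {q. sat 3 C ?\<phi> q}"
    unfolding mc_correct[OF assms(1)] by (simp add: hd_rev last_map)
  have "zip (rep_of m C) (vec C {q. sat 3 C ?\<phi> q}) = map (\<lambda>q. (rep_state m C q, sat 3 C ?\<phi> q)) [0..<card (states C)]"
    by (simp add: rep_of_def vec_def zip_map_map zip_same_conv_map)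
  then have "mc_holds g (rep_of m C) ns \<longleftrightarrow> (\<forall>q<card (states C). q \<in> init C \<longrightarrow> sat 3 C ?\<phi> q)"
    unfolding mc_holds_def h by (auto simp: rep_state_def Let_def)
  also have "\<dots> \<longleftrightarrow> cgs_sat 3 C ?\<phi>"
    using std_is_cgs std_states unfolding cgs_sat_def is_cgs_def by blast
  finally show ?thesis .
qed

end

subsection \<open>The verifier\<close>

lemma ptime_tuples30: "ptime tuples3"
  unfolding tuples3_def[abs_def] product_lists.simps by (intro ptime_intro)

lemmas ptime_tuples3 [ptime_intro] = ptime_comp[OF ptime_tuples30]

lemma ptime_enc_nat0: "ptime enc_nat"
  unfolding enc_nat_def[abs_def] by (intro ptime_intro)

lemmas ptime_enc_nat [ptime_intro] = ptime_comp[OF ptime_enc_nat0]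

lemma ptime_enc_srep0: "ptime enc_srep"
  unfolding enc_srep_def[abs_def] by (intro ptime_intro)

lemmas ptime_enc_srep [ptime_intro] = ptime_comp[OF ptime_enc_srep0]

lemma ptime_enc_rep0: "ptime enc_rep"
  unfolding enc_rep_def[abs_def] by (intro ptime_intro)

lemmas ptime_enc_rep [ptime_intro] = ptime_comp[OF ptime_enc_rep0]

lemma ptime_enc_irep0: "ptime enc_irep"
  unfolding enc_irep_def[abs_def] by (intro ptime_intro)

lemmas ptime_enc_irep [ptime_intro] = ptime_comp[OF ptime_enc_irep0]

lemma ptime_valid_rep0: "ptime (\<lambda>p. valid_rep (fst p) (snd p))"
  unfolding valid_rep_def by (intro ptime_intro)

lemmas ptime_valid_rep [ptime_intro] = ptime_comp2[OF ptime_valid_rep0]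

lemma ptime_ok_node0: "ptime (\<lambda>p. ok_node Bl (fst p) (fst (snd p)) (snd (snd p)))"
  unfolding ok_node_def Let_def by (intro ptime_intro)

lemmas ptime_ok_node [ptime_intro] = ptime_comp3[OF ptime_ok_node0]

lemma ptime_ok_dag0: "ptime (\<lambda>p. ok_dag Bl (fst p) (snd p))"
  unfolding ok_dag_def by (intro ptime_intro)

lemmas ptime_ok_dag [ptime_intro] = ptime_comp2[OF ptime_ok_dag0]

lemma ptime_agree0: "ptime (\<lambda>p. agree (fst p) (fst (snd p)) (snd (snd p)))"
  unfolding agree_def by (intro ptime_intro)

lemmas ptime_agree [ptime_intro] = ptime_comp3[OF ptime_agree0]

lemma ptime_mc_cpre0: "ptime (\<lambda>p. mc_cpre (fst p) (fst (snd p)) (snd (snd p)))"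
  unfolding mc_cpre_def by (intro ptime_intro)

lemmas ptime_mc_cpre [ptime_intro] = ptime_comp3[OF ptime_mc_cpre0]

lemma ptime_mc_step [ptime_intro]:
  assumes "ptime ss" and "ptime L" and "ptime X" and "ptime Z"
  shows "ptime (\<lambda>x. mc_step g (ss x) (L x) (X x) (Z x))"
  unfolding mc_step_def
  by (intro ptime_intro assms ptime_comp[OF assms(2)] ptime_comp[OF assms(4)])

lemma length_mc_step: "length (mc_step g ss L X Z) \<le> length ss"
  by (simp add: mc_step_def)

text \<open>Each round zips with the list of states, so iterates are never longer than
  \<open>ss\<close>; the summand for \<open>X\<close> covers the start.\<close>

lemma ptime_mc_solve [ptime_intro]:
  assumes "ptime ss" and "ptime L" and "ptime X"
  shows "ptime (\<lambda>x. (mc_step g (ss x) (L x) (X x) ^^ length (ss x)) (X x))"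
proof (rule ptime_funpow[where f = "\<lambda>x. mc_step g (ss x) (L x) (X x)" and S = "\<lambda>x. 4 * length (ss x) + bsize (X x)"])
  show "ptime (\<lambda>p. mc_step g (ss (fst p)) (L (fst p)) (X (fst p)) (snd p))"
    by (intro ptime_mc_step ptime_comp[OF assms(1)] ptime_comp[OF assms(2)] ptime_comp[OF assms(3)] ptime_intro)
  show "polyb bsize (\<lambda>x. 4 * length (ss x) + bsize (X x))"
    by (intro polyb_intro assms)
  fix x k
  show "bsize ((mc_step g (ss x) (L x) (X x) ^^ k) (X x)) \<le> 4 * length (ss x) + bsize (X x)"
  proof (cases k)
    case (Suc k')
    then show ?thesis
      using length_mc_step[of g "ss x" "L x" "X x" "(mc_step g (ss x) (L x) (X x) ^^ k') (X x)"]
      by (simp add: bsize_bools)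
  qed simp
qed (intro ptime_intro assms)+

lemma ptime_mc_node0: "ptime (\<lambda>p. mc_node g (fst p) (fst (snd p)) (snd (snd p)))"
  unfolding mc_node_def Let_def by (intro ptime_intro)

lemmas ptime_mc_node [ptime_intro] = ptime_comp3[OF ptime_mc_node0]

lemma length_mc_node:
  assumes "\<forall>v\<in>set vs. length v \<le> length ss"
  shows "length (mc_node g ss vs z) \<le> length ss"
proof -
  have n: "length (nthd [] vs i) \<le> length ss" for i using assms by (simp add: nthd_def)
  have "length ((mc_step g ss L X ^^ k) X) \<le> length ss" if "length X \<le> length ss" for L X k
    using that length_mc_step by (cases k) auto
  then show ?thesis using n by (auto simp: mc_node_def Let_def min_le_iff_disj)
qed

lemma ptime_mc0: "ptime (\<lambda>p. mc g (fst p) (snd p))"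
  unfolding mc_def
proof (rule ptime_fold[where f = "\<lambda>p z vs. vs @ [mc_node g (fst p) vs z]"
      and S = "\<lambda>p. length (snd p) * (2 * (4 * length (fst p)) + 2)"])
  show "polyb bsize (\<lambda>p :: srep list \<times> node list. length (snd p) * (2 * (4 * length (fst p)) + 2))"
    by (intro polyb_intro ptime_intro)
  fix p :: "srep list \<times> node list" and k
  have l: "length (fold (\<lambda>z vs. vs @ [mc_node g (fst p) vs z]) ns []) = length ns \<and>
      (\<forall>v\<in>set (fold (\<lambda>z vs. vs @ [mc_node g (fst p) vs z]) ns []). length v \<le> length (fst p))" for ns
    by (induction ns rule: rev_induct) (auto simp: length_mc_node)
  let ?r = "fold (\<lambda>z vs. vs @ [mc_node g (fst p) vs z]) (take k (snd p)) []"
  have "bsize ?r \<le> length ?r * (2 * (4 * length (fst p)) + 2)"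
    by (rule bsize_list_bound) (use l[of "take k (snd p)"] in \<open>auto simp: bsize_bools\<close>)
  also have "\<dots> \<le> length (snd p) * (2 * (4 * length (fst p)) + 2)"
    using l[of "take k (snd p)"] by (intro mult_le_mono) auto
  finally show "bsize ?r \<le> length (snd p) * (2 * (4 * length (fst p)) + 2)" .
qed (intro ptime_intro)+

lemmas ptime_mc [ptime_intro] = ptime_comp2[OF ptime_mc0]

lemma ptime_mc_holds0: "ptime (\<lambda>p. mc_holds g (fst p) (snd p))"
  unfolding mc_holds_def by (intro ptime_intro)

lemmas ptime_mc_holds [ptime_intro] = ptime_comp2[OF ptime_mc_holds0]

definition verify :: "bool \<Rightarrow> bin_lg set \<Rightarrow> nat \<Rightarrow> bool list \<Rightarrow> irep \<times> node list \<Rightarrow> bool" where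
  "verify g Bl n x z \<longleftrightarrow> enc_irep (fst z) = x \<and>
     (\<forall>ss\<in>set (fst (snd (fst z))). valid_rep (fst (fst z)) ss) \<and>
     (\<forall>ss\<in>set (fst (snd (snd (fst z)))). valid_rep (fst (fst z)) ss) \<and>
     ok_dag Bl (fst (fst z)) (snd z) \<and> snd z \<noteq> [] \<and>
     length (snd z) \<le> snd (snd (snd (fst z))) \<and> length (filter bin_node (snd z)) \<le> n \<and>
     (\<forall>ss\<in>set (fst (snd (fst z))). mc_holds g ss (snd z)) \<and>
     (\<forall>ss\<in>set (fst (snd (snd (fst z)))). \<not> mc_holds g ss (snd z))"

lemma ptime_verify: "ptime (\<lambda>p. verify g Bl n (fst p) (snd p))"
  unfolding verify_def by (intro ptime_intro)

lemma verify_sound: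
  assumes "verify g Bl n x z"
  shows "x \<in> ATL_Learn 3 {op_of g} Bl n"
proof -
  obtain m Ps Ns B ns where z: "z = ((m, Ps, Ns, B), ns)" by (metis prod.collapse)
  have v: "enc_irep (m, Ps, Ns, B) = x" "\<And>ss. ss \<in> set Ps \<union> set Ns \<Longrightarrow> valid_rep m ss"
    "ok_dag Bl m ns" "ns \<noteq> []" "length ns \<le> B" "length (filter bin_node ns) \<le> n"
    "\<And>ss. ss \<in> set Ps \<Longrightarrow> mc_holds g ss ns" "\<And>ss. ss \<in> set Ns \<Longrightarrow> \<not> mc_holds g ss ns"
    using assms by (auto simp: verify_def z)
  define \<phi> where "\<phi> = last (forms (op_of g) ns)"
  have \<phi>: "\<phi> \<in> ATL 3 {..<m} {op_of g} Bl" "atl_size \<phi> \<le> B" "atl_size_Bin \<phi> \<le> n"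
    using dag_formula[OF v(3,4) \<phi>_def] v(5,6) by auto
  have sat: "cgs_sat 3 (cgs_of ss) \<phi> \<longleftrightarrow> mc_holds g ss ns" if "ss \<in> set Ps \<union> set Ns" for ss
    using mc_holds_iff[OF cgs_of_valid(1)[OF v(2)[OF that]] v(3,4), of g] cgs_of_valid(2)[OF v(2)[OF that]]
    by (simp add: \<phi>_def)
  have ids: "map (rep_of m) (map cgs_of Ps) = Ps" "map (rep_of m) (map cgs_of Ns) = Ns"
    using cgs_of_valid(2)[OF v(2)] by (auto intro!: nth_equalityI)
  have x: "x = enc_instance 3 m (map cgs_of Ps) (map cgs_of Ns) B"
    unfolding enc_instance_rep ids using v(1) by simp
  have "\<forall>C\<in>set (map cgs_of Ps) \<union> set (map cgs_of Ns). std_cgs 3 m C"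
    using cgs_of_valid(1)[OF v(2)] by auto
  moreover have "learnable 3 {op_of g} Bl n {..<m} (set (map cgs_of Ps)) (set (map cgs_of Ns)) B"
    unfolding learnable_def using \<phi> sat v(7,8) by (intro bexI[of _ \<phi>]) auto
  ultimately show ?thesis unfolding ATL_Learn_def x by blast
qed

text \<open>Shows that the decoded instance inside the certificate is short: its code is linear in
  the input, since both are unary. The doubling of first components at each nesting level is
  absorbed by the constants of the next three lemmas.\<close>

lemma bsize_list_encoding:
  assumes "\<And>a. a \<in> set xs \<Longrightarrow> 2 * bsize a + 2 \<le> c * length (e a)"
  shows "bsize xs \<le> c * length (concat (map e xs))"
  using assms by (induction xs) (auto simp: algebra_simps add_mono, fastforce)

lemma bsize_srep: "2 * bsize (s :: srep) + 2 \<le> 50 * length (enc_srep s)"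
proof -
  have "bsize (s_trans s) \<le> 2 * length (concat (map enc_nat (s_trans s)))"
    by (rule bsize_list_encoding) (simp add: length_enc_nat)
  then show ?thesis by (simp add: enc_srep_def length_enc_nat bsize_bools)
qed

lemma bsize_rep: "2 * bsize (ss :: srep list) + 2 \<le> 102 * length (enc_rep ss)"
proof -
  have "bsize ss \<le> 50 * length (concat (map enc_srep ss))"
    by (rule bsize_list_encoding) (rule bsize_srep)
  then show ?thesis by (simp add: enc_rep_def length_enc_nat)
qed

lemma bsize_irep: "bsize (z :: irep) \<le> 300 * length (enc_irep z)"
proof -
  have "bsize ss \<le> 102 * length (concat (map enc_rep ss))" for ss
    by (rule bsize_list_encoding) (rule bsize_rep)
  from this[of "fst (snd z)"] this[of "fst (snd (snd z))"] show ?thesis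
    by (simp add: enc_irep_def length_enc_nat)
qed

lemma verify_complete:
  assumes "x \<in> ATL_Learn 3 {op_of g} Bl n"
  shows "\<exists>z. verify g Bl n x z \<and> bsize z \<le> 2 * (300 * length x) + 2 + length x * (2 * (100 + 6 * length x) + 2)"
proof -
  obtain m Ps Ns B \<phi> where x: "x = enc_instance 3 m Ps Ns B"
    and std: "\<And>C. C \<in> set Ps \<union> set Ns \<Longrightarrow> std_cgs 3 m C"
    and \<phi>: "\<phi> \<in> ATL 3 {..<m} {op_of g} Bl" "atl_size \<phi> \<le> B" "atl_size_Bin \<phi> \<le> n"
      "\<And>C. C \<in> set Ps \<Longrightarrow> cgs_sat 3 C \<phi>" "\<And>C. C \<in> set Ns \<Longrightarrow> \<not> cgs_sat 3 C \<phi>"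
    using assms unfolding ATL_Learn_def learnable_def by blast
  obtain ns where ns: "ok_dag Bl m ns" "ns \<noteq> []" "last (forms (op_of g) ns) = \<phi>" "length ns = atl_size \<phi>"
    "length (filter bin_node ns) = atl_size_Bin \<phi>"
    "\<And>z. z \<in> set ns \<Longrightarrow> bsize z \<le> 100 + 3 * (m + atl_size \<phi>)"
    using dag_complete[OF \<phi>(1)] by blast
  define inst where "inst = (m, map (rep_of m) Ps, map (rep_of m) Ns, B)"
  have xi: "x = enc_irep inst" unfolding inst_def x enc_instance_rep ..
  have mB: "m \<le> length x" "B \<le> length x" unfolding x enc_instance_def by (simp_all add: length_enc_nat)
  have holds: "mc_holds g (rep_of m C) ns \<longleftrightarrow> cgs_sat 3 C \<phi>" if "C \<in> set Ps \<union> set Ns" for C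
    using mc_holds_iff[OF std[OF that] ns(1,2), of g] ns(3) by simp
  have "verify g Bl n x (inst, ns)"
    unfolding verify_def xi using ns \<phi> holds std valid_rep_of by (auto simp: inst_def)
  moreover have "bsize (inst, ns) \<le> 2 * (300 * length x) + 2 + length x * (2 * (100 + 6 * length x) + 2)"
  proof -
    have "bsize ns \<le> length ns * (2 * (100 + 6 * length x) + 2)"
      by (rule bsize_list_bound) (use ns(6) \<phi>(2) mB in \<open>fastforce intro: order_trans\<close>)
    also have "\<dots> \<le> length x * (2 * (100 + 6 * length x) + 2)"
      using ns(4) \<phi>(2) mB by (intro mult_le_mono) auto
    finally show ?thesis using bsize_irep[of inst] unfolding xi by simp
  qed
  ultimately show ?thesis by blast
qed

theorem ATL_Learn_in_NP: "ATL_Learn 3 {op_of g} Bl n \<in> NP_class"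
proof (rule NP_classI[of "verify g Bl n"])
  show "ptime (\<lambda>p. verify g Bl n (fst p) (snd p))" by (rule ptime_verify)
  show "ptime (unbits :: bool list \<Rightarrow> irep \<times> node list)" by (intro ptime_unbits)
  show "polyb length (\<lambda>x :: bool list. 2 * (300 * length x) + 2 + length x * (2 * (100 + 6 * length x) + 2))"
    by (intro polyb_intro)
qed (use verify_sound verify_complete in blast)+

section \<open>Reduction of arbitrary problems in NP\<close>

section \<open>Hardness\<close>

subsection \<open>Unique decoding of instances\<close>

lemma enc_nat_append_inject: "enc_nat a @ r = enc_nat b @ r' \<longleftrightarrow> a = b \<and> r = r'"
proof (induction a arbitrary: b)
  case 0
  show ?case by (cases b) (auto simp: enc_nat_def)
next
  case (Suc a)
  show ?case
  proof (cases b)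
    case (Suc b')
    then show ?thesis using Suc.IH[of b'] by (simp add: enc_nat_def)
  qed (simp add: enc_nat_def)
qed

lemma concat_append_inject:
  assumes e: "\<And>x y r r'. P x \<Longrightarrow> P y \<Longrightarrow> e x @ r = e y @ r' \<Longrightarrow> x = y \<and> r = r'"
    and "length xs = length ys" and "\<forall>x\<in>set xs. P x" and "\<forall>y\<in>set ys. P y"
    and "concat (map e xs) @ r = concat (map e ys) @ r'"
  shows "xs = ys \<and> r = r'"
  using assms(2-)
proof (induction xs ys rule: list_induct2)
  case (Cons x xs y ys)
  have "x = y \<and> concat (map e xs) @ r = concat (map e ys) @ r'"
    by (rule e) (use Cons.prems in auto)
  then show ?case using Cons by auto
qed simp

lemma enc_nats_append_inject:
  "length xs = length ys \<Longrightarrow> concat (map enc_nat xs) @ r = concat (map enc_nat ys) @ r' \<Longrightarrow> xs = ys \<and> r = r'"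
  by (rule concat_append_inject[of "\<lambda>_. True" enc_nat]) (auto simp: enc_nat_append_inject)

text \<open>Labels and transition tables carry no length marks. The first have the known length
  \<open>m\<close>; the action counts precede the table and determine its length.\<close>

lemma enc_srep_append_inject:
  assumes s: "length (s_label s) = m \<and> length (s_trans s) = length (tuples3 (s_acts s))"
    and s': "length (s_label s') = m \<and> length (s_trans s') = length (tuples3 (s_acts s'))"
    and eq: "enc_srep s @ r = enc_srep s' @ r'"
  shows "s = s' \<and> r = r'"
proof -
  obtain i l a b c t where S: "s = (i, l, (a, b, c), t)" by (metis prod.collapse)
  obtain i' l' a' b' c' t' where S': "s' = (i', l', (a', b', c'), t')" by (metis prod.collapse)
  have "i = i'" and "l @ enc_nat a @ enc_nat b @ enc_nat c @ concat (map enc_nat t) @ r =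
      l' @ enc_nat a' @ enc_nat b' @ enc_nat c' @ concat (map enc_nat t') @ r'"
    using eq by (simp_all add: S S' enc_srep_def)
  moreover have "length l = length l'" using s s' by (simp add: S S')
  ultimately have e: "i = i'" "l = l'" "a = a'" "b = b'" "c = c'"
    "concat (map enc_nat t) @ r = concat (map enc_nat t') @ r'"
    by (simp_all add: enc_nat_append_inject)
  have "length t = length t'" using s s' e by (simp add: S S')
  from enc_nats_append_inject[OF this e(6)] show ?thesis using e by (simp add: S S')
qed

lemma enc_rep_append_inject:
  assumes "valid_rep m ss" and "valid_rep m ss'" and "enc_rep ss @ r = enc_rep ss' @ r'"
  shows "ss = ss' \<and> r = r'"
proof -
  have "length ss = length ss'" "concat (map enc_srep ss) @ r = concat (map enc_srep ss') @ r'"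
    using assms(3) by (simp_all add: enc_rep_def enc_nat_append_inject)
  then show ?thesis
    using assms(1,2) unfolding valid_rep_def
    by (intro concat_append_inject[where e = enc_srep and
          P = "\<lambda>s. length (s_label s) = m \<and> length (s_trans s) = length (tuples3 (s_acts s))"]
        enc_srep_append_inject) auto
qed

lemma enc_irep_inject:
  assumes "enc_irep (m, Ps, Ns, B) = enc_irep (m', Ps', Ns', B')"
    and "\<forall>ss\<in>set Ps \<union> set Ns. valid_rep m ss" and "\<forall>ss\<in>set Ps' \<union> set Ns'. valid_rep m' ss"
  shows "m = m' \<and> Ps = Ps' \<and> Ns = Ns' \<and> B = B'"
proof -
  have m: "m = m'" "length Ps = length Ps'"
    "concat (map enc_rep Ps) @ enc_nat (length Ns) @ concat (map enc_rep Ns) @ enc_nat B =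
     concat (map enc_rep Ps') @ enc_nat (length Ns') @ concat (map enc_rep Ns') @ enc_nat B'"
    using assms(1) by (simp_all add: enc_irep_def enc_nat_append_inject)
  have P: "Ps = Ps' \<and> enc_nat (length Ns) @ concat (map enc_rep Ns) @ enc_nat B =
     enc_nat (length Ns') @ concat (map enc_rep Ns') @ enc_nat B'"
  proof (rule concat_append_inject[where e = enc_rep and P = "valid_rep m"])
    show "ss = ss' \<and> r = r'" if "valid_rep m ss" "valid_rep m ss'" "enc_rep ss @ r = enc_rep ss' @ r'" for ss ss' r r'
      using enc_rep_append_inject that by blast
  qed (use m assms(2,3) in simp_all)
  then have N: "length Ns = length Ns'" "concat (map enc_rep Ns) @ enc_nat B = concat (map enc_rep Ns') @ enc_nat B'"
    by (simp_all add: enc_nat_append_inject)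
  have "Ns = Ns' \<and> enc_nat B = enc_nat B'"
  proof (rule concat_append_inject[where e = enc_rep and P = "valid_rep m"])
    show "ss = ss' \<and> r = r'" if "valid_rep m ss" "valid_rep m ss'" "enc_rep ss @ r = enc_rep ss' @ r'" for ss ss' r r'
      using enc_rep_append_inject that by blast
  qed (use m N assms(2,3) in simp_all)
  then show ?thesis using m P enc_nat_append_inject[of B "[]" B' "[]"] by simp
qed

text \<open>Membership only says that some instance with the same word is learnable, so decoding
  must be unique. As words determine structures only up to their representations, the argument
  passes through the verifier, which sees nothing else.\<close>

lemma enc_instance_in_ATL_Learn:
  assumes std: "\<forall>C\<in>set Ps \<union> set Ns. std_cgs 3 m C"
  shows "enc_instance 3 m Ps Ns B \<in> ATL_Learn 3 {op_of g} Bl n \<longleftrightarrow>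
    learnable 3 {op_of g} Bl n {..<m} (set Ps) (set Ns) B"
proof
  assume "enc_instance 3 m Ps Ns B \<in> ATL_Learn 3 {op_of g} Bl n"
  then obtain m' Ps' Ns' B' ns where v: "verify g Bl n (enc_instance 3 m Ps Ns B) ((m', Ps', Ns', B'), ns)"
    using verify_complete[of _ g Bl n] by (metis prod.collapse)
  then have "enc_irep (m', Ps', Ns', B') = enc_irep (m, map (rep_of m) Ps, map (rep_of m) Ns, B)"
    "\<forall>ss\<in>set Ps' \<union> set Ns'. valid_rep m' ss" by (auto simp: verify_def enc_instance_rep)
  moreover have "\<forall>ss\<in>set (map (rep_of m) Ps) \<union> set (map (rep_of m) Ns). valid_rep m ss"
    using std valid_rep_of by auto
  ultimately have "m' = m" "Ps' = map (rep_of m) Ps" "Ns' = map (rep_of m) Ns" "B' = B"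
    using enc_irep_inject by blast+
  then have v: "ok_dag Bl m ns" "ns \<noteq> []" "length ns \<le> B" "length (filter bin_node ns) \<le> n"
    "\<And>C. C \<in> set Ps \<Longrightarrow> mc_holds g (rep_of m C) ns" "\<And>C. C \<in> set Ns \<Longrightarrow> \<not> mc_holds g (rep_of m C) ns"
    using v by (auto simp: verify_def)
  show "learnable 3 {op_of g} Bl n {..<m} (set Ps) (set Ns) B"
    unfolding learnable_def
    using dag_formula[OF v(1,2) refl, of "op_of g"] v std mc_holds_iff[OF _ v(1,2)]
    by (intro bexI[of _ "last (forms (op_of g) ns)"]) auto
next
  assume "learnable 3 {op_of g} Bl n {..<m} (set Ps) (set Ns) B"
  then show "enc_instance 3 m Ps Ns B \<in> ATL_Learn 3 {op_of g} Bl n"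
    using std unfolding ATL_Learn_def by blast
qed

subsection \<open>Writing down chains\<close>

text \<open>Division by 2, obtained by counting so that the closure rules for \<open>filter\<close>
  and \<open>length\<close> apply.\<close>

definition half :: "nat \<Rightarrow> nat" where
  "half q = length (filter (\<lambda>i. 2 * i \<le> q) [1..<Suc q])"

lemma half: "half q = q div 2"
proof -
  have "[1..<Suc q] = [1..<Suc (q div 2)] @ [Suc (q div 2)..<Suc q]"
    using upt_add_eq_append[of 1 "Suc (q div 2)" "q - q div 2"] by simp
  moreover have "filter (\<lambda>i. 2 * i \<le> q) [1..<Suc (q div 2)] = [1..<Suc (q div 2)]"
    by (rule filter_True) auto
  moreover have "filter (\<lambda>i. 2 * i \<le> q) [Suc (q div 2)..<Suc q] = []"
    by (rule filter_False) auto
  ultimately show ?thesis unfolding half_def by (simp only: filter_append append_Nil2 length_upt diff_Suc_1)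
qed

text \<open>\<open>clause_level\<close> in terms of the action tuple instead of the set of voters,
  using only operations with closure rules. This explains \<open>hd\<close> and \<open>drop\<close>
  in place of indexing.\<close>

definition level_rep :: "'v list \<Rightarrow> (bool \<times> 'v) list \<Rightarrow> nat \<Rightarrow> nat list \<Rightarrow> bool" where
  "level_rep vs c q \<alpha> = (if 2 * half q = q
     then (hd \<alpha> = 1 \<and> (True, hd (drop (half q - 1) vs)) \<notin> set c) \<or>
          (hd (tl \<alpha>) = 1 \<and> (False, hd (drop (half q - 1) vs)) \<notin> set c)
     else hd (tl (tl \<alpha>)) = 1)"

definition all_acts :: "nat list list" where
  "all_acts = tuples3 (2, 2, 2)"

definition clause_rep :: "bool \<Rightarrow> nat \<Rightarrow> 'v list \<Rightarrow> (bool \<times> 'v) list \<Rightarrow> srep list" where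
  "clause_rep g l vs c = map (\<lambda>q. (q = l, [(q = 0) \<noteq> g], (2, 2, 2),
     map (\<lambda>\<alpha>. if q \<noteq> 0 \<and> level_rep vs c q \<alpha> then q - 1 else q) all_acts)) [0..<Suc l]"

lemma rep_of_clause_chain: "rep_of 1 (chain g (clause_level vs c) l) = clause_rep g l vs c"
proof -
  have lev: "clause_level vs c q {a. a < 3 \<and> \<alpha> ! a = 1} = level_rep vs c q \<alpha>" if "\<alpha> \<in> set all_acts" for q \<alpha>
  proof -
    have "length \<alpha> = 3" using that unfolding all_acts_def tuples3_def by (auto simp: in_set_product_lists_length)
    then obtain x y z where \<alpha>: "\<alpha> = [x, y, z]" by (auto simp: numeral_3_eq_3 length_Suc_conv)
    have "2 * half q = q \<longleftrightarrow> even q" unfolding half by (metis dvd_mult_div_cancel dvd_triv_left)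
    then show ?thesis by (simp add: clause_level_def level_rep_def \<alpha> half Let_def)
  qed
  have "rep_state 1 (chain g (clause_level vs c) l) q = (q = l, [(q = 0) \<noteq> g], (2, 2, 2),
     map (\<lambda>\<alpha>. if q \<noteq> 0 \<and> level_rep vs c q \<alpha> then q - 1 else q) all_acts)" for q
  proof -
    have "num_act (chain g (clause_level vs c) l) q a = 2" for a by (simp add: chain_def)
    moreover have "map (\<lambda>p. p \<in> label (chain g (clause_level vs c) l) q) [0..<1] = [(q = 0) \<noteq> g]"
      by (simp add: chain_def)
    moreover have "map (trans (chain g (clause_level vs c) l) q) (tuples3 (2, 2, 2)) =
        map (\<lambda>\<alpha>. if q \<noteq> 0 \<and> level_rep vs c q \<alpha> then q - 1 else q) all_acts"
      unfolding all_acts_def[symmetric] by (rule map_cong[OF refl]) (simp only: chain_simps lev)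
    ultimately show ?thesis
      unfolding rep_state_def Let_def by (simp only: chain_simps singleton_iff)
  qed
  then show ?thesis by (simp add: rep_of_def clause_rep_def)
qed

lemma ptime_half0: "ptime half"
  unfolding half_def[abs_def] by (intro ptime_intro)

lemmas ptime_half [ptime_intro] = ptime_comp[OF ptime_half0]

lemma ptime_clause_rep0:
  "ptime (\<lambda>p :: nat \<times> 'v::bitcoded list \<times> (bool \<times> 'v) list. clause_rep g (fst p) (fst (snd p)) (snd (snd p)))"
  unfolding clause_rep_def level_rep_def by (intro ptime_intro)

lemmas ptime_clause_rep [ptime_intro] = ptime_comp3[OF ptime_clause_rep0]

text \<open>The majority chain does not depend on the clauses, so its representation enters as a
  constant; the other chains are produced by \<open>clause_rep\<close>.\<close>

definition sat_instance :: "bool \<Rightarrow> 'v list \<Rightarrow> (bool \<times> 'v) list list \<Rightarrow> bool list" where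
  "sat_instance g vs cs = (let l = 2 * length vs; pos = [clause_rep g l vs []];
     neg = rep_of 1 (chain g majority 1) # clause_rep g (l + 2) vs [] # map (clause_rep g l vs) cs
   in enc_irep (1, if g then neg else pos, if g then pos else neg, l + 1))"

lemma ptime_sat_instance0: "ptime (\<lambda>p :: 'v::bitcoded list \<times> (bool \<times> 'v) list list. sat_instance g (fst p) (snd p))"
  unfolding sat_instance_def Let_def by (intro ptime_intro)

lemmas ptime_sat_instance = ptime_comp2[OF ptime_sat_instance0]

lemma sat_instance_in_ATL_Learn:
  fixes vs :: "'v list"
  assumes "distinct vs" and "\<And>c l. c \<in> set cs \<Longrightarrow> l \<in> set c \<Longrightarrow> snd l \<in> set vs"
  shows "sat_instance g vs cs \<in> ATL_Learn 3 {op_of g} Bl n \<longleftrightarrow>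
    (\<exists>\<tau>. \<forall>c\<in>set cs. \<exists>l\<in>set c. \<tau> (snd l) = fst l)"
proof -
  let ?Ps = "if g then neg_chains g vs cs else [pos_chain g vs]"
  let ?Ns = "if g then [pos_chain g vs] else neg_chains g vs cs"
  have "sat_instance g vs cs = enc_instance 3 1 ?Ps ?Ns (2 * length vs + 1)"
    unfolding enc_instance_rep
    by (simp add: sat_instance_def Let_def pos_chain_def neg_chains_def rep_of_clause_chain[simplified] comp_def)
  moreover have "\<forall>C\<in>set ?Ps \<union> set ?Ns. std_cgs 3 1 C"
    by (auto simp: neg_chains_def pos_chain_def std_chain[simplified])
  ultimately have "sat_instance g vs cs \<in> ATL_Learn 3 {op_of g} Bl n \<longleftrightarrow>
    learnable 3 {op_of g} Bl n {..<1} (set ?Ps) (set ?Ns) (2 * length vs + 1)"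
    using enc_instance_in_ATL_Learn[of ?Ps ?Ns 1 "2 * length vs + 1" g Bl n] by simp
  also have "set ?Ps = (if g then set (neg_chains g vs cs) else {pos_chain g vs})" by simp
  also have "set ?Ns = (if g then {pos_chain g vs} else set (neg_chains g vs cs))" by simp
  also have "learnable 3 {op_of g} Bl n {..<1} (if g then set (neg_chains g vs cs) else {pos_chain g vs})
      (if g then {pos_chain g vs} else set (neg_chains g vs cs)) (2 * length vs + 1) \<longleftrightarrow>
    (\<exists>\<tau>. \<forall>c\<in>set cs. \<exists>(b, v)\<in>set c. \<tau> v = b)"
  proof (rule learnable_iff_satisfiable[OF assms(1)])
    show "v \<in> set vs" if "c \<in> set cs" "(b, v) \<in> set c" for c b v using assms(2)[OF that] by simp
  qed
  finally show ?thesis by (simp add: split_beta)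
qed

subsection \<open>Runs of Turing machines as propositional clauses\<close>

text \<open>
  A fact \<open>(r, k, t, j, a)\<close> speaks about time \<open>t\<close> and tape \<open>k\<close>: the state is \<open>a\<close> (\<open>r = 0\<close>), cell \<open>j\<close>
  contains \<open>a\<close> (\<open>r = 1\<close>), the head is on cell \<open>j\<close> (\<open>r = 2\<close>), the symbol read is \<open>a\<close> (\<open>r = 3\<close>), and
  symbol \<open>a\<close> is written and the head moved by \<open>j - 1\<close> (\<open>r = 4\<close>). Cell \<open>j\<close> is the tape position \<open>j - T\<close>.
  The clauses are Horn clauses deriving the facts of the run, except those on the unknown part of the
  input; so no clauses excluding contradictory facts are needed.
\<close>

type_synonym fact = "nat \<times> nat \<times> nat \<times> nat \<times> nat"
type_synonym clause = "(bool \<times> fact) list"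

definition fS :: "nat \<Rightarrow> nat \<Rightarrow> fact" where "fS t q = (0, 0, t, 0, q)"
definition fC :: "nat \<Rightarrow> nat \<Rightarrow> nat \<Rightarrow> nat \<Rightarrow> fact" where "fC k t j a = (1, k, t, j, a)"
definition fH :: "nat \<Rightarrow> nat \<Rightarrow> nat \<Rightarrow> fact" where "fH k t j = (2, k, t, j, 0)"
definition fR :: "nat \<Rightarrow> nat \<Rightarrow> nat \<Rightarrow> fact" where "fR k t a = (3, k, t, 0, a)"
definition fW :: "nat \<Rightarrow> nat \<Rightarrow> nat \<Rightarrow> nat \<Rightarrow> fact" where "fW k t d b = (4, k, t, d, b)"

lemmas fact_defs = fS_def fC_def fH_def fR_def fW_def

fun mcode :: "head_move \<Rightarrow> nat" where
  "mcode Move_Left = 0"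
| "mcode Stay = 1"
| "mcode Move_Right = 2"

lemma mcode: "int (mcode m) = 1 + move_offset m" "mcode m < 3"
  by (cases m; simp)+

text \<open>The halting state is given a step that rewrites the symbols read and does not move. Runs
  of different lengths can thus all be inspected at time \<open>T\<close>.\<close>

definition tm_next :: "tm \<Rightarrow> nat \<Rightarrow> nat list \<Rightarrow> nat \<times> (nat \<times> head_move) list" where
  "tm_next M q as = (if q = 1 then (1, map (\<lambda>a. (a, Stay)) as) else delta M q as)"

definition rules :: "tm \<Rightarrow> (nat \<times> nat list \<times> nat \<times> (nat \<times> nat) list) list" where
  "rules M = map (\<lambda>(q, as). (q, as, fst (tm_next M q as), map (\<lambda>x. (fst x, mcode (snd x))) (snd (tm_next M q as))))
     (List.product [0..<nstates M] (List.n_lists (ntapes M) [0..<nsyms M]))"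

definition prefix :: "bool list \<Rightarrow> bool list" where
  "prefix x = concat (map (\<lambda>b. [b, b]) x) @ [False, True]"

text \<open>The last two groups of clauses describe the certificate: each of \<open>L\<close> cells
  is blank or holds a bit, and blanks spread to the right, so the cells spell a word of length at
  most \<open>L\<close>.\<close>

definition init_clauses :: "tm \<Rightarrow> bool list \<Rightarrow> nat \<Rightarrow> nat \<Rightarrow> clause list" where
  "init_clauses M x T L =
    [[(True, fS 0 0)]] @
    map (\<lambda>k. [(True, fH k 0 T)]) [0..<ntapes M] @
    concat (map (\<lambda>k. map (\<lambda>j. [(True, fC k 0 j 0)]) [0..<2 * T + 3]) [1..<ntapes M]) @
    map (\<lambda>j. [(True, fC 0 0 j 0)]) [0..<T] @
    map (\<lambda>j. [(True, fC 0 0 j 0)]) [T + (2 * length x + 2) + L..<2 * T + 3] @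
    map (\<lambda>i. [(True, fC 0 0 (T + fst i) (if snd i then 2 else 1))]) (zip [0..<2 * length x + 2] (prefix x)) @
    map (\<lambda>i. [(True, fC 0 0 (T + (2 * length x + 2) + i) 0), (True, fC 0 0 (T + (2 * length x + 2) + i) 1),
      (True, fC 0 0 (T + (2 * length x + 2) + i) 2)]) [0..<L] @
    map (\<lambda>i. [(False, fC 0 0 (T + (2 * length x + 2) + i) 0), (True, fC 0 0 (T + (2 * length x + 2) + i + 1) 0)]) [0..<L]"

definition rule_clauses :: "tm \<Rightarrow> nat \<Rightarrow> nat \<times> nat list \<times> nat \<times> (nat \<times> nat) list \<Rightarrow> clause list" where
  "rule_clauses M t r = (let pre = (False, fS t (fst r)) #
       map (\<lambda>y. (False, fR (fst y) t (snd y))) (zip [0..<ntapes M] (fst (snd r)))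
     in (pre @ [(True, fS (t + 1) (fst (snd (snd r))))]) #
        map (\<lambda>y. pre @ [(True, fW (fst y) t (snd (snd y)) (fst (snd y)))]) (zip [0..<ntapes M] (snd (snd (snd r)))))"

text \<open>Before time \<open>T\<close> no head leaves the cells 1 to \<open>2 * T\<close>, so
  moves are needed for these only; starting at 1 also keeps \<open>j + d - 1\<close> exact for
  natural numbers. The last group says that cells away from the head keep their contents.\<close>

definition step_clauses :: "tm \<Rightarrow> nat \<Rightarrow> nat \<Rightarrow> clause list" where
  "step_clauses M T t =
    concat (map (\<lambda>k. concat (map (\<lambda>j. map (\<lambda>a. [(False, fH k t j), (False, fC k t j a), (True, fR k t a)])
      [0..<nsyms M]) [0..<2 * T + 3])) [0..<ntapes M]) @
    concat (map (rule_clauses M t) (rules M)) @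
    concat (map (\<lambda>k. concat (map (\<lambda>b. concat (map (\<lambda>d. concat (map (\<lambda>j.
        [[(False, fW k t d b), (False, fH k t j), (True, fC k (t + 1) j b)],
         [(False, fW k t d b), (False, fH k t j), (True, fH k (t + 1) (j + d - 1))]])
      [1..<2 * T + 1])) [0..<3])) [0..<nsyms M])) [0..<ntapes M]) @
    concat (map (\<lambda>k. concat (map (\<lambda>a. concat (map (\<lambda>i. concat (map (\<lambda>j.
        if i = j then [] else [[(False, fH k t j), (False, fC k t i a), (True, fC k (t + 1) i a)]])
      [0..<2 * T + 3])) [0..<2 * T + 3])) [0..<nsyms M])) [0..<ntapes M])"

text \<open>Symbol 1 at position 0 (cell \<open>T\<close>) of the output tape means rejection. The
  final clause forbids it instead of demanding symbol 2, because making every fact true satisfies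
  all the other clauses.\<close>

definition run_clauses :: "tm \<Rightarrow> bool list \<Rightarrow> nat \<Rightarrow> nat \<Rightarrow> clause list" where
  "run_clauses M x T L = init_clauses M x T L @ concat (map (step_clauses M T) [0..<T]) @
     [[(False, fC (ntapes M - 1) T T 1)]]"

text \<open>A box that contains every fact of the clauses; surplus facts only lengthen the chains.
  Its side lengths are polynomial because \<open>M\<close> is fixed.\<close>

definition all_facts :: "tm \<Rightarrow> nat \<Rightarrow> fact list" where
  "all_facts M T = List.product [0..<5] (List.product [0..<ntapes M] (List.product [0..<T + 1]
     (List.product [0..<2 * T + 4] [0..<nstates M + nsyms M + 3])))"

abbreviation satisfies :: "(fact \<Rightarrow> bool) \<Rightarrow> clause list \<Rightarrow> bool" where
  "satisfies \<tau> cs \<equiv> \<forall>c\<in>set cs. \<exists>l\<in>set c. \<tau> (snd l) = fst l"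

lemma ball_zip_upt:
  "length xs = n \<Longrightarrow> (\<forall>y\<in>set (zip [0..<n] xs). P y) \<longleftrightarrow> (\<forall>i<n. P (i, xs ! i))"
  by (auto simp: all_set_conv_all_nth)

lemma bex_zip_upt:
  "length xs = n \<Longrightarrow> (\<exists>y\<in>set (zip [0..<n] xs). P y) \<longleftrightarrow> (\<exists>i<n. P (i, xs ! i))"
  using ball_zip_upt[of xs n "\<lambda>y. \<not> P y"] by blast

lemma length_prefix: "length (prefix x) = 2 * length x + 2"
  by (induction x) (auto simp: prefix_def)

lemma word_pair_prefix: "word_pair x u = prefix x @ u"
  by (simp add: word_pair_def prefix_def)

lemma satisfies_concat:
  "satisfies \<tau> (concat (map f xs)) \<longleftrightarrow> (\<forall>x\<in>set xs. satisfies \<tau> (f x))"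
  by auto

lemma satisfies_map:
  "satisfies \<tau> (map f xs) \<longleftrightarrow> (\<forall>x\<in>set xs. \<exists>l\<in>set (f x). \<tau> (snd l) = fst l)"
  by auto

lemma ball_upt: "(\<forall>x\<in>set [a..<b]. P x) \<longleftrightarrow> (\<forall>x. a \<le> x \<and> x < b \<longrightarrow> P x)"
  by auto

lemma satisfies_init:
  "satisfies \<tau> (init_clauses M x T L) \<longleftrightarrow>
     \<tau> (fS 0 0) \<and> (\<forall>k<ntapes M. \<tau> (fH k 0 T)) \<and>
     (\<forall>k. 1 \<le> k \<and> k < ntapes M \<longrightarrow> (\<forall>j<2 * T + 3. \<tau> (fC k 0 j 0))) \<and>
     (\<forall>j<T. \<tau> (fC 0 0 j 0)) \<and>
     (\<forall>j. T + (2 * length x + 2) + L \<le> j \<and> j < 2 * T + 3 \<longrightarrow> \<tau> (fC 0 0 j 0)) \<and>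
     (\<forall>i<2 * length x + 2. \<tau> (fC 0 0 (T + i) (sym_of (prefix x ! i)))) \<and>
     (\<forall>i<L. \<tau> (fC 0 0 (T + (2 * length x + 2) + i) 0) \<or> \<tau> (fC 0 0 (T + (2 * length x + 2) + i) 1) \<or>
        \<tau> (fC 0 0 (T + (2 * length x + 2) + i) 2)) \<and>
     (\<forall>i<L. \<tau> (fC 0 0 (T + (2 * length x + 2) + i) 0) \<longrightarrow> \<tau> (fC 0 0 (T + (2 * length x + 2) + i + 1) 0))"
  unfolding init_clauses_def set_append ball_Un satisfies_concat satisfies_map ball_zip_upt[OF length_prefix[of x]] ball_upt
  by (intro arg_cong2[of _ _ _ _ "(\<and>)"] refl) auto

lemma satisfies_rule:
  assumes "length (fst (snd r)) = ntapes M" and "length (snd (snd (snd r))) = ntapes M"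
  shows "satisfies \<tau> (rule_clauses M t r) \<longleftrightarrow>
    (\<tau> (fS t (fst r)) \<and> (\<forall>k<ntapes M. \<tau> (fR k t (fst (snd r) ! k))) \<longrightarrow>
       \<tau> (fS (t + 1) (fst (snd (snd r)))) \<and>
       (\<forall>k<ntapes M. \<tau> (fW k t (snd (snd (snd (snd r)) ! k)) (fst (snd (snd (snd r)) ! k)))))"
  unfolding rule_clauses_def Let_def list.set set_map set_append ball_simps ball_zip_upt[OF assms(2)]
    bex_simps bex_Un bex_zip_upt[OF assms(1)]
  by auto

lemma satisfies_step:
  assumes len: "\<forall>r\<in>set (rules M). length (fst (snd r)) = ntapes M \<and> length (snd (snd (snd r))) = ntapes M"
  shows "satisfies \<tau> (step_clauses M T t) \<longleftrightarrow>
    (\<forall>k<ntapes M. \<forall>j<2 * T + 3. \<forall>a<nsyms M. \<tau> (fH k t j) \<longrightarrow> \<tau> (fC k t j a) \<longrightarrow> \<tau> (fR k t a)) \<and>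
    (\<forall>r\<in>set (rules M). \<tau> (fS t (fst r)) \<and> (\<forall>k<ntapes M. \<tau> (fR k t (fst (snd r) ! k))) \<longrightarrow>
       \<tau> (fS (t + 1) (fst (snd (snd r)))) \<and>
       (\<forall>k<ntapes M. \<tau> (fW k t (snd (snd (snd (snd r)) ! k)) (fst (snd (snd (snd r)) ! k))))) \<and>
    (\<forall>k<ntapes M. \<forall>b<nsyms M. \<forall>d<3. \<forall>j. 1 \<le> j \<and> j < 2 * T + 1 \<longrightarrow> \<tau> (fW k t d b) \<longrightarrow> \<tau> (fH k t j) \<longrightarrow>
       \<tau> (fC k (t + 1) j b) \<and> \<tau> (fH k (t + 1) (j + d - 1))) \<and>
    (\<forall>k<ntapes M. \<forall>a<nsyms M. \<forall>i<2 * T + 3. \<forall>j<2 * T + 3. i \<noteq> j \<longrightarrow> \<tau> (fH k t j) \<longrightarrow>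
       \<tau> (fC k t i a) \<longrightarrow> \<tau> (fC k (t + 1) i a))"
proof -
  have rl: "(\<forall>r\<in>set (rules M). satisfies \<tau> (rule_clauses M t r)) \<longleftrightarrow>
    (\<forall>r\<in>set (rules M). \<tau> (fS t (fst r)) \<and> (\<forall>k<ntapes M. \<tau> (fR k t (fst (snd r) ! k))) \<longrightarrow>
       \<tau> (fS (t + 1) (fst (snd (snd r)))) \<and>
       (\<forall>k<ntapes M. \<tau> (fW k t (snd (snd (snd (snd r)) ! k)) (fst (snd (snd (snd r)) ! k)))))"
    using satisfies_rule len by (intro ball_cong refl) blast
  show ?thesis
    unfolding step_clauses_def set_append ball_Un satisfies_concat satisfies_map rl ball_upt
    by (intro arg_cong2[of _ _ _ _ "(\<and>)"] refl) auto
qed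

subsection \<open>Correctness of the clauses\<close>

context
  fixes M :: tm and w :: "bool list"
  assumes wf: "wf_tm M"
begin

definition "cfg t = (tm_step M ^^ t) (tm_init M w)"
definition "st t = fst (cfg t)"
definition "hp t k = fst (snd (cfg t) ! k)"
definition "ce t k = snd (snd (cfg t) ! k)"
definition "rd t = map (\<lambda>k. ce t k (hp t k)) [0..<ntapes M]"
definition "nx t = tm_next M (st t) (rd t)"

lemma tm_next_wf:
  assumes "q < nstates M" and "length as = ntapes M" and "set as \<subseteq> {..<nsyms M}"
  shows "fst (tm_next M q as) < nstates M" and "length (snd (tm_next M q as)) = ntapes M"
    and "k < ntapes M \<Longrightarrow> fst (snd (tm_next M q as) ! k) < nsyms M"
proof -
  have d: "fst (delta M q as) < nstates M" "length (snd (delta M q as)) = ntapes M"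
    "fst ` set (snd (delta M q as)) \<subseteq> {..<nsyms M}" "2 \<le> nstates M"
    using wf assms unfolding wf_tm_def by blast+
  show "fst (tm_next M q as) < nstates M" "length (snd (tm_next M q as)) = ntapes M"
    using d assms by (auto simp: tm_next_def)
  show "fst (snd (tm_next M q as) ! k) < nsyms M" if "k < ntapes M"
  proof (cases "q = 1")
    case True
    then show ?thesis using subsetD[OF assms(3) nth_mem[of k as]] assms(2) that by (simp add: tm_next_def)
  next
    case False
    then have "fst (snd (delta M q as) ! k) \<in> fst ` set (snd (delta M q as))" using that d(2) by simp
    then show ?thesis using False d(3) by (auto simp: tm_next_def)
  qed
qed

lemma tm_step_next:
  assumes "length (snd c) = ntapes M"
  shows "tm_step M c = (fst (tm_next M (fst c) (map read_tape (snd c))),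
     map2 act_tape (snd (tm_next M (fst c) (map read_tape (snd c)))) (snd c))"
proof (cases "fst c = 1")
  case True
  have "act_tape (read_tape t, Stay) t = t" for t by (simp add: act_tape_def read_tape_def)
  then have "map2 act_tape (map (\<lambda>a. (a, Stay)) (map read_tape ts)) ts = ts" for ts
    by (induction ts) auto
  then show ?thesis using True by (simp add: tm_step_def tm_next_def prod_eq_iff)
next
  case False
  then show ?thesis by (simp add: tm_step_def tm_next_def Let_def)
qed

lemma cfg_Suc: "cfg (Suc t) = tm_step M (cfg t)"
  by (simp add: cfg_def)

lemma reads: "length (snd (cfg t)) = ntapes M \<Longrightarrow> map read_tape (snd (cfg t)) = rd t"
  by (auto simp: rd_def read_tape_def hp_def ce_def intro!: nth_equalityI)

lemma cfg_wf: "length (snd (cfg t)) = ntapes M \<and> st t < nstates M \<and> (\<forall>k<ntapes M. \<forall>i. ce t k i < nsyms M)"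
proof (induction t)
  case 0
  have n: "1 \<le> ntapes M" "2 \<le> nstates M" "3 \<le> nsyms M" using wf by (auto simp: wf_tm_def)
  have "tape_word v i < nsyms M" for v i using n by (auto simp: tape_word_def)
  then show ?case using n by (auto simp: cfg_def tm_init_def st_def ce_def nth_Cons')
next
  case (Suc t)
  then have len: "length (snd (cfg t)) = ntapes M" by simp
  have as: "length (rd t) = ntapes M" "set (rd t) \<subseteq> {..<nsyms M}" using Suc by (auto simp: rd_def)
  note nxt = tm_next_wf[OF _ as, of "st t"]
  have c: "cfg (Suc t) = (fst (nx t), map2 act_tape (snd (nx t)) (snd (cfg t)))"
    unfolding cfg_Suc tm_step_next[OF len] reads[OF len] nx_def st_def ..
  have lnx: "length (snd (nx t)) = ntapes M" using nxt Suc by (simp add: nx_def)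
  have "ce (Suc t) k i < nsyms M" if "k < ntapes M" for k i
  proof -
    have "ce (Suc t) k = (ce t k)(hp t k := fst (snd (nx t) ! k))"
      using that len lnx by (simp add: ce_def c act_tape_def hp_def)
    then show ?thesis using Suc that nxt(3)[of k] by (simp add: nx_def)
  qed
  moreover have "st (Suc t) < nstates M" using nxt(1) Suc unfolding st_def c by (simp add: nx_def st_def)
  ultimately show ?case using lnx len c by simp
qed

lemma rd_wf: "length (rd t) = ntapes M" "set (rd t) \<subseteq> {..<nsyms M}"
  using cfg_wf[of t] by (auto simp: rd_def)

lemma nx_wf: "fst (nx t) < nstates M" "length (snd (nx t)) = ntapes M"
  "k < ntapes M \<Longrightarrow> fst (snd (nx t) ! k) < nsyms M"
  using tm_next_wf[OF _ rd_wf, of "st t"] cfg_wf[of t] by (simp_all add: nx_def)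

lemma run_Suc:
  shows "st (Suc t) = fst (nx t)"
    and "k < ntapes M \<Longrightarrow> hp (Suc t) k = hp t k + move_offset (snd (snd (nx t) ! k))"
    and "k < ntapes M \<Longrightarrow> ce (Suc t) k = (ce t k)(hp t k := fst (snd (nx t) ! k))"
proof -
  have len: "length (snd (cfg t)) = ntapes M" using cfg_wf by blast
  have c: "cfg (Suc t) = (fst (nx t), map2 act_tape (snd (nx t)) (snd (cfg t)))"
    unfolding cfg_Suc tm_step_next[OF len] reads[OF len] nx_def st_def ..
  show "st (Suc t) = fst (nx t)" by (simp add: st_def c)
  assume "k < ntapes M"
  then show "hp (Suc t) k = hp t k + move_offset (snd (snd (nx t) ! k))"
    "ce (Suc t) k = (ce t k)(hp t k := fst (snd (nx t) ! k))"
    using len nx_wf(2) by (simp_all add: hp_def ce_def c act_tape_def)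
qed

lemma run_0: "st 0 = 0" "k < ntapes M \<Longrightarrow> hp 0 k = 0" "ce 0 0 = tape_word w"
  "1 \<le> k \<Longrightarrow> k < ntapes M \<Longrightarrow> ce 0 k = (\<lambda>_. 0)"
  by (auto simp: st_def hp_def ce_def cfg_def tm_init_def nth_Cons' tape_word_Nil)

lemma hp_bound: "k < ntapes M \<Longrightarrow> \<bar>hp t k\<bar> \<le> int t"
proof (induction t)
  case (Suc t)
  have "\<bar>move_offset m\<bar> \<le> 1" for m by (cases m) auto
  from this[of "snd (snd (nx t) ! k)"] show ?case
    using Suc run_Suc(2)[OF Suc.prems, of t] by linarith
qed (simp add: run_0)

lemma rules_iff:
  "(q, as, q', acts) \<in> set (rules M) \<longleftrightarrow> q < nstates M \<and> length as = ntapes M \<and> set as \<subseteq> {..<nsyms M} \<and>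
     q' = fst (tm_next M q as) \<and> acts = map (\<lambda>x. (fst x, mcode (snd x))) (snd (tm_next M q as))"
proof -
  let ?f = "\<lambda>(q, as). (q, as, fst (tm_next M q as), map (\<lambda>x. (fst x, mcode (snd x))) (snd (tm_next M q as)))"
  have "(q, as, q', acts) \<in> set (rules M) \<longleftrightarrow>
      (q, as) \<in> {..<nstates M} \<times> {as. length as = ntapes M \<and> set as \<subseteq> {..<nsyms M}} \<and> (q, as, q', acts) = ?f (q, as)"
    by (auto simp only: rules_def set_map set_product set_n_lists set_upt atLeast0LessThan)
  then show ?thesis by simp
qed

lemma rules_length: "\<forall>r\<in>set (rules M). length (fst (snd r)) = ntapes M \<and> length (snd (snd (snd r))) = ntapes M"
  by (auto simp: rules_iff tm_next_wf(2))

text \<open>Forward derivation along the rules: a satisfying assignment contains at least the facts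
  of the actual run. It may contain others, about which nothing is claimed.\<close>

lemma run_derivable:
  assumes sat: "\<And>t. t < T \<Longrightarrow> satisfies \<tau> (step_clauses M T t)"
    and S0: "\<tau> (fS 0 0)" and H0: "\<And>k. k < ntapes M \<Longrightarrow> \<tau> (fH k 0 T)"
    and C0: "\<And>k j. k < ntapes M \<Longrightarrow> j < 2 * T + 3 \<Longrightarrow> \<tau> (fC k 0 j (ce 0 k (int j - int T)))"
  shows "t \<le> T \<Longrightarrow> \<tau> (fS t (st t)) \<and> (\<forall>k<ntapes M. \<tau> (fH k t (nat (hp t k + int T)))) \<and>
    (\<forall>k<ntapes M. \<forall>j<2 * T + 3. \<tau> (fC k t j (ce t k (int j - int T))))"
proof (induction t)
  case 0
  then show ?case using S0 H0 C0 by (simp add: run_0)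
next
  case (Suc t)
  have step: "satisfies \<tau> (step_clauses M T t)" by (rule sat) (use Suc.prems in simp)
  note cl = step[unfolded satisfies_step[OF rules_length]]
  have IH: "\<tau> (fS t (st t))" "\<And>k. k < ntapes M \<Longrightarrow> \<tau> (fH k t (nat (hp t k + int T)))"
    "\<And>k j. k < ntapes M \<Longrightarrow> j < 2 * T + 3 \<Longrightarrow> \<tau> (fC k t j (ce t k (int j - int T)))"
    using Suc by auto
  define h where "h k = nat (hp t k + int T)" for k
  \<comment> \<open>A head moves by at most one cell per step and here \<open>t < T\<close>, so it
    stays where the clauses for moves apply.\<close>
  have h: "1 \<le> h k" "h k < 2 * T + 1" "int (h k) - int T = hp t k" if "k < ntapes M" for k
    using hp_bound[OF that, of t] Suc.prems by (auto simp: h_def)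
  have clR: "\<tau> (fR k t a)" if "k < ntapes M" "j < 2 * T + 3" "a < nsyms M" "\<tau> (fH k t j)" "\<tau> (fC k t j a)" for k j a
    using cl that by blast
  have clD: "\<tau> (fS (t + 1) (fst (snd (snd r)))) \<and>
      (\<forall>k<ntapes M. \<tau> (fW k t (snd (snd (snd (snd r)) ! k)) (fst (snd (snd (snd r)) ! k))))"
    if "r \<in> set (rules M)" "\<tau> (fS t (fst r))" "\<forall>k<ntapes M. \<tau> (fR k t (fst (snd r) ! k))" for r
    using cl that by blast
  have clW: "\<tau> (fC k (t + 1) j b) \<and> \<tau> (fH k (t + 1) (j + d - 1))"
    if "k < ntapes M" "b < nsyms M" "d < 3" "1 \<le> j" "j < 2 * T + 1" "\<tau> (fW k t d b)" "\<tau> (fH k t j)" for k b d j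
    using cl that by blast
  have clF: "\<tau> (fC k (t + 1) i a)" if "k < ntapes M" "a < nsyms M" "i < 2 * T + 3" "j < 2 * T + 3" "i \<noteq> j"
      "\<tau> (fH k t j)" "\<tau> (fC k t i a)" for k a i j
    using cl that by blast
  have R: "\<tau> (fR k t (rd t ! k))" if k: "k < ntapes M" for k
  proof (rule clR[OF k])
    show "\<tau> (fC k t (h k) (rd t ! k))" using IH(3)[OF k, of "h k"] h[OF k] k by (simp add: rd_def)
    show "rd t ! k < nsyms M" using subsetD[OF rd_wf(2) nth_mem[of k "rd t"]] rd_wf(1)[of t] k by simp
    show "\<tau> (fH k t (h k))" using IH(2)[OF k] by (simp add: h_def)
  qed (use h(2)[OF k] in simp)
  define r where "r = (st t, rd t, fst (nx t), map (\<lambda>x. (fst x, mcode (snd x))) (snd (nx t)))"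
  have "r \<in> set (rules M)"
    using rd_wf cfg_wf[of t] by (simp add: r_def rules_iff nx_def)
  from clD[OF this] have S: "\<tau> (fS (t + 1) (fst (nx t)))"
    and W: "\<And>k. k < ntapes M \<Longrightarrow> \<tau> (fW k t (mcode (snd (snd (nx t) ! k))) (fst (snd (nx t) ! k)))"
    using R IH(1) nx_wf(2)[of t] by (simp_all add: r_def)
  have CH: "\<tau> (fC k (t + 1) (h k) (fst (snd (nx t) ! k))) \<and>
    \<tau> (fH k (t + 1) (h k + mcode (snd (snd (nx t) ! k)) - 1))" if k: "k < ntapes M" for k
    by (rule clW[OF k nx_wf(3)[OF k] mcode(2) h(1)[OF k] h(2)[OF k] W[OF k]]) (use IH(2)[OF k] in \<open>simp add: h_def\<close>)
  have "nat (hp (Suc t) k + int T) = h k + mcode (snd (snd (nx t) ! k)) - 1" if k: "k < ntapes M" for k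
    using h[OF k] mcode(1)[of "snd (snd (nx t) ! k)"] run_Suc(2)[OF k, of t] by linarith
  moreover have "\<tau> (fC k (t + 1) j (ce (Suc t) k (int j - int T)))" if k: "k < ntapes M" and j: "j < 2 * T + 3" for k j
  proof (cases "j = h k")
    case True
    then show ?thesis using CH[OF k] h(3)[OF k] run_Suc(3)[OF k, of t] by simp
  next
    case False
    then have "int j - int T \<noteq> hp t k" using h(3)[OF k] by linarith
    then have ce: "ce (Suc t) k (int j - int T) = ce t k (int j - int T)" using run_Suc(3)[OF k, of t] by simp
    show ?thesis
      unfolding ce
    proof (rule clF[OF k _ j _ False])
      show "ce t k (int j - int T) < nsyms M" using cfg_wf k by blast
      show "\<tau> (fH k t (h k))" using IH(2)[OF k] by (simp add: h_def)
      show "\<tau> (fC k t j (ce t k (int j - int T)))" by (rule IH(3)[OF k j])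
    qed (use h(2)[OF k] in simp)
  qed
  ultimately show ?case using S CH run_Suc(1)[of t] by simp
qed

text \<open>The converse of \<open>run_derivable\<close>: the facts that are true of the actual run
  form a satisfying assignment.\<close>

lemma run_satisfies_step:
  fixes T :: nat
  defines "\<tau> \<equiv> \<lambda>(r, k, t, j, a). if r = 0 then st t = a else if r = 1 then ce t k (int j - int T) = a
     else if r = 2 then hp t k = int j - int T else if r = 3 then ce t k (hp t k) = a
     else fst (snd (nx t) ! k) = a \<and> mcode (snd (snd (nx t) ! k)) = (j :: nat)"
  shows "satisfies \<tau> (step_clauses M T t)"
proof -
  have \<tau>: "\<tau> (fS t q) \<longleftrightarrow> st t = q" "\<tau> (fC k t j a) \<longleftrightarrow> ce t k (int j - int T) = a"
    "\<tau> (fH k t j) \<longleftrightarrow> hp t k = int j - int T" "\<tau> (fR k t a) \<longleftrightarrow> ce t k (hp t k) = a"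
    "\<tau> (fW k t d b) \<longleftrightarrow> fst (snd (nx t) ! k) = b \<and> mcode (snd (snd (nx t) ! k)) = d" for t k q j a d b
    by (simp_all add: \<tau>_def fact_defs)
  show ?thesis
    unfolding satisfies_step[OF rules_length] \<tau>
  proof (intro conjI allI impI ballI)
    fix r assume r: "r \<in> set (rules M)" and pre: "st t = fst r \<and> (\<forall>k<ntapes M. ce t k (hp t k) = fst (snd r) ! k)"
    obtain q as q' acts where req: "r = (q, as, q', acts)" by (metis prod.collapse)
    have as: "as = rd t" using pre bspec[OF rules_length r] by (auto simp: req rd_def intro!: nth_equalityI)
    have q: "q = st t" using pre by (simp add: req)
    have nx: "q' = fst (nx t)" "acts = map (\<lambda>x. (fst x, mcode (snd x))) (snd (nx t))"
      using r by (simp_all add: req rules_iff as q nx_def)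
    show "st (t + 1) = fst (snd (snd r))" by (simp add: req nx run_Suc)
    fix k assume "k < ntapes M"
    then show "fst (snd (nx t) ! k) = fst (snd (snd (snd r)) ! k)" "mcode (snd (snd (nx t) ! k)) = snd (snd (snd (snd r)) ! k)"
      using nx_wf(2)[of t] by (simp_all add: req nx)
  next
    fix k b d j assume k: "k < ntapes M" and j: "1 \<le> j \<and> j < 2 * T + 1"
      and W: "fst (snd (nx t) ! k) = b \<and> mcode (snd (snd (nx t) ! k)) = d" and H: "hp t k = int j - int T"
    show "ce (t + 1) k (int j - int T) = b" using W H run_Suc(3)[OF k, of t] by simp
    show "hp (t + 1) k = int (j + d - 1) - int T"
      using W H j run_Suc(2)[OF k, of t] mcode(1)[of "snd (snd (nx t) ! k)"] by (simp add: of_nat_diff)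
  qed (auto simp: run_Suc)
qed

end

lemma run_clauses_complete:
  assumes wf: "wf_tm M" and T: "2 * length x + 2 + L \<le> T" and u: "length u \<le> L"
    and acc: "ce M (word_pair x u) T (ntapes M - 1) 0 \<noteq> 1"
  shows "\<exists>\<tau>. satisfies \<tau> (run_clauses M x T L)"
proof -
  define w where "w = word_pair x u"
  define \<tau> :: "fact \<Rightarrow> bool" where "\<tau> = (\<lambda>(r, k, t, j, a). if r = 0 then st M w t = a
     else if r = 1 then ce M w t k (int j - int T) = a
     else if r = 2 then hp M w t k = int j - int T else if r = 3 then ce M w t k (hp M w t k) = a
     else fst (snd (nx M w t) ! k) = a \<and> mcode (snd (snd (nx M w t) ! k)) = j)"
  have \<tau>: "\<tau> (fS t q) \<longleftrightarrow> st M w t = q" "\<tau> (fC k t j a) \<longleftrightarrow> ce M w t k (int j - int T) = a"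
    "\<tau> (fH k t j) \<longleftrightarrow> hp M w t k = int j - int T" for t k q j a
    by (simp_all add: \<tau>_def fact_defs)
  have K: "ntapes M \<ge> 1" using wf by (simp add: wf_tm_def)
  have lw: "length w = 2 * length x + 2 + length u" by (simp add: w_def)
  have word: "tape_word w (int i) = sym_of (prefix x ! i)" if "i < 2 * length x + 2" for i
    using that length_prefix[of x] by (simp add: tape_word_def w_def word_pair_prefix nth_append)
  have "satisfies \<tau> (init_clauses M x T L)"
    unfolding satisfies_init \<tau>
  proof (intro conjI allI impI)
    fix i assume "i < L"
    show "ce M w 0 0 (int (T + (2 * length x + 2) + i) - int T) = 0 \<or> ce M w 0 0 (int (T + (2 * length x + 2) + i) - int T) = 1 \<or>
        ce M w 0 0 (int (T + (2 * length x + 2) + i) - int T) = 2"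
      unfolding run_0[OF wf] by (simp add: tape_word_def)
  next
    fix i assume "ce M w 0 0 (int (T + (2 * length x + 2) + i) - int T) = 0"
    then show "ce M w 0 0 (int (T + (2 * length x + 2) + i + 1) - int T) = 0"
      unfolding run_0[OF wf] by (auto simp: tape_word_def split: if_splits)
  next
    fix i assume "i < 2 * length x + 2"
    then show "ce M w 0 0 (int (T + i) - int T) = sym_of (prefix x ! i)"
      unfolding run_0[OF wf] using word by simp
  next
    fix j assume "j < T"
    then show "ce M w 0 0 (int j - int T) = 0" unfolding run_0[OF wf] by (simp add: tape_word_neg)
  next
    fix j assume "T + (2 * length x + 2) + L \<le> j \<and> j < 2 * T + 3"
    then show "ce M w 0 0 (int j - int T) = 0" unfolding run_0[OF wf] using u lw by (auto simp: tape_word_def)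
  qed (use run_0[OF wf] in auto)
  moreover have "satisfies \<tau> (step_clauses M T t)" for t
    using run_satisfies_step[OF wf, where T = T and w = w and t = t] unfolding \<tau>_def .
  moreover have "\<not> \<tau> (fC (ntapes M - 1) T T 1)" unfolding \<tau> using acc by (simp add: w_def)
  ultimately show ?thesis unfolding run_clauses_def by (intro exI[of _ \<tau>]) auto
qed

lemma run_clauses_sound:
  assumes wf: "wf_tm M" and T: "2 * length x + 2 + L \<le> T" and sat: "satisfies \<tau> (run_clauses M x T L)"
  shows "\<exists>u. length u \<le> L \<and> ce M (word_pair x u) T (ntapes M - 1) 0 \<noteq> 1"
proof -
  have K: "ntapes M \<ge> 1" using wf by (simp add: wf_tm_def)
  have init: "satisfies \<tau> (init_clauses M x T L)" and step: "\<And>t. t < T \<Longrightarrow> satisfies \<tau> (step_clauses M T t)"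
    and fin: "\<not> \<tau> (fC (ntapes M - 1) T T 1)"
    using sat unfolding run_clauses_def by auto
  note cl = init[unfolded satisfies_init]
  let ?l = "2 * length x + 2"
  \<comment> \<open>The first certificate cell marked blank gives the length of \<open>u\<close>.
    The alternative \<open>i \<ge> L\<close> makes the minimum exist when none is marked.\<close>
  define n where "n = (LEAST i. i \<ge> L \<or> \<tau> (fC 0 0 (T + ?l + i) 0))"
  have n: "n \<ge> L \<or> \<tau> (fC 0 0 (T + ?l + n) 0)" unfolding n_def by (rule LeastI[of _ L]) simp
  have nL: "n \<le> L" unfolding n_def by (rule Least_le) simp
  have less: "\<not> \<tau> (fC 0 0 (T + ?l + i) 0)" if "i < n" for i using not_less_Least that unfolding n_def by blast
  \<comment> \<open>A cell may be marked with several symbols; mark 2 takes precedence. If it is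
    absent, mark 1 must be present, because cells before \<open>n\<close> are not marked
    blank.\<close>
  define u where "u = map (\<lambda>i. \<tau> (fC 0 0 (T + ?l + i) 2)) [0..<n]"
  define w where "w = word_pair x u"
  have w: "w = prefix x @ u" "length w = ?l + n" by (simp_all add: w_def word_pair_prefix length_prefix u_def)
  \<comment> \<open>Up to \<open>L\<close> blanks spread by the implications, beyond it they are
    given by unit clauses.\<close>
  have blank: "\<tau> (fC 0 0 (T + ?l + i) 0)" if "n \<le> i" "T + ?l + i < 2 * T + 3" for i
    using that
  proof (induction i rule: dec_induct)
    case base
    then show ?case using n nL cl by auto
  next
    case (step i)
    then have "\<tau> (fC 0 0 (T + ?l + i) 0)" by simp
    moreover have "\<tau> (fC 0 0 (T + ?l + Suc i) 0)" if "L \<le> Suc i"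
      using cl that step.prems by auto
    ultimately show ?case using cl by (cases "i < L") auto
  qed
  have C0: "\<tau> (fC 0 0 j (tape_word w (int j - int T)))" if j: "j < 2 * T + 3" for j
  proof -
    consider "j < T" | "T \<le> j" "j < T + ?l" | "T + ?l \<le> j" "j < T + ?l + n" | "T + ?l + n \<le> j" by linarith
    then show ?thesis
    proof cases
      case 1
      then show ?thesis using cl by (simp add: tape_word_neg)
    next
      case 2
      define i where "i = j - T"
      have i: "j = T + i" "i < ?l" using 2 by (auto simp: i_def)
      have "tape_word w (int j - int T) = sym_of (prefix x ! i)"
        using i length_prefix[of x] by (simp add: tape_word_def w nth_append)
      then show ?thesis using cl i by simp
    next
      case 3
      define i where "i = j - T - ?l"
      have i: "j = T + ?l + i" "i < n" using 3 by (auto simp: i_def)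
      have "nat (int j - int T) = length (prefix x) + i" using i length_prefix[of x] by simp
      then have "w ! nat (int j - int T) = u ! i" unfolding w(1) by (simp only: nth_append_length_plus)
      then have "tape_word w (int j - int T) = sym_of (u ! i)" using i by (simp add: tape_word_def w(2))
      moreover have "\<tau> (fC 0 0 (T + ?l + i) (sym_of (u ! i)))"
      proof -
        have "i < L" using i(2) nL by simp
        then have "\<tau> (fC 0 0 (T + ?l + i) 1) \<or> \<tau> (fC 0 0 (T + ?l + i) 2)" using cl less[OF i(2)] by blast
        then show ?thesis using i(2) by (auto simp: u_def)
      qed
      ultimately show ?thesis using i(1) by simp
    next
      case 4
      define i where "i = j - T - ?l"
      have i: "j = T + ?l + i" "n \<le> i" using 4 by (auto simp: i_def)
      have "tape_word w (int j - int T) = 0" using 4 by (simp add: tape_word_def w(2))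
      then show ?thesis using blank[OF i(2)] i(1) j by simp
    qed
  qed
  have "\<tau> (fC (ntapes M - 1) T T (ce M w T (ntapes M - 1) (int T - int T)))"
  proof -
    have "\<tau> (fC k 0 j (ce M w 0 k (int j - int T)))" if "k < ntapes M" "j < 2 * T + 3" for k j
      using C0[OF that(2)] cl that by (cases "k = 0") (auto simp: run_0[OF wf])
    moreover have "\<tau> (fS 0 0)" "\<And>k. k < ntapes M \<Longrightarrow> \<tau> (fH k 0 T)" using cl by simp_all
    ultimately have "\<forall>k<ntapes M. \<forall>j<2 * T + 3. \<tau> (fC k T j (ce M w T k (int j - int T)))"
      using run_derivable[OF wf step, where w = w and t = T] by simp
    moreover have "ntapes M - 1 < ntapes M" "T < 2 * T + 3" using K by auto
    ultimately show ?thesis by blast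
  qed
  then have "ce M w T (ntapes M - 1) 0 \<noteq> 1" using fin by auto
  then show ?thesis using nL by (intro exI[of _ u]) (simp add: u_def w_def)
qed

lemma all_facts_iff:
  "(r, k, t, j, a) \<in> set (all_facts M T) \<longleftrightarrow>
     r < 5 \<and> k < ntapes M \<and> t \<le> T \<and> j < 2 * T + 4 \<and> a < nstates M + nsyms M + 3"
  by (auto simp: all_facts_def)

lemma distinct_all_facts: "distinct (all_facts M T)"
  unfolding all_facts_def by (intro distinct_product distinct_upt)

lemma run_clauses_facts:
  assumes wf: "wf_tm M" and T: "2 * length x + 2 + L \<le> T"
    and c: "c \<in> set (run_clauses M x T L)" and l: "l \<in> set c"
  shows "snd l \<in> set (all_facts M T)"
proof -
  have K: "1 \<le> ntapes M" "2 \<le> nstates M" "3 \<le> nsyms M" using wf by (auto simp: wf_tm_def)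
  let ?F = "\<lambda>cs. \<forall>c\<in>set cs. \<forall>l\<in>set c. snd l \<in> set (all_facts M T)"
  have "?F (init_clauses M x T L)"
    using K T unfolding init_clauses_def fact_defs
    by (auto simp: all_facts_iff dest!: set_zip_leftD split: if_splits)
  moreover have "?F (step_clauses M T t)" if t: "t < T" for t
  proof -
    have rl: "?F (rule_clauses M t r)" if r: "r \<in> set (rules M)" for r
    proof -
      obtain q as q' acts where req: "r = (q, as, q', acts)" by (metis prod.collapse)
      have q: "q < nstates M" "length as = ntapes M" "set as \<subseteq> {..<nsyms M}"
        "q' = fst (tm_next M q as)" "acts = map (\<lambda>x. (fst x, mcode (snd x))) (snd (tm_next M q as))"
        using r rules_iff[OF wf] unfolding req by blast+
      note nxt = tm_next_wf[OF wf q(1,2,3)]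
      have "fst y < nsyms M \<and> snd y < 3" if "y \<in> set acts" for y
      proof -
        obtain i where i: "i < length (snd (tm_next M q as))" "y = (\<lambda>x. (fst x, mcode (snd x))) (snd (tm_next M q as) ! i)"
          using \<open>y \<in> set acts\<close> unfolding q(5) by (auto simp: in_set_conv_nth)
        then show ?thesis using nxt(2) nxt(3)[of i] mcode(2) by simp
      qed
      moreover have "a < nsyms M" if "a \<in> set as" for a using that q(3) by blast
      moreover have "q' < nstates M" using nxt(1) q(4) by simp
      ultimately show ?thesis
        using K t q(1) unfolding rule_clauses_def Let_def fact_defs req
        by (fastforce simp: all_facts_iff dest: set_zip_leftD set_zip_rightD)
    qed
    have "?F (concat (map (rule_clauses M t) (rules M)))"
      unfolding set_concat set_map using rl by blast
    then show ?thesis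
      unfolding step_clauses_def set_append ball_Un
      by (intro conjI) (use K t in \<open>auto simp: fact_defs all_facts_iff split: if_splits\<close>)
  qed
  moreover have "?F [[(False, fC (ntapes M - 1) T T 1)]]"
    using K by (simp add: fact_defs all_facts_iff)
  ultimately have "?F (run_clauses M x T L)"
    unfolding run_clauses_def set_append ball_Un set_concat set_map by auto
  then show ?thesis using c l by blast
qed

subsection \<open>The reduction\<close>

lemma ptime_product [ptime_intro]:
  assumes "ptime xs" and "ptime ys"
  shows "ptime (\<lambda>x. List.product (xs x) (ys x))"
  unfolding product_concat_map by (intro ptime_intro assms ptime_comp[OF assms(2)])

lemma ptime_all_facts0: "ptime (all_facts M)"
  unfolding all_facts_def[abs_def] by (intro ptime_intro)

lemmas ptime_all_facts = ptime_comp[OF ptime_all_facts0]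

lemma ptime_prefix0: "ptime prefix"
  unfolding prefix_def[abs_def] by (intro ptime_intro)

lemmas ptime_prefix [ptime_intro] = ptime_comp[OF ptime_prefix0]

lemma ptime_init_clauses0: "ptime (\<lambda>p. init_clauses M (fst p) (fst (snd p)) (snd (snd p)))"
  unfolding init_clauses_def fact_defs by (intro ptime_intro)

lemma ptime_rule_clauses0: "ptime (\<lambda>p. rule_clauses M (fst p) (snd p))"
  unfolding rule_clauses_def Let_def fact_defs by (intro ptime_intro)

lemmas ptime_rule_clauses [ptime_intro] = ptime_comp2[OF ptime_rule_clauses0]

lemma ptime_step_clauses0: "ptime (\<lambda>p. step_clauses M (fst p) (snd p))"
  unfolding step_clauses_def fact_defs by (intro ptime_intro)

lemmas ptime_init_clauses [ptime_intro] = ptime_comp3[OF ptime_init_clauses0]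
lemmas ptime_step_clauses [ptime_intro] = ptime_comp2[OF ptime_step_clauses0]

lemma ptime_run_clauses0: "ptime (\<lambda>p. run_clauses M (fst p) (fst (snd p)) (snd (snd p)))"
  unfolding run_clauses_def fact_defs by (intro ptime_intro)

lemmas ptime_run_clauses = ptime_comp3[OF ptime_run_clauses0]

theorem ATL_Learn_NP_hard: "NP_hard (ATL_Learn 3 {op_of g} Bl n)"
  unfolding NP_hard_def
proof
  fix A assume "A \<in> NP_class"
  then obtain V q where "V \<in> P_class"
    and A: "\<And>x. x \<in> A \<longleftrightarrow> (\<exists>u. length u \<le> poly q (length x) \<and> word_pair x u \<in> V)"
    unfolding NP_class_def by blast
  then obtain M p where wf: "wf_tm M" and comp: "computes_in_time M (\<lambda>w. [w \<in> V]) (poly p)"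
    unfolding P_class_def poly_time_computable_def by blast
  define L where "L x = poly q (length x)" for x :: "bool list"
  \<comment> \<open>The running time on the longest admissible pair, plus the length of that pair,
    so that the cells also cover the whole input.\<close>
  define T where "T x = poly p (2 * length x + 2 + L x) + (2 * length x + 2 + L x)" for x :: "bool list"
  have T: "2 * length x + 2 + L x \<le> T x" for x by (simp add: T_def)
  have out: "ce M (word_pair x u) (T x) (ntapes M - 1) 0 = sym_of (word_pair x u \<in> V)"
    if "length u \<le> L x" for x u
  proof -
    define w where "w = word_pair x u"
    define t where "t = poly p (length w)"
    have fin: "fst (cfg M w t) = 1" "snd (last (snd (cfg M w t))) = tape_word [w \<in> V]"
      using comp unfolding computes_in_time_def Let_def cfg_def[OF wf] t_def by blast+
    have "t \<le> T x" using that poly_nat_mono[of "length w" "2 * length x + 2 + L x" p] by (simp add: t_def T_def w_def)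
    \<comment> \<open>The halted configuration persists, so the answer can be read at the common
      time \<open>T x\<close>, whatever the length of the certificate.\<close>
    moreover have "cfg M w (t + d) = cfg M w t" for d
      by (induction d) (simp_all add: cfg_Suc[OF wf] tm_step_def fin)
    ultimately have "cfg M w (T x) = cfg M w t" by (metis le_add_diff_inverse)
    moreover have "length (snd (cfg M w t)) = ntapes M" using cfg_wf[OF wf] by blast
    moreover have "ntapes M \<ge> 1" using wf by (simp add: wf_tm_def)
    ultimately have "ce M w (T x) (ntapes M - 1) = tape_word [w \<in> V]"
      using fin(2) by (simp add: ce_def[OF wf] last_conv_nth flip: length_greater_0_conv)
    then show ?thesis by (simp add: w_def tape_word_def)
  qed
  define f where "f x = sat_instance g (all_facts M (T x)) (run_clauses M x (T x) (L x))" for x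
  have "x \<in> A \<longleftrightarrow> f x \<in> ATL_Learn 3 {op_of g} Bl n" for x
  proof -
    have "x \<in> A \<longleftrightarrow> (\<exists>u. length u \<le> L x \<and> ce M (word_pair x u) (T x) (ntapes M - 1) 0 \<noteq> 1)"
      unfolding A L_def[symmetric] using out by (metis (no_types, lifting) n_not_Suc_n numeral_2_eq_2 One_nat_def)
    also have "\<dots> \<longleftrightarrow> (\<exists>\<tau>. satisfies \<tau> (run_clauses M x (T x) (L x)))"
      using run_clauses_complete[OF wf T] run_clauses_sound[OF wf T] by blast
    also have "\<dots> \<longleftrightarrow> f x \<in> ATL_Learn 3 {op_of g} Bl n"
      unfolding f_def
      by (rule sat_instance_in_ATL_Learn[symmetric]) (use distinct_all_facts run_clauses_facts[OF wf T] in blast)+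
    finally show ?thesis .
  qed
  moreover have "ptime f"
  proof -
    have L: "ptime L" unfolding L_def[abs_def] by (intro ptime_intro)
    have T: "ptime T" unfolding T_def[abs_def] by (intro ptime_intro L)
    show ?thesis
      unfolding f_def[abs_def]
      by (intro ptime_sat_instance ptime_all_facts ptime_run_clauses ptime_id T L)
  qed
  ultimately show "poly_time_reducible A (ATL_Learn 3 {op_of g} Bl n)"
    unfolding poly_time_reducible_def using poly_time_computable_ptime by blast
qed

theorem theorem10:
  fixes Bl :: "bin_lg set" and n :: nat
  shows "NP_complete (ATL_Learn 3 {Finally} Bl n) \<and> NP_complete (ATL_Learn 3 {Globally} Bl n)"
  using ATL_Learn_in_NP[of False] ATL_Learn_in_NP[of True] ATL_Learn_NP_hard[of False] ATL_Learn_NP_hard[of True]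
  by (simp add: NP_complete_def)

end
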